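(* Assume $\zeta>0$ and set $T(\zeta):=\frac{N_1-\tau}{\zeta}$. Let $(\sigma_0,\sigma_1)\in(0,\infty)\times(1,\infty)$. There exist $\epsilon_0>0$ and $C>0$ such that for all $\epsilon<\epsilon_0$ the following is true. Suppose $(\chi_0,\chi_1,N_0)$ is a set of classical shock front initial data with initial shock front $\sigma_0$ such that there exists $r>0$ such that $$B:=\sup_{s\in[\sigma_0,\infty)}\Bigl[|\chi_0'(s)-\tau|+s^{r+2}|\chi_0''(s)|+\bigl|\chi_1(s)-[\zeta(s-\sigma_0)+\sigma_1(N_1-\tau)]\bigr|+s^{r+2}|\chi_1'(s)-\zeta|\Bigr]<\epsilon.$$ Then the unique classical shock solution $(\chi,N)$ with initial data $(\chi_0,\chi_1,N_0)$, with shock front $\sigma$, has final time of existence $T_+=T(\zeta)$, and the state variables and shock speed remain close to and asymptotically approach those of a piece-wise constant stretched motion as $t\to T(\zeta)$: there exists $\sigma_1^\infty\in(1,\infty)$ such that $\bigl|\frac{\sigma_1^\infty}{\sigma_1}-1\bigr|\le C\epsilon$ and for all $t\in[0,T(\zeta))$ (writing $\sigma=\sigma(t)$): $$\sup_{s\in[\sigma(t),\infty)}s^{r+2}\bigl[|\chi_{ss}(s,t)|+|\chi_{st}(s,t)-\zeta|\bigr]\le CB,$$ $$\sup_{s\in[\sigma(t),\infty)}\Bigl[|\chi_s(s,t)-(\zeta t+\tau)|+\bigl|\chi_t(s,t)-[\zeta(s-\sigma_0)+\sigma_1^\infty(N_1-\tau)]\bigr|\Bigr]\le CB\,(T(\zeta)-t)^{1+r},$$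 $$\left|\sigma'(t)\Bigl(\frac{\zeta(\sigma-\sigma_0)+\sigma_1^\infty(N_1-\tau)}{N_1-(\zeta t+\tau)}\Bigr)^{-1}-1\right|\le CB\,(T(\zeta)-t)^{r},$$ $$\sup_{s\in[0,\sigma(t)]}\left|N(s,t)\Bigl(\frac{[\zeta(\sigma-\sigma_0)+\sigma_1^\infty(N_1-\tau)]^2}{N_1-(\zeta t+\tau)}\Bigr)^{-1}-1\right|\le CB\,(T(\zeta)-t)^{r}.$$
   Context: Standing constants (units chosen so that mass density and elastic modulus equal $1$): $N_1>1$, $0<\eta<N_1$, $\tau\in(\eta,N_1)$, $\zeta\ge 0$ are fixed. Here $\chi(s,t)$ is the position at time $t$ of the particle $s\in[0,\infty)$ of a string and $N(s,t)$ its tension. For a function $g$, $g(\infty)$ means $\lim_{s\to\infty}g(s)$; likewise $g(\infty,t)=\lim_{s\to\infty}g(s,t)$. A superscript $+$ as in $g(\sigma^+,t)$ denotes the limit from the right in $s$. At the interface between two regions, values are understood as one-sided limits from the region in question (so suprema over $[\sigma(t),\infty)$ use values from $\mathcal E_\sigma$ and suprema over $[0,\sigma(t)]$ use values from $\mathcal I_\sigma$, both defined below). Classical shock front initial data: a triple $(\chi_0,\chi_1,N_0)$ of real-valued functions in $C([0,\infty))\times L^\infty([0,\infty))\times L^\infty([0,\infty))$ for which there is a unique $\sigma_0\in(0,\infty)$ (the initial shock front) such that (1) $\chi_0\in C^2([\sigma_0,\infty))$, $\chi_1\in C^1([\sigma_0,\infty))$, $N_0\in C^1([\sigma_0,\infty))$;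 (2) for all $s\in[\sigma_0,\infty)$, $N_0(s)=\chi_0'(s)$ and $\eta<N_0(s)<N_1$; (3) $\chi_0'(\infty)=\tau$, $\chi_1'(\infty)=\zeta$, $\chi_0(\sigma_0)=N_1\sigma_0$; (4) $v_0:=\dfrac{\chi_1(\sigma_0^+)}{N_1-\chi_0'(\sigma_0^+)}>1$; (5) for all $s\in[0,\sigma_0]$: $\chi_0(s)=N_1 s$, $\chi_1(s)=0$, $N_0(s)=N_0(\sigma_0^+)+v_0^2\,(N_1-N_0(\sigma_0^+))>N_1$. Classical shock solution on $[0,T]$ with initial data $(\chi_0,\chi_1,N_0)$: a pair $(\chi,N)$ with $\chi\in C([0,\infty)\times[0,T])$, $N\in L^\infty([0,\infty)\times[0,T])$, $\partial_t\chi\in L^\infty([0,\infty)\times[0,T])$, for which there is a unique curve $\sigma\in C^2([0,T];[\sigma_0,\infty))$ (the shock front) with $\sigma(0)=\sigma_0$ such that, with $\mathcal E_\sigma=\{(s,t):t\in[0,T],\ s\in[\sigma(t),\infty)\}$ and $\mathcal I_\sigma=\{(s,t):t\in[0,T],\ s\in[0,\sigma(t)]\}$ (writing $\sigma=\sigma(t)$), (1) $\chi\in C^2(\mathcal E_\sigma)$ and $N\in C^1(\mathcal E_\sigma)$; (2) on $\mathcal E_\sigma$: $N=\chi_s$ and $\eta<N<N_1$; (3) $\chi(\sigma^+,t)=N_1\sigma$; (4) $\sigma'(t)=\dfrac{\chi_t(\sigma^+,t)}{N_1-N(\sigma^+,t)}>1$; (5) on $\mathcal I_\sigma$: $\chi(s,t)=N_1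 s$ and $N(s,t)=N(\sigma^+,t)+(\sigma')^2(N_1-N(\sigma^+,t))>N_1$; (6) on $\mathcal E_\sigma$: $\chi_{tt}=\chi_{ss}$, $\chi_s(\infty,t)=\zeta t+\tau$, and $\chi(s,0)=\chi_0(s)$, $\chi_t(s,0)=\chi_1(s)$ for $s\ge\sigma_0$. A shock solution on a half-open interval $[0,T)$ is a pair that is a classical shock solution on $[0,T']$ for every $T'<T$. For given initial data the classical shock solution is unique on any interval on which it exists; its final time of existence $T_+\in(0,\infty]$ is the largest time such that it is a shock solution on $[0,T_+)$. "The unique classical shock solution with given initial data" means the one on $[0,T_+)$. Piece-wise constant stretched motion with parameters $(a,b)\in(0,\infty)\times(1,\infty)$: the motion on $[0,T(\zeta))$ with shock front $\sigma(t)=a+\frac{b(N_1-\tau)t}{N_1-(\zeta t+\tau)}$ and, for $s\ge\sigma(t)$, $\chi(s,t)=N_1a+(\zeta t+\tau)(s-a)+b(N_1-\tau)t$, $N(s,t)=\zeta t+\tau$, extended to $s\in[0,\sigma(t)]$ by (5).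
   Formalization: χ_1 and χ_t are only required to be locally bounded (bounded data cannot exist when ζ>0); ε_0 and C may depend on r (uniformity in r fails); in the last estimate the reference tension is (ζt+τ)+[…]²/(N_1−(ζt+τ)), since the printed one fails for B=0. *)

theory Defs
  imports "HOL-Analysis.Analysis"
begin

definition Linf_on :: "'a::euclidean_space set \<Rightarrow> ('a \<Rightarrow> real) \<Rightarrow> bool" where
  "Linf_on S f \<longleftrightarrow>
     f \<in> borel_measurable (lebesgue_on S) \<and> (\<exists>K. AE x in lebesgue_on S. \<bar>f x\<bar> \<le> K)"

definition Linf_loc_on :: "'a::euclidean_space set \<Rightarrow> ('a \<Rightarrow> real) \<Rightarrow> bool" where
  "Linf_loc_on S f \<longleftrightarrow> (\<forall>K. compact K \<and> K \<subseteq> S \<longrightarrow> Linf_on K f)"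

text \<open>All derivatives are taken within the closed set on which the function is considered; at
  boundary points they are one-sided.\<close>

definition deriv_on :: "real set \<Rightarrow> (real \<Rightarrow> real) \<Rightarrow> real \<Rightarrow> real" where
  "deriv_on S f x = vector_derivative f (at x within S)"

definition C1_on :: "real set \<Rightarrow> (real \<Rightarrow> real) \<Rightarrow> bool" where
  "C1_on S f \<longleftrightarrow> f differentiable_on S \<and> continuous_on S (deriv_on S f)"

definition C2_on :: "real set \<Rightarrow> (real \<Rightarrow> real) \<Rightarrow> bool" where
  "C2_on S f \<longleftrightarrow> C1_on S f \<and> C1_on S (deriv_on S f)"

text \<open>Partial derivatives are components of the total derivative within the region. A partial
  difference quotient would not do: below, the point where the front starts at time 0 has no
  neighbour in the region with the same first coordinate.\<close>

definition pd_s :: "(real \<times> real) set \<Rightarrow> (real \<times> real \<Rightarrow> real) \<Rightarrow> real \<times> real \<Rightarrow> real" where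
  "pd_s E f p = frechet_derivative f (at p within E) (1, 0)"

definition pd_t :: "(real \<times> real) set \<Rightarrow> (real \<times> real \<Rightarrow> real) \<Rightarrow> real \<times> real \<Rightarrow> real" where
  "pd_t E f p = frechet_derivative f (at p within E) (0, 1)"

definition C1_region :: "(real \<times> real) set \<Rightarrow> (real \<times> real \<Rightarrow> real) \<Rightarrow> bool" where
  "C1_region E f \<longleftrightarrow>
     f differentiable_on E \<and> continuous_on E (pd_s E f) \<and> continuous_on E (pd_t E f)"

definition C2_region :: "(real \<times> real) set \<Rightarrow> (real \<times> real \<Rightarrow> real) \<Rightarrow> bool" where
  "C2_region E f \<longleftrightarrow> C1_region E f \<and> C1_region E (pd_s E f) \<and> C1_region E (pd_t E f)"

text \<open>The velocity and the tension jump across the front. On the front itself their value is the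
  limit from the region under consideration; the value the function happens to have there is never
  used.\<close>

definition right_trace :: "real \<Rightarrow> (real \<Rightarrow> real) \<Rightarrow> real \<Rightarrow> real" where
  "right_trace a f s = (if s = a then Lim (at_right a) f else f s)"

definition left_trace :: "real \<Rightarrow> (real \<Rightarrow> real) \<Rightarrow> real \<Rightarrow> real" where
  "left_trace a f s = (if s = a then Lim (at_left a) f else f s)"

definition ext_trace :: "(real \<Rightarrow> real) \<Rightarrow> (real \<times> real \<Rightarrow> real) \<Rightarrow> real \<times> real \<Rightarrow> real" where
  "ext_trace \<sigma> f = (\<lambda>(s, t). right_trace (\<sigma> t) (\<lambda>x. f (x, t)) s)"

definition int_trace :: "(real \<Rightarrow> real) \<Rightarrow> (real \<times> real \<Rightarrow> real) \<Rightarrow> real \<times> real \<Rightarrow> real" where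
  "int_trace \<sigma> f = (\<lambda>(s, t). left_trace (\<sigma> t) (\<lambda>x. f (x, t)) s)"

definition ext_region :: "(real \<Rightarrow> real) \<Rightarrow> real set \<Rightarrow> (real \<times> real) set" where
  "ext_region \<sigma> J = {(s, t). t \<in> J \<and> \<sigma> t \<le> s}"

definition int_region :: "(real \<Rightarrow> real) \<Rightarrow> real set \<Rightarrow> (real \<times> real) set" where
  "int_region \<sigma> J = {(s, t). t \<in> J \<and> 0 \<le> s \<and> s \<le> \<sigma> t}"

context
  fixes N1 \<eta> \<tau> \<zeta> :: real
begin

text \<open>The velocity is only required to be locally bounded: as \<open>chi1'\<close> tends to \<open>\<zeta>\<close> at infinity, it
  grows linearly when \<open>\<zeta> > 0\<close>. The same applies to \<open>chi_t\<close> below.\<close>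

definition initial_front_conditions ::
  "(real \<Rightarrow> real) \<Rightarrow> (real \<Rightarrow> real) \<Rightarrow> (real \<Rightarrow> real) \<Rightarrow> real \<Rightarrow> bool" where
  "initial_front_conditions chi0 chi1 N0 \<sigma>0 \<longleftrightarrow>
     (let X = {\<sigma>0..};
          chi0' = deriv_on X chi0;
          chi1R = right_trace \<sigma>0 chi1;
          N0R = right_trace \<sigma>0 N0;
          v0 = chi1R \<sigma>0 / (N1 - chi0' \<sigma>0)
      in 0 < \<sigma>0
       \<and> C2_on X chi0 \<and> C1_on X chi1R \<and> C1_on X N0R
       \<and> (\<forall>s\<in>X. N0R s = chi0' s \<and> \<eta> < N0R s \<and> N0R s < N1)
       \<and> (chi0' \<longlongrightarrow> \<tau>) at_top \<and> (deriv_on X chi1R \<longlongrightarrow> \<zeta>) at_top \<and> chi0 \<sigma>0 = N1 * \<sigma>0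
       \<and> v0 > 1
       \<and> (\<forall>s\<in>{0..\<sigma>0}. chi0 s = N1 * s \<and> left_trace \<sigma>0 chi1 s = 0
             \<and> left_trace \<sigma>0 N0 s = N0R \<sigma>0 + v0\<^sup>2 * (N1 - N0R \<sigma>0)
             \<and> left_trace \<sigma>0 N0 s > N1))"

definition classical_shock_data ::
  "(real \<Rightarrow> real) \<Rightarrow> (real \<Rightarrow> real) \<Rightarrow> (real \<Rightarrow> real) \<Rightarrow> bool" where
  "classical_shock_data chi0 chi1 N0 \<longleftrightarrow>
     continuous_on {0..} chi0 \<and> Linf_loc_on {0..} chi1 \<and> Linf_on {0..} N0
     \<and> (\<exists>!\<sigma>0. initial_front_conditions chi0 chi1 N0 \<sigma>0)"

definition initial_shock_front ::
  "(real \<Rightarrow> real) \<Rightarrow> (real \<Rightarrow> real) \<Rightarrow> (real \<Rightarrow> real) \<Rightarrow> real" where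
  "initial_shock_front chi0 chi1 N0 = (THE \<sigma>0. initial_front_conditions chi0 chi1 N0 \<sigma>0)"

definition front_conditions ::
  "(real \<Rightarrow> real) \<Rightarrow> (real \<Rightarrow> real) \<Rightarrow> (real \<Rightarrow> real) \<Rightarrow> real \<Rightarrow>
   (real \<times> real \<Rightarrow> real) \<Rightarrow> (real \<times> real \<Rightarrow> real) \<Rightarrow> (real \<Rightarrow> real) \<Rightarrow> bool" where
  "front_conditions chi0 chi1 N0 T chi N \<sigma> \<longleftrightarrow>
     (let J = {0..T};
          E = ext_region \<sigma> J;
          I = int_region \<sigma> J;
          \<sigma>0 = initial_shock_front chi0 chi1 N0;
          \<sigma>' = deriv_on J \<sigma>;
          NE = ext_trace \<sigma> N;
          NI = int_trace \<sigma> N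
      in C2_on J \<sigma> \<and> \<sigma> ` J \<subseteq> {\<sigma>0..} \<and> \<sigma> 0 = \<sigma>0
       \<and> C2_region E chi \<and> C1_region E NE
       \<and> (\<forall>p\<in>E. NE p = pd_s E chi p \<and> \<eta> < NE p \<and> NE p < N1)
       \<and> (\<forall>t\<in>J. chi (\<sigma> t, t) = N1 * \<sigma> t)
       \<and> (\<forall>t\<in>J. \<sigma>' t = pd_t E chi (\<sigma> t, t) / (N1 - NE (\<sigma> t, t)) \<and> \<sigma>' t > 1)
       \<and> (\<forall>(s, t)\<in>I. chi (s, t) = N1 * s
             \<and> NI (s, t) = NE (\<sigma> t, t) + (\<sigma>' t)\<^sup>2 * (N1 - NE (\<sigma> t, t))
             \<and> NI (s, t) > N1)
       \<and> (\<forall>p\<in>E. pd_t E (pd_t E chi) p = pd_s E (pd_s E chi) p)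
       \<and> (\<forall>t\<in>J. ((\<lambda>s. pd_s E chi (s, t)) \<longlongrightarrow> \<zeta> * t + \<tau>) at_top)
       \<and> (\<forall>s\<ge>\<sigma>0. chi (s, 0) = chi0 s \<and> pd_t E chi (s, 0) = right_trace \<sigma>0 chi1 s))"

definition classical_shock_solution ::
  "(real \<Rightarrow> real) \<Rightarrow> (real \<Rightarrow> real) \<Rightarrow> (real \<Rightarrow> real) \<Rightarrow> real \<Rightarrow>
   (real \<times> real \<Rightarrow> real) \<Rightarrow> (real \<times> real \<Rightarrow> real) \<Rightarrow> bool" where
  "classical_shock_solution chi0 chi1 N0 T chi N \<longleftrightarrow>
     continuous_on ({0..} \<times> {0..T}) chi
     \<and> Linf_on ({0..} \<times> {0..T}) N
     \<and> Linf_loc_on ({0..} \<times> {0..T}) (\<lambda>(s, t). deriv_on {0..T} (\<lambda>t'. chi (s, t')) t)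
     \<and> (\<exists>\<sigma>. front_conditions chi0 chi1 N0 T chi N \<sigma>
          \<and> (\<forall>\<sigma>'. front_conditions chi0 chi1 N0 T chi N \<sigma>' \<longrightarrow> (\<forall>t\<in>{0..T}. \<sigma>' t = \<sigma> t)))"

definition shock_solution_before ::
  "(real \<Rightarrow> real) \<Rightarrow> (real \<Rightarrow> real) \<Rightarrow> (real \<Rightarrow> real) \<Rightarrow> ereal \<Rightarrow>
   (real \<times> real \<Rightarrow> real) \<Rightarrow> (real \<times> real \<Rightarrow> real) \<Rightarrow> bool" where
  "shock_solution_before chi0 chi1 N0 T chi N \<longleftrightarrow>
     0 < T \<and> (\<forall>T'. 0 < T' \<and> ereal T' < T \<longrightarrow> classical_shock_solution chi0 chi1 N0 T' chi N)"

definition shock_front_before ::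
  "(real \<Rightarrow> real) \<Rightarrow> (real \<Rightarrow> real) \<Rightarrow> (real \<Rightarrow> real) \<Rightarrow> ereal \<Rightarrow>
   (real \<times> real \<Rightarrow> real) \<Rightarrow> (real \<times> real \<Rightarrow> real) \<Rightarrow> (real \<Rightarrow> real) \<Rightarrow> bool" where
  "shock_front_before chi0 chi1 N0 T chi N \<sigma> \<longleftrightarrow>
     (\<forall>T'. 0 < T' \<and> ereal T' < T \<longrightarrow> front_conditions chi0 chi1 N0 T' chi N \<sigma>)"

text \<open>Functions are total here, so "the largest time up to which the solution is a shock solution"
  has to range over all solutions with the given data.\<close>

definition final_time :: "(real \<Rightarrow> real) \<Rightarrow> (real \<Rightarrow> real) \<Rightarrow> (real \<Rightarrow> real) \<Rightarrow> ereal" where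
  "final_time chi0 chi1 N0 = Sup {T. \<exists>chi N. shock_solution_before chi0 chi1 N0 T chi N}"

text \<open>Two solutions are identified if they agree up to the value of the tension on the front.\<close>

definition unique_shock_solution ::
  "(real \<Rightarrow> real) \<Rightarrow> (real \<Rightarrow> real) \<Rightarrow> (real \<Rightarrow> real) \<Rightarrow>
   (real \<times> real \<Rightarrow> real) \<Rightarrow> (real \<times> real \<Rightarrow> real) \<Rightarrow> (real \<Rightarrow> real) \<Rightarrow> bool" where
  "unique_shock_solution chi0 chi1 N0 chi N \<sigma> \<longleftrightarrow>
     shock_solution_before chi0 chi1 N0 (final_time chi0 chi1 N0) chi N
     \<and> shock_front_before chi0 chi1 N0 (final_time chi0 chi1 N0) chi N \<sigma>
     \<and> (\<forall>T chi' N'. shock_solution_before chi0 chi1 N0 T chi' N' \<longrightarrow>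
          (\<forall>s t. 0 \<le> s \<and> 0 \<le> t \<and> ereal t < T \<longrightarrow>
             chi' (s, t) = chi (s, t) \<and> (s \<noteq> \<sigma> t \<longrightarrow> N' (s, t) = N (s, t))))"

text \<open>The deviation of the data from those of the piece-wise constant stretched motion with
  parameters \<open>(\<sigma>0, \<sigma>1)\<close>.\<close>

definition data_deviation ::
  "real \<Rightarrow> real \<Rightarrow> real \<Rightarrow> (real \<Rightarrow> real) \<Rightarrow> (real \<Rightarrow> real) \<Rightarrow> ereal" where
  "data_deviation \<sigma>0 \<sigma>1 r chi0 chi1 =
     (let X = {\<sigma>0..}; chi1R = right_trace \<sigma>0 chi1
      in SUP s\<in>X. ereal (\<bar>deriv_on X chi0 s - \<tau>\<bar>
           + s powr (r + 2) * \<bar>deriv_on X (deriv_on X chi0) s\<bar>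
           + \<bar>chi1R s - (\<zeta> * (s - \<sigma>0) + \<sigma>1 * (N1 - \<tau>))\<bar>
           + s powr (r + 2) * \<bar>deriv_on X chi1R s - \<zeta>\<bar>))"

end

end

theory Submission
  imports Defs
begin

text \<open>The front moves faster than the waves, so ahead of it the solution is given by d'Alembert's
  formula \<open>w(s, t) = P(s + t) + Q(s - t)\<close> in terms of the initial data alone. The front is then the
  solution \<open>s = \<sigma>(t)\<close> of the scalar equation \<open>w(s, t) = N1 s\<close>: it stays ahead of a slightly slower
  piece-wise constant stretched motion, and there \<open>w_s < N1\<close> makes \<open>w(s, t) - N1 s\<close> strictly
  decreasing in \<open>s\<close>. Since \<open>s - t\<close> is of order \<open>1 / (T - t)\<close> at the front, the decay of the data in
  \<open>s\<close> turns into powers of \<open>T - t\<close>. Conversely every solution is given by d'Alembert's formula ahead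
  of its front, which makes it unique, and its tension at infinity \<open>\<zeta> t + \<tau>\<close> reaches \<open>N1\<close> at time
  \<open>T\<close>.\<close>

subsection \<open>One-dimensional calculus\<close>

text \<open>The barrier and the front start at the same point, so at time 0 there is no margin
  between them. On the barrier \<open>w - N1 s\<close> equals
  \<open>(c - lam * \<zeta> * T) * t\<close> plus a remainder; the remainder must therefore be at
  most a small multiple of \<open>t\<close>, not merely a small constant. The parameter
  \<open>lam\<close> lies halfway between 1 and \<open>\<sigma>1\<close>:
  \<open>lam < \<sigma>1\<close> leaves this margin to the perturbation, \<open>lam > 1\<close>
  makes \<open>s - t\<close> at least a multiple of \<open>1 / (T - t)\<close>. The weight of power
  \<open>r + 2\<close> on the second derivatives becomes, after integration towards infinity, a
  decay of order \<open>r + 1\<close> of the first derivatives. Such a decay holds only relative to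
  their limit at infinity, which for the velocity is in general not the prescribed
  \<open>\<sigma>1 * (N1 - \<tau>)\<close>; this is where \<open>\<sigma>1inf\<close> comes from.
  Speed and tension behind the front divide by \<open>N1\<close> minus the tension ahead of it, a
  quantity of order \<open>T - t\<close>; one power is lost, whence the exponents
  \<open>1 + r\<close> for the first derivatives and \<open>r\<close> for speed and tension. All
  constants depend on \<open>r\<close>, which is fixed before them.\<close>

lemma at_within_interval_nontrivial:
  fixes x :: real
  assumes "is_interval S" "x \<in> S" "y \<in> S" "x \<noteq> y"
  shows "at x within S \<noteq> bot"
proof -
  have "connected S"
    using assms(1) is_interval_connected by blast
  moreover have "\<nexists>a. S = {a}"
    using assms by auto
  ultimately show ?thesis
    using connected_imp_perfect assms(2) trivial_limit_within by metis
qed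

lemma deriv_on_eqI:
  assumes "(f has_real_derivative d) (at x within S)" "at x within S \<noteq> bot"
  shows "deriv_on S f x = d"
  unfolding deriv_on_def
  using assms vector_derivative_within has_real_derivative_iff_has_vector_derivative by blast

lemma deriv_on_cong:
  assumes "x \<in> S" "\<And>y. y \<in> S \<Longrightarrow> f y = g y"
  shows "deriv_on S f x = deriv_on S g x"
proof -
  have "(f has_vector_derivative d) (at x within S) \<longleftrightarrow> (g has_vector_derivative d) (at x within S)" for d
    using assms has_vector_derivative_transform by metis
  then show ?thesis
    by (simp add: deriv_on_def vector_derivative_def)
qed

lemma C1_on_imp_has_deriv:
  assumes "C1_on S f" "x \<in> S"
  shows "(f has_real_derivative deriv_on S f x) (at x within S)"
  using assms vector_derivative_works
  unfolding C1_on_def differentiable_on_def deriv_on_def has_real_derivative_iff_has_vector_derivative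
  by blast

lemma C1_onI:
  assumes "\<And>x. x \<in> S \<Longrightarrow> (f has_real_derivative f' x) (at x within S)"
    and "continuous_on S f'"
    and "\<And>x. x \<in> S \<Longrightarrow> at x within S \<noteq> bot"
  shows "C1_on S f"
proof -
  have "deriv_on S f x = f' x" if "x \<in> S" for x
    using deriv_on_eqI assms that by blast
  then have "continuous_on S (deriv_on S f)"
    using assms(2) continuous_on_cong by force
  moreover have "f differentiable_on S"
    using assms(1) unfolding differentiable_on_def real_differentiable_def
    by (metis has_field_derivative_imp_has_derivative differentiableI)
  ultimately show ?thesis
    unfolding C1_on_def by blast
qed

lemma C1_on_cong:
  assumes "\<And>y. y \<in> S \<Longrightarrow> f y = g y"
  shows "C1_on S f \<longleftrightarrow> C1_on S g"
proof -
  have "f differentiable_on S \<longleftrightarrow> g differentiable_on S"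
    unfolding differentiable_on_def using assms differentiable_transform_within zero_less_one by metis
  moreover have "continuous_on S (deriv_on S f) \<longleftrightarrow> continuous_on S (deriv_on S g)"
    using deriv_on_cong[of _ S f g] assms continuous_on_cong by metis
  ultimately show ?thesis
    unfolding C1_on_def by blast
qed

lemma C2_onI:
  assumes "\<And>x. x \<in> S \<Longrightarrow> (f has_real_derivative f' x) (at x within S)"
    and "\<And>x. x \<in> S \<Longrightarrow> (f' has_real_derivative f'' x) (at x within S)"
    and "continuous_on S f''"
    and nt: "\<And>x. x \<in> S \<Longrightarrow> at x within S \<noteq> bot"
  shows "C2_on S f"
proof -
  have "continuous_on S f'"
    using assms(2) DERIV_continuous_on by blast
  then have 1: "C1_on S f"
    using C1_onI assms by blast
  have "C1_on S f'"
    using C1_onI assms by blast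
  moreover have "deriv_on S f x = f' x" if "x \<in> S" for x
    using deriv_on_eqI assms that by blast
  ultimately show ?thesis
    unfolding C2_on_def using 1 C1_on_cong by metis
qed

lemma atLeast_at_within_nontrivial: "(a::real) \<le> x \<Longrightarrow> at x within {a..} \<noteq> bot"
  by (rule at_within_interval_nontrivial[where y = "x + 1"]) (auto simp: is_interval_ci)

lemma continuous_antiderivative:
  fixes f :: "real \<Rightarrow> real"
  assumes "continuous_on UNIV f"
  obtains F where "\<And>x. (F has_real_derivative f x) (at x)" "F a = b"
proof -
  obtain G where "\<forall>x::real. -\<infinity> < ereal x \<longrightarrow> ereal x < \<infinity> \<longrightarrow> (G has_vector_derivative f x) (at x)"
    using einterval_antiderivative[of "-\<infinity>" "\<infinity>" f] assms
    by (auto simp: continuous_on_eq_continuous_at)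
  then have G: "(G has_real_derivative f x) (at x)" for x
    by (simp add: has_real_derivative_iff_has_vector_derivative)
  show ?thesis
  proof
    show "((\<lambda>x. G x - G a + b) has_real_derivative f x) (at x)" for x
      by (auto intro!: derivative_eq_intros G)
  qed simp
qed

lemma same_deriv_on_atLeast:
  fixes f g :: "real \<Rightarrow> real"
  assumes "\<And>x. x \<ge> a \<Longrightarrow> (f has_real_derivative f' x) (at x within {a..})"
    and "\<And>x. x \<ge> a \<Longrightarrow> (g has_real_derivative f' x) (at x within {a..})"
    and "f a = g a" "x \<ge> a"
  shows "f x = g x"
proof -
  have "((\<lambda>x. f x - g x) has_real_derivative 0) (at x within {a..})" if "x \<in> {a..}" for x
    using that by (auto intro!: derivative_eq_intros assms)
  then obtain c where "\<forall>x\<in>{a..}. f x - g x = c"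
    using has_field_derivative_zero_constant[of "{a..}" "\<lambda>x. f x - g x"] by auto
  then have "f x - g x = c" "f a - g a = c"
    using assms(4) by auto
  then show ?thesis
    using assms(3) by simp
qed

text \<open>The one-sided derivative is continued to the left by its value at \<open>a\<close>,
  which keeps it continuous; an antiderivative of this continuation is the extension.\<close>

lemma C1_on_extension:
  assumes "C1_on {a..} g"
  obtains h h' where "\<And>x. (h has_real_derivative h' x) (at x)" "continuous_on UNIV h'"
    "\<And>x. x \<ge> a \<Longrightarrow> h x = g x" "\<And>x. x \<ge> a \<Longrightarrow> h' x = deriv_on {a..} g x"
proof -
  define h' where "h' x = deriv_on {a..} g (max a x)" for x
  have c: "continuous_on UNIV h'"
    unfolding h'_def
  proof (rule continuous_on_compose2[of "{a..}" "deriv_on {a..} g"])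
    show "continuous_on {a..} (deriv_on {a..} g)"
      using assms unfolding C1_on_def by blast
  qed (auto intro!: continuous_intros)
  obtain h where h: "\<And>x. (h has_real_derivative h' x) (at x)" "h a = g a"
    using continuous_antiderivative[OF c] by metis
  show ?thesis
  proof (rule that)
    show "h x = g x" if "x \<ge> a" for x
    proof (rule same_deriv_on_atLeast[of a h h' g])
      show "(g has_real_derivative h' x) (at x within {a..})" if "x \<ge> a" for x
        using C1_on_imp_has_deriv[OF assms, of x] that by (simp add: h'_def max_def)
      show "(h has_real_derivative h' x) (at x within {a..})" for x
        by (rule has_field_derivative_at_within[OF h(1)])
    qed (use h that in auto)
    show "h' x = deriv_on {a..} g x" if "x \<ge> a" for x
      using that by (simp add: h'_def max_def)
  qed (use h c in auto)
qed

text \<open>The tail integral of the bound is \<open>k\<close>, so \<open>g - k\<close> increases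
  and \<open>g + k\<close> decreases. These two monotone functions enclose the limit, and
  \<open>k\<close> is the rate; \<open>g'\<close> itself is never integrated.\<close>

lemma decay_limit:
  fixes g :: "real \<Rightarrow> real"
  assumes "a > 0" "q > 0"
    and g: "\<And>x. x \<ge> a \<Longrightarrow> (g has_real_derivative g' x) (at x)"
    and bd: "\<And>x. x \<ge> a \<Longrightarrow> \<bar>g' x\<bar> \<le> K * x powr (-(q+1))"
  obtains l where "(g \<longlongrightarrow> l) at_top" "\<And>x. x \<ge> a \<Longrightarrow> \<bar>g x - l\<bar> \<le> K / q * x powr (-q)"
proof -
  define k where "k x = K / q * x powr (-q)" for x
  have k': "(k has_real_derivative - K * x powr (-(q+1))) (at x)" if "x \<ge> a" for x
  proof -
    have "x > 0" using that assms(1) by linarith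
    then have "(k has_real_derivative K / q * (- q * x powr (- q - 1))) (at x)"
      unfolding k_def by (intro DERIV_cmult has_real_derivative_powr)
    moreover have "K / q * (- q * x powr (- q - 1)) = - K * x powr (-(q+1))"
    proof -
      have "- q - 1 = -(q+1)" by simp
      then show ?thesis using assms(2) by (simp only:) simp
    qed
    ultimately show ?thesis by simp
  qed
  have inc: "g x - k x \<le> g y - k y" if "a \<le> x" "x \<le> y" for x y
  proof (rule DERIV_nonneg_imp_nondecreasing[OF that(2)])
    fix z assume "x \<le> z" "z \<le> y"
    then have z: "a \<le> z" using that by linarith
    show "\<exists>d. ((\<lambda>x. g x - k x) has_real_derivative d) (at z) \<and> d \<ge> 0"
    proof (intro exI conjI)
      show "((\<lambda>x. g x - k x) has_real_derivative g' z - - K * z powr (-(q+1))) (at z)"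
        by (rule DERIV_diff[OF g[OF z] k'[OF z]])
    qed (use bd[OF z] in auto)
  qed
  have dec: "g y + k y \<le> g x + k x" if "a \<le> x" "x \<le> y" for x y
  proof (rule DERIV_nonpos_imp_nonincreasing[OF that(2)])
    fix z assume "x \<le> z" "z \<le> y"
    then have z: "a \<le> z" using that by linarith
    show "\<exists>d. ((\<lambda>x. g x + k x) has_real_derivative d) (at z) \<and> d \<le> 0"
    proof (intro exI conjI)
      show "((\<lambda>x. g x + k x) has_real_derivative g' z + - K * z powr (-(q+1))) (at z)"
        by (rule DERIV_add[OF g[OF z] k'[OF z]])
    qed (use bd[OF z] in auto)
  qed
  have "0 \<le> K * a powr (-(q+1))"
    using bd[of a] abs_ge_zero order_trans by blast
  then have "K \<ge> 0"
    using assms(1) by (simp add: zero_le_mult_iff)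
  then have k0: "k x \<ge> 0" for x
    unfolding k_def using assms(2) by simp
  define l where "l = Sup ((\<lambda>x. g x - k x) ` {a..})"
  have bdd: "bdd_above ((\<lambda>x. g x - k x) ` {a..})"
  proof (rule bdd_aboveI2)
    fix x assume "x \<in> {a..}"
    then show "g x - k x \<le> g a + k a"
      using dec[of a x] k0[of x] by auto
  qed
  have lo: "g x - k x \<le> l" if "x \<ge> a" for x
    unfolding l_def by (rule cSUP_upper[OF _ bdd]) (use that in auto)
  have hi: "l \<le> g x + k x" if "x \<ge> a" for x
    unfolding l_def
  proof (rule cSUP_least)
    fix y assume "y \<in> {a..}"
    then have y: "a \<le> y" by simp
    show "g y - k y \<le> g x + k x"
    proof (cases "x \<le> y")
      case True
      then show ?thesis using dec[OF that True] k0[of y] by linarith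
    next
      case False
      then show ?thesis using inc[OF y, of x] k0[of x] by linarith
    qed
  qed auto
  have le: "\<bar>g x - l\<bar> \<le> k x" if "x \<ge> a" for x
    using lo[OF that] hi[OF that] by linarith
  have "((\<lambda>x. x powr (-q)) \<longlongrightarrow> 0) at_top"
    using tendsto_neg_powr[OF _ filterlim_ident, of "-q"] assms(2) by simp
  then have "(k \<longlongrightarrow> K / q * 0) at_top"
    unfolding k_def by (intro tendsto_intros)
  then have klim: "(k \<longlongrightarrow> 0) at_top" by simp
  have "((\<lambda>x. g x - l) \<longlongrightarrow> 0) at_top"
    by (rule Lim_null_comparison[OF _ klim]) (use le in \<open>auto simp: eventually_at_top_linorder\<close>)
  then have "(g \<longlongrightarrow> l) at_top"
    by (simp add: LIM_zero_iff)
  then show ?thesis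
    using that le unfolding k_def by blast
qed

subsection \<open>Calculus in regions of the plane\<close>

text \<open>Restriction to the line through \<open>x\<close> with direction \<open>u\<close> reduces
  this to the uniqueness of a one-variable derivative within the parameter set \<open>D\<close>, of
  which 0 is a limit point by the last hypothesis.\<close>

lemma has_derivative_unique_direction:
  fixes f :: "'a::real_normed_vector \<Rightarrow> real"
  assumes f': "(f has_derivative f') (at x within S)" and f'': "(f has_derivative f'') (at x within S)"
    and u: "\<And>e. e > 0 \<Longrightarrow> \<exists>d. 0 < \<bar>d\<bar> \<and> \<bar>d\<bar> < e \<and> x + d *\<^sub>R u \<in> S"
  shows "f' u = f'' u"
proof -
  define D where "D = {d. x + d *\<^sub>R u \<in> S}"
  have lin: "((\<lambda>d::real. x + d *\<^sub>R u) has_derivative (\<lambda>d. d *\<^sub>R u)) (at 0 within D)"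
    by (auto intro!: derivative_eq_intros)
  have along: "((\<lambda>d. f (x + d *\<^sub>R u)) has_vector_derivative F u) (at 0 within D)"
    if F: "(f has_derivative F) (at x within S)" for F
  proof -
    have "((\<lambda>d. f (x + d *\<^sub>R u)) has_derivative (\<lambda>d. F (d *\<^sub>R u))) (at 0 within D)"
    proof (rule has_derivative_in_compose[OF lin])
      show "(f has_derivative F) (at (x + 0 *\<^sub>R u) within (\<lambda>d. x + d *\<^sub>R u) ` D)"
        using F by (auto simp: D_def intro: has_derivative_subset)
    qed
    then show ?thesis
      using linear_cmul[OF has_derivative_linear[OF F]] by (simp add: has_vector_derivative_def)
  qed
  have "at 0 within D \<noteq> bot"
    unfolding trivial_limit_within islimpt_approachable_real D_def using u by fastforce
  then show ?thesis
    using vector_derivative_unique_within along f' f'' by blast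
qed

text \<open>Enough approach directions inside \<open>E\<close> for derivatives within \<open>E\<close> to be unique.\<close>

definition approachable :: "(real \<times> real) set \<Rightarrow> bool" where
  "approachable E \<longleftrightarrow> (\<forall>(s, t)\<in>E.
     (\<forall>e>0. \<exists>d. 0 < \<bar>d\<bar> \<and> \<bar>d\<bar> < e \<and> (s + d, t) \<in> E)
     \<and> (\<exists>K. \<forall>e>0. \<exists>d. 0 < \<bar>d\<bar> \<and> \<bar>d\<bar> < e \<and> (s + d * K, t + d) \<in> E))"

text \<open>At the point where the front starts, the region contains no segment in pure time
  direction. Linearity recovers the time derivative from the direction \<open>(1, 0)\<close> and one
  slanted direction \<open>(K, 1)\<close>.\<close>

lemma pd_eqI:
  assumes E: "approachable E" "p \<in> E"
    and f: "(f has_derivative (\<lambda>(h, k). a * h + b * k)) (at p within E)"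
  shows "pd_s E f p = a" "pd_t E f p = b"
proof -
  obtain s t where p: "p = (s, t)" by (cases p)
  let ?F = "frechet_derivative f (at p within E)"
  have F: "(f has_derivative ?F) (at p within E)"
    using f frechet_derivative_works differentiableI by blast
  obtain K where K: "\<forall>e>0. \<exists>d. 0 < \<bar>d\<bar> \<and> \<bar>d\<bar> < e \<and> (s + d * K, t + d) \<in> E"
    using E p unfolding approachable_def by fast
  have "\<forall>e>0. \<exists>d. 0 < \<bar>d\<bar> \<and> \<bar>d\<bar> < e \<and> (s + d, t) \<in> E"
    using E p unfolding approachable_def by fast
  then have 1: "?F (1, 0) = a"
    using has_derivative_unique_direction[OF F f, of "(1, 0)"] p by simp
  have "?F (K, 1) = a * K + b"
    using has_derivative_unique_direction[OF F f, of "(K, 1)"] p K by simp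
  moreover have "?F (K, 1) = K *\<^sub>R ?F (1, 0) + ?F (0, 1)"
    using linear_add[OF has_derivative_linear[OF F], of "K *\<^sub>R (1, 0)" "(0, 1)"]
      linear_cmul[OF has_derivative_linear[OF F], of K "(1, 0)"] by simp
  ultimately show "pd_s E f p = a" "pd_t E f p = b"
    using 1 unfolding pd_s_def pd_t_def by auto
qed

lemma C1_region_has_derivative:
  assumes "C1_region E f" "p \<in> E"
  shows "(f has_derivative (\<lambda>(h, k). pd_s E f p * h + pd_t E f p * k)) (at p within E)"
proof -
  let ?F = "frechet_derivative f (at p within E)"
  have F: "(f has_derivative ?F) (at p within E)"
    using assms frechet_derivative_works unfolding C1_region_def differentiable_on_def by blast
  have "?F (h, k) = pd_s E f p * h + pd_t E f p * k" for h k
    using linear_add[OF has_derivative_linear[OF F], of "h *\<^sub>R (1, 0)" "k *\<^sub>R (0, 1)"]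
      linear_cmul[OF has_derivative_linear[OF F], of h "(1, 0)"]
      linear_cmul[OF has_derivative_linear[OF F], of k "(0, 1)"]
    by (simp add: pd_s_def pd_t_def)
  then have "?F = (\<lambda>(h, k). pd_s E f p * h + pd_t E f p * k)"
    by auto
  then show ?thesis
    using F by metis
qed

lemma C1_regionI:
  assumes E: "approachable E"
    and f: "\<And>p. p \<in> E \<Longrightarrow> (f has_derivative (\<lambda>(h, k). fs p * h + ft p * k)) (at p within E)"
    and "continuous_on E fs" "continuous_on E ft"
  shows "C1_region E f"
proof -
  have "continuous_on E (pd_s E f)" "continuous_on E (pd_t E f)"
    using pd_eqI[OF E _ f] assms(3,4) continuous_on_cong by (metis (no_types, lifting))+
  moreover have "f differentiable_on E"
    using f unfolding differentiable_on_def by (blast intro: differentiableI)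
  ultimately show ?thesis
    unfolding C1_region_def by blast
qed

lemma frechet_derivative_cong_on:
  assumes "p \<in> E" "\<And>q. q \<in> E \<Longrightarrow> f q = g q"
  shows "frechet_derivative f (at p within E) = frechet_derivative g (at p within E)"
proof -
  have "(f has_derivative D) (at p within E) \<longleftrightarrow> (g has_derivative D) (at p within E)" for D
    using assms has_derivative_transform by metis
  then show ?thesis
    by (simp add: frechet_derivative_def)
qed

lemma pd_cong:
  assumes "p \<in> E" "\<And>q. q \<in> E \<Longrightarrow> f q = g q"
  shows "pd_s E f p = pd_s E g p" "pd_t E f p = pd_t E g p"
  unfolding pd_s_def pd_t_def using frechet_derivative_cong_on[OF assms] by auto

lemma C1_region_cong:
  assumes "\<And>q. q \<in> E \<Longrightarrow> f q = g q"
  shows "C1_region E f \<longleftrightarrow> C1_region E g"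
proof -
  have "f differentiable_on E \<longleftrightarrow> g differentiable_on E"
    unfolding differentiable_on_def using assms differentiable_transform_within zero_less_one by metis
  moreover have "continuous_on E (pd_s E f) \<longleftrightarrow> continuous_on E (pd_s E g)"
    using pd_cong(1)[of _ E f g] assms continuous_on_cong by metis
  moreover have "continuous_on E (pd_t E f) \<longleftrightarrow> continuous_on E (pd_t E g)"
    using pd_cong(2)[of _ E f g] assms continuous_on_cong by metis
  ultimately show ?thesis
    unfolding C1_region_def by blast
qed

lemma has_real_derivative_along_path:
  assumes f: "(f has_derivative (\<lambda>(h, k). A * h + B * k)) (at (x t, y t) within E)"
    and x: "(x has_real_derivative u) (at t within J)" and y: "(y has_real_derivative v) (at t within J)"
    and sub: "\<And>t. t \<in> J \<Longrightarrow> (x t, y t) \<in> E"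
  shows "((\<lambda>t. f (x t, y t)) has_real_derivative A * u + B * v) (at t within J)"
proof -
  have "((\<lambda>t. (x t, y t)) has_derivative (\<lambda>h. (u * h, v * h))) (at t within J)"
    using x y by (intro has_derivative_Pair) (auto simp: has_field_derivative_def)
  then have "((\<lambda>t. f (x t, y t)) has_derivative (\<lambda>h. case (u * h, v * h) of (h, k) \<Rightarrow> A * h + B * k)) (at t within J)"
    by (rule has_derivative_in_compose) (use f sub in \<open>auto intro: has_derivative_subset\<close>)
  moreover have "(\<lambda>h. case (u * h, v * h) of (h, k) \<Rightarrow> A * h + B * k) = (*) (A * u + B * v)"
    by (auto simp: algebra_simps)
  ultimately show ?thesis
    by (simp add: has_field_derivative_def)
qed

text \<open>Both mixed second derivatives are limits of the second difference over shrinking squares,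
  divided by the area of the square.\<close>

lemma mixed_partials_commute:
  fixes f :: "real \<times> real \<Rightarrow> real"
  assumes U: "open U" "p \<in> U"
    and f: "\<And>q. q \<in> U \<Longrightarrow> (f has_derivative (\<lambda>(h, k). fs q * h + ft q * k)) (at q)"
    and fs: "\<And>q. q \<in> U \<Longrightarrow> (fs has_derivative (\<lambda>(h, k). fss q * h + fst' q * k)) (at q)"
    and ft: "\<And>q. q \<in> U \<Longrightarrow> (ft has_derivative (\<lambda>(h, k). fts q * h + ftt q * k)) (at q)"
    and cont: "isCont fst' p" "isCont fts p"
  shows "fst' p = fts p"
proof (rule ccontr)
  assume ne: "fst' p \<noteq> fts p"
  define e where "e = \<bar>fst' p - fts p\<bar> / 2"
  have "e > 0" using ne by (simp add: e_def)
  obtain a b where p: "p = (a, b)" by (cases p)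
  obtain d0 where d0: "d0 > 0" "ball p d0 \<subseteq> U"
    using U open_contains_ball by blast
  obtain d1 where d1: "d1 > 0" "\<And>q. dist q p < d1 \<Longrightarrow> \<bar>fst' q - fst' p\<bar> < e"
    using cont(1) \<open>e > 0\<close> unfolding continuous_at_eps_delta dist_real_def by blast
  obtain d2 where d2: "d2 > 0" "\<And>q. dist q p < d2 \<Longrightarrow> \<bar>fts q - fts p\<bar> < e"
    using cont(2) \<open>e > 0\<close> unfolding continuous_at_eps_delta dist_real_def by blast
  \<comment> \<open>A point of the square of side \<open>h\<close> with lower left corner
    \<open>p\<close> has distance at most \<open>2 * h\<close> from \<open>p\<close>; the divisor 3
    makes the inequality in \<open>near\<close> strict.\<close>
  define h where "h = min d0 (min d1 d2) / 3"
  have h: "h > 0" "3 * h \<le> d0" "3 * h \<le> d1" "3 * h \<le> d2"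
    using d0 d1 d2 by (auto simp: h_def)
  have near: "dist (x, y) p < 3 * h" if "a \<le> x" "x \<le> a + h" "b \<le> y" "y \<le> b + h" for x y
  proof -
    have "dist (x, y) (a, b) \<le> \<bar>x - a\<bar> + \<bar>y - b\<bar>"
      using sqrt_sum_squares_le_sum_abs by (simp add: dist_Pair_Pair dist_real_def)
    then show ?thesis using that h p by auto
  qed
  then have inU: "(x, y) \<in> U" if "a \<le> x" "x \<le> a + h" "b \<le> y" "y \<le> b + h" for x y
    using near[OF that] h(2) d0(2) by (auto simp: dist_commute subset_iff)
  note path = has_real_derivative_along_path[where E = UNIV and J = UNIV, simplified]
  have along_s: "((\<lambda>x. g (x, y)) has_real_derivative gs (x, y)) (at x)"
    if "(g has_derivative (\<lambda>(h, k). gs (x, y) * h + gt (x, y) * k)) (at (x, y))" for g gs gt x y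
    using path[of g "gs (x, y)" "gt (x, y)" "\<lambda>x. x" x "\<lambda>x. y" 1 0] that by simp
  have along_t: "((\<lambda>y. g (x, y)) has_real_derivative gt (x, y)) (at y)"
    if "(g has_derivative (\<lambda>(h, k). gs (x, y) * h + gt (x, y) * k)) (at (x, y))" for g gs gt x y
    using path[of g "gs (x, y)" "gt (x, y)" "\<lambda>y. x" y "\<lambda>y. y" 0 1] that by simp
  define \<Delta> where "\<Delta> = f (a + h, b + h) - f (a + h, b) - f (a, b + h) + f (a, b)"
  have "\<exists>z>a. z < a + h \<and> (f (a + h, b + h) - f (a + h, b)) - (f (a, b + h) - f (a, b))
      = (a + h - a) * (fs (z, b + h) - fs (z, b))"
    by (rule MVT2) (use h in \<open>auto intro!: DERIV_diff along_s f inU\<close>)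
  then obtain x1 where x1: "a < x1" "x1 < a + h" "\<Delta> = h * (fs (x1, b + h) - fs (x1, b))"
    by (auto simp: \<Delta>_def algebra_simps)
  have "\<exists>z>b. z < b + h \<and> fs (x1, b + h) - fs (x1, b) = (b + h - b) * fst' (x1, z)"
    by (rule MVT2) (use h x1 in \<open>auto intro!: along_t fs inU\<close>)
  then obtain y1 where y1: "b < y1" "y1 < b + h" "\<Delta> = h * (h * fst' (x1, y1))"
    using x1 by auto
  have "\<exists>z>b. z < b + h \<and> (f (a + h, b + h) - f (a, b + h)) - (f (a + h, b) - f (a, b))
      = (b + h - b) * (ft (a + h, z) - ft (a, z))"
    by (rule MVT2) (use h in \<open>auto intro!: DERIV_diff along_t f inU\<close>)
  then obtain y2 where y2: "b < y2" "y2 < b + h" "\<Delta> = h * (ft (a + h, y2) - ft (a, y2))"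
    by (auto simp: \<Delta>_def algebra_simps)
  have "\<exists>z>a. z < a + h \<and> ft (a + h, y2) - ft (a, y2) = (a + h - a) * fts (z, y2)"
    by (rule MVT2) (use h y2 in \<open>auto intro!: along_s ft inU\<close>)
  then obtain x2 where x2: "a < x2" "x2 < a + h" "\<Delta> = h * (h * fts (x2, y2))"
    using y2 by auto
  have "fst' (x1, y1) = fts (x2, y2)"
    using x2(3) y1(3) h(1) by simp
  moreover have "\<bar>fst' (x1, y1) - fst' p\<bar> < e"
    using d1(2) near[of x1 y1] x1 y1 h by force
  moreover have "\<bar>fts (x2, y2) - fts p\<bar> < e"
    using d2(2) near[of x2 y2] x2 y2 h by force
  ultimately show False
    unfolding e_def by (auto simp: abs_if field_simps split: if_splits)
qed

text \<open>Continuity of \<open>g\<close> is known beforehand, so differentiability of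
  \<open>F\<close> at the single point is enough. The first-order expansion gives a Lipschitz bound
  for \<open>g\<close> at \<open>t\<close> with constant \<open>M\<close>; inserted back, it makes
  the error small relative to the increment of \<open>t\<close>. Since \<open>J\<close> is
  arbitrary, the one-sided derivative at time 0 is included.\<close>

lemma implicit_function_has_derivative:
  fixes F :: "real \<times> real \<Rightarrow> real" and g :: "real \<Rightarrow> real"
  assumes F: "(F has_derivative (\<lambda>(h, k). A * h + B * k)) (at (g t, t))"
    and A: "A \<noteq> 0" and g: "continuous (at t within J) g"
    and zero: "\<And>u. u \<in> J \<Longrightarrow> F (g u, u) = 0" and t: "t \<in> J"
  shows "(g has_real_derivative - B / A) (at t within J)"
proof -
  define M where "M = (2 * \<bar>B\<bar> + \<bar>A\<bar>) / \<bar>A\<bar>"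
  have M: "M > 0" using A by (auto simp: M_def intro!: divide_pos_pos add_nonneg_pos)
  have "\<exists>d>0. \<forall>u\<in>J. norm (u - t) < d \<longrightarrow>
      norm (g u - g t - (- B / A) * (u - t)) \<le> e * norm (u - t)" if "e > 0" for e
  proof -
    \<comment> \<open>The first entry lets half of \<open>\<bar>A\<bar> * \<bar>x\<bar>\<close>
      absorb the error, which yields \<open>M\<close>; the second makes the final error at most
      \<open>e * \<bar>y\<bar>\<close> after division by \<open>\<bar>A\<bar>\<close>.\<close>
    define e' where "e' = min (\<bar>A\<bar> / 2) (e * \<bar>A\<bar> / (M + 1))"
    have e': "e' > 0" "e' \<le> \<bar>A\<bar> / 2" "e' * (M + 1) \<le> e * \<bar>A\<bar>"
    proof -
      show "e' > 0"
        using A M that by (auto simp: e'_def)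
      show "e' \<le> \<bar>A\<bar> / 2"
        unfolding e'_def by (rule min.cobounded1)
      have "e' \<le> e * \<bar>A\<bar> / (M + 1)"
        by (simp add: e'_def)
      then show "e' * (M + 1) \<le> e * \<bar>A\<bar>"
        using M by (simp add: pos_le_divide_eq)
    qed
    obtain d where d: "d > 0" "\<And>q. norm (q - (g t, t)) < d \<Longrightarrow>
        \<bar>F q - F (g t, t) - (A * fst (q - (g t, t)) + B * snd (q - (g t, t)))\<bar> \<le> e' * norm (q - (g t, t))"
      using F e'(1) unfolding has_derivative_at_alt by (force simp: case_prod_beta)
    obtain d' where d': "d' > 0" "\<And>u. u \<in> J \<Longrightarrow> dist u t < d' \<Longrightarrow> dist (g u) (g t) < d / 2"
      using g d(1) unfolding continuous_within_eps_delta by (meson half_gt_zero)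
    show ?thesis
    proof (intro exI conjI ballI impI)
      show "min d' (d / 2) > 0" using d d' by simp
      fix u assume u: "u \<in> J" "norm (u - t) < min d' (d / 2)"
      define x y where "x = g u - g t" and "y = u - t"
      have n: "norm ((g u, u) - (g t, t)) \<le> \<bar>x\<bar> + \<bar>y\<bar>"
        using sqrt_sum_squares_le_sum_abs by (simp add: norm_Pair x_def y_def)
      moreover have "\<bar>x\<bar> < d / 2" "\<bar>y\<bar> < d / 2"
        using u d'(2)[of u] by (auto simp: x_def y_def dist_real_def)
      ultimately have "norm ((g u, u) - (g t, t)) < d" by linarith
      from d(2)[OF this] have "\<bar>A * x + B * y\<bar> \<le> e' * norm ((g u, u) - (g t, t))"
        using zero u(1) t by (simp add: x_def y_def)
      also have "\<dots> \<le> e' * (\<bar>x\<bar> + \<bar>y\<bar>)"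
        using n e'(1) by simp
      finally have main: "\<bar>A * x + B * y\<bar> \<le> e' * (\<bar>x\<bar> + \<bar>y\<bar>)" .
      have "\<bar>A\<bar> * \<bar>x\<bar> \<le> \<bar>A * x + B * y\<bar> + \<bar>B\<bar> * \<bar>y\<bar>"
        using abs_triangle_ineq4[of "A * x + B * y" "B * y"] by (simp add: abs_mult)
      also have "\<dots> \<le> \<bar>A\<bar> / 2 * (\<bar>x\<bar> + \<bar>y\<bar>) + \<bar>B\<bar> * \<bar>y\<bar>"
        using main mult_right_mono[OF e'(2), of "\<bar>x\<bar> + \<bar>y\<bar>"] by simp
      finally have "\<bar>x\<bar> \<le> M * \<bar>y\<bar>"
        using A by (simp add: M_def field_simps)
      then have "\<bar>A * x + B * y\<bar> \<le> e' * ((M + 1) * \<bar>y\<bar>)"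
        using main e'(1) by (smt (verit) distrib_right mult_cancel_right1 mult_left_mono)
      also have "\<dots> \<le> e * \<bar>A\<bar> * \<bar>y\<bar>"
        using mult_right_mono[OF e'(3), of "\<bar>y\<bar>"] by (simp add: mult.assoc)
      finally have "\<bar>A * x + B * y\<bar> / \<bar>A\<bar> \<le> e * \<bar>y\<bar>"
        using A by (simp add: field_simps)
      moreover have "\<bar>A * x + B * y\<bar> / \<bar>A\<bar> = \<bar>x - (- B / A) * y\<bar>"
      proof -
        have "A * x + B * y = A * (x - (- B / A) * y)"
          using A by (simp add: field_simps)
        then show ?thesis
          using A by (simp add: abs_mult)
      qed
      ultimately show "norm (g u - g t - (- B / A) * (u - t)) \<le> e * norm (u - t)"
        by (simp add: x_def y_def)
    qed
  qed
  then show ?thesis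
    unfolding has_field_derivative_def has_derivative_within_alt
    by (auto simp: bounded_linear_mult_right)
qed

subsection \<open>Characteristics\<close>

text \<open>At a positive time one can step straight back, since an increasing front was further
  behind before. At time 0 only the future is available, and the slanted line must keep ahead of the
  front; this is what the linear growth bound with slope \<open>K\<close> provides.\<close>

lemma approachable_ext_region:
  assumes J: "\<And>t u. t \<in> J \<Longrightarrow> 0 \<le> u \<Longrightarrow> u \<le> t \<Longrightarrow> u \<in> J" "\<And>t. t \<in> J \<Longrightarrow> 0 \<le> t"
    and mono: "\<And>t u. t \<in> J \<Longrightarrow> 0 \<le> u \<Longrightarrow> u \<le> t \<Longrightarrow> \<sigma> u \<le> \<sigma> t"
    and grow: "d0 > 0" "\<And>d. 0 < d \<Longrightarrow> d < d0 \<Longrightarrow> d \<in> J \<and> \<sigma> d \<le> \<sigma> 0 + K * d"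
  shows "approachable (ext_region \<sigma> J)"
proof -
  have "(\<forall>e>0. \<exists>d. 0 < \<bar>d\<bar> \<and> \<bar>d\<bar> < e \<and> (s + d, t) \<in> ext_region \<sigma> J)
     \<and> (\<exists>K. \<forall>e>0. \<exists>d. 0 < \<bar>d\<bar> \<and> \<bar>d\<bar> < e \<and> (s + d * K, t + d) \<in> ext_region \<sigma> J)"
    if st: "(s, t) \<in> ext_region \<sigma> J" for s t
  proof (intro conjI)
    from st have t: "t \<in> J" "\<sigma> t \<le> s" by (auto simp: ext_region_def)
    show "\<forall>e>0. \<exists>d. 0 < \<bar>d\<bar> \<and> \<bar>d\<bar> < e \<and> (s + d, t) \<in> ext_region \<sigma> J"
    proof (intro allI impI)
      fix e :: real assume "e > 0"
      then show "\<exists>d. 0 < \<bar>d\<bar> \<and> \<bar>d\<bar> < e \<and> (s + d, t) \<in> ext_region \<sigma> J"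
        using t by (intro exI[of _ "e / 2"]) (auto simp: ext_region_def)
    qed
    show "\<exists>K. \<forall>e>0. \<exists>d. 0 < \<bar>d\<bar> \<and> \<bar>d\<bar> < e \<and> (s + d * K, t + d) \<in> ext_region \<sigma> J"
    proof (cases "t = 0")
      case True
      show ?thesis
      proof (rule exI[of _ K], intro allI impI)
        fix e :: real assume "e > 0"
        define d where "d = min e d0 / 2"
        have "0 < d" "d < e" "d < d0" using \<open>e > 0\<close> grow(1) by (auto simp: d_def)
        then show "\<exists>d. 0 < \<bar>d\<bar> \<and> \<bar>d\<bar> < e \<and> (s + d * K, t + d) \<in> ext_region \<sigma> J"
          using grow(2)[of d] t True by (intro exI[of _ d]) (auto simp: ext_region_def algebra_simps)
      qed
    next
      case False
      then have "t > 0" using J(2)[OF t(1)] by simp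
      show ?thesis
      proof (rule exI[of _ 0], intro allI impI)
        fix e :: real assume "e > 0"
        define d where "d = min e t / 2"
        have "0 < d" "d < e" "d < t" using \<open>e > 0\<close> \<open>t > 0\<close> by (auto simp: d_def)
        then show "\<exists>d. 0 < \<bar>d\<bar> \<and> \<bar>d\<bar> < e \<and> (s + d * 0, t + d) \<in> ext_region \<sigma> J"
          using J(1)[of t "t - d"] mono[of t "t - d"] t
          by (intro exI[of _ "- d"]) (auto simp: ext_region_def)
      qed
    qed
  qed
  then show ?thesis
    unfolding approachable_def by blast
qed

text \<open>A front faster than the waves is never reached from behind, so backward characteristics
  from the region ahead of it end on the initial line.\<close>

lemma wave_ahead_of_fast_front:
  fixes \<sigma> :: "real \<Rightarrow> real" and T :: real
  defines "E \<equiv> ext_region \<sigma> {0..T}"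
  assumes cont: "continuous_on {0..T} \<sigma>"
    and fast: "\<And>t u. 0 \<le> t \<Longrightarrow> t < u \<Longrightarrow> u \<le> T \<Longrightarrow> \<sigma> t - t < \<sigma> u - u"
    and f: "C2_region E f"
    and wave: "\<And>p. p \<in> E \<Longrightarrow> pd_t E (pd_t E f) p = pd_s E (pd_s E f) p"
    and init: "\<And>s. s \<ge> \<sigma> 0 \<Longrightarrow> f (s, 0) = P s + Q s"
      "\<And>s. s \<ge> \<sigma> 0 \<Longrightarrow> pd_t E f (s, 0) = P1 s - Q1 s"
    and P: "\<And>x. (P has_real_derivative P1 x) (at x)"
    and Q: "\<And>x. (Q has_real_derivative Q1 x) (at x)"
    and st: "(s, t) \<in> E"
  shows "f (s, t) = P (s + t) + Q (s - t)"
    and "pd_s E f (s, t) = P1 (s + t) + Q1 (s - t)"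
    and "pd_t E f (s, t) = P1 (s + t) - Q1 (s - t)"
proof -
  have E: "(x, u) \<in> E \<longleftrightarrow> 0 \<le> u \<and> u \<le> T \<and> \<sigma> u \<le> x" for x u
    by (auto simp: E_def ext_region_def)
  have C1: "C1_region E f" "C1_region E (pd_s E f)" "C1_region E (pd_t E f)"
    using f by (auto simp: C2_region_def)
  \<comment> \<open>Characteristics run in the open set \<open>U\<close> except at their endpoints.
    Inside \<open>U\<close> all derivatives are two-sided and mixed partials commute; continuity on
    \<open>E\<close> carries the conserved quantities to the endpoints.\<close>
  define U where "U = (UNIV \<times> {0<..<T}) \<inter> (\<lambda>p. fst p - \<sigma> (snd p)) -` {0<..}"
  have "continuous_on (UNIV \<times> {0<..<T}) (\<lambda>p::real \<times> real. fst p - \<sigma> (snd p))"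
    by (intro continuous_intros continuous_on_compose2[OF cont]) auto
  then have "open U"
    unfolding U_def by (intro continuous_open_preimage open_Times) auto
  have U: "(x, u) \<in> U \<longleftrightarrow> 0 < u \<and> u < T \<and> \<sigma> u < x" for x u
    by (auto simp: U_def)
  have UE: "U \<subseteq> E" using U E by auto
  have at_U: "at p within E = at p" if "p \<in> U" for p
    using at_within_open_subset that \<open>open U\<close> UE by blast
  note D = C1_region_has_derivative
  have DU: "(g has_derivative (\<lambda>(h, k). pd_s E g p * h + pd_t E g p * k)) (at p)"
    if "C1_region E g" "p \<in> U" for g p
    using D[OF that(1), of p] that(2) at_U[OF that(2)] UE by auto
  have schwarz: "pd_t E (pd_s E f) p = pd_s E (pd_t E f) p" if "p \<in> U" for p
  proof (rule mixed_partials_commute[OF \<open>open U\<close> that])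
    show "isCont (pd_t E (pd_s E f)) p" "isCont (pd_s E (pd_t E f)) p"
      using C1 that UE \<open>open U\<close> unfolding C1_region_def
      by (metis continuous_on_eq_continuous_at continuous_on_subset)+
  qed (use DU C1 in auto)
  have init_s: "pd_s E f (x, 0) = P1 x + Q1 x" if x: "x \<ge> \<sigma> 0" for x
  proof -
    have "0 \<le> T" using st E by auto
    then have "((\<lambda>x. f (x, 0)) has_real_derivative pd_s E f (x, 0) * 1 + pd_t E f (x, 0) * 0) (at x within {\<sigma> 0..})"
      by (intro has_real_derivative_along_path[where E = E] D C1) (use x E in \<open>auto intro!: derivative_eq_intros\<close>)
    then have 1: "((\<lambda>x. f (x, 0)) has_real_derivative pd_s E f (x, 0)) (at x within {\<sigma> 0..})"
      by simp
    have "((\<lambda>x. P x + Q x) has_real_derivative P1 x + Q1 x) (at x within {\<sigma> 0..})"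
      by (intro DERIV_add has_field_derivative_at_within[OF P] has_field_derivative_at_within[OF Q])
    then have "((\<lambda>x. f (x, 0)) has_real_derivative P1 x + Q1 x) (at x within {\<sigma> 0..})"
      by (rule has_field_derivative_transform_within[OF _ zero_less_one]) (use x init in auto)
    then show ?thesis
      using 1 deriv_on_eqI atLeast_at_within_nontrivial[OF x] by metis
  qed
  have left: "(s + t - u, u) \<in> E" "0 < u \<Longrightarrow> u < t \<Longrightarrow> (s + t - u, u) \<in> U"
    if st: "(s, t) \<in> E" "0 \<le> u" "u \<le> t" for s t u
    using st fast[of u t] E U by (cases "u = t"; fastforce)+
  \<comment> \<open>The critical family: followed back in time such a characteristic retreats by
    \<open>t - u\<close>, and the front retreats by more than that.\<close>
  have right: "(s - t + u, u) \<in> E" "0 < u \<Longrightarrow> u < t \<Longrightarrow> (s - t + u, u) \<in> U"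
    if st: "(s, t) \<in> E" "0 \<le> u" "u \<le> t" for s t u
    using st fast[of u t] E U by (cases "u = t"; fastforce)+
  have cont_E: "continuous_on E f" "continuous_on E (pd_s E f)" "continuous_on E (pd_t E f)"
    using C1 by (auto simp: C1_region_def intro: differentiable_imp_continuous_on)
  \<comment> \<open>The wave operator factors into two transport operators: the sum of the two first
    derivatives is constant along \<open>s + t\<close> constant, their difference along
    \<open>s - t\<close> constant.\<close>
  have plus: "pd_t E f (s, t) + pd_s E f (s, t) = 2 * P1 (s + t)" if st: "(s, t) \<in> E" for s t
  proof (cases "t = 0")
    case True
    then show ?thesis using init(2)[of s] init_s[of s] st E by auto
  next
    case False
    then have "0 < t" using st E by auto
    let ?g = "\<lambda>u. pd_t E f (s + t - u, u) + pd_s E f (s + t - u, u)"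
    have "?g t = ?g 0"
    proof (rule DERIV_isconst_end[OF \<open>0 < t\<close>])
      show "continuous_on {0..t} ?g"
        by (intro continuous_intros continuous_on_compose2[OF cont_E(2)] continuous_on_compose2[OF cont_E(3)])
          (use left[OF st] in auto)
      fix u assume u: "0 < u" "u < t"
      then have inU: "(s + t - u, u) \<in> U" using left[OF st] by auto
      have "(?g has_real_derivative (pd_s E (pd_t E f) (s + t - u, u) * (-1) + pd_t E (pd_t E f) (s + t - u, u) * 1)
          + (pd_s E (pd_s E f) (s + t - u, u) * (-1) + pd_t E (pd_s E f) (s + t - u, u) * 1)) (at u)"
        by (intro DERIV_add has_real_derivative_along_path[where E = UNIV] DU C1 inU)
          (auto intro!: derivative_eq_intros)
      then show "(?g has_real_derivative 0) (at u)"
        using wave[of "(s + t - u, u)"] schwarz[OF inU] inU UE by auto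
    qed
    then show ?thesis
      using init(2)[of "s + t"] init_s[of "s + t"] left[OF st, of 0] \<open>0 < t\<close> E by auto
  qed
  have minus: "pd_t E f (s, t) - pd_s E f (s, t) = - 2 * Q1 (s - t)" if st: "(s, t) \<in> E" for s t
  proof (cases "t = 0")
    case True
    then show ?thesis using init(2)[of s] init_s[of s] st E by auto
  next
    case False
    then have "0 < t" using st E by auto
    let ?g = "\<lambda>u. pd_t E f (s - t + u, u) - pd_s E f (s - t + u, u)"
    have "?g t = ?g 0"
    proof (rule DERIV_isconst_end[OF \<open>0 < t\<close>])
      show "continuous_on {0..t} ?g"
        by (intro continuous_intros continuous_on_compose2[OF cont_E(2)] continuous_on_compose2[OF cont_E(3)])
          (use right[OF st] in auto)
      fix u assume u: "0 < u" "u < t"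
      then have inU: "(s - t + u, u) \<in> U" using right[OF st] by auto
      have "(?g has_real_derivative (pd_s E (pd_t E f) (s - t + u, u) * 1 + pd_t E (pd_t E f) (s - t + u, u) * 1)
          - (pd_s E (pd_s E f) (s - t + u, u) * 1 + pd_t E (pd_s E f) (s - t + u, u) * 1)) (at u)"
        by (intro DERIV_diff has_real_derivative_along_path[where E = UNIV] DU C1 inU)
          (auto intro!: derivative_eq_intros)
      then show "(?g has_real_derivative 0) (at u)"
        using wave[of "(s - t + u, u)"] schwarz[OF inU] inU UE by auto
    qed
    then show ?thesis
      using init(2)[of "s - t"] init_s[of "s - t"] right[OF st, of 0] \<open>0 < t\<close> E by auto
  qed
  show s: "pd_s E f (s, t) = P1 (s + t) + Q1 (s - t)" and "pd_t E f (s, t) = P1 (s + t) - Q1 (s - t)"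
    using plus[OF st] minus[OF st] by auto
  show "f (s, t) = P (s + t) + Q (s - t)"
  proof (cases "t = 0")
    case True
    then show ?thesis using init(1)[of s] st E by auto
  next
    case False
    then have "0 < t" using st E by auto
    \<comment> \<open>Along \<open>s + t\<close> constant, \<open>f\<close> changes at the rate
      given by the difference of its time and space derivatives. By \<open>minus\<close> this is
      \<open>- 2 * Q1\<close>, evaluated at \<open>s + t - 2 * u\<close>, whose antiderivative is
      subtracted here.\<close>
    let ?g = "\<lambda>u. f (s + t - u, u) - Q (s + t - 2 * u)"
    have "?g t = ?g 0"
    proof (rule DERIV_isconst_end[OF \<open>0 < t\<close>])
      have "continuous_on UNIV Q"
        using Q DERIV_continuous_on has_field_derivative_at_within by metis
      then have "continuous_on {0..t} (\<lambda>u. Q (s + t - 2 * u))"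
        by (rule continuous_on_compose2) (auto intro!: continuous_intros)
      moreover have "continuous_on {0..t} (\<lambda>u. f (s + t - u, u))"
        by (rule continuous_on_compose2[OF cont_E(1)]) (use left[OF st] in \<open>auto intro!: continuous_intros\<close>)
      ultimately show "continuous_on {0..t} ?g"
        by (intro continuous_on_diff)
      fix u assume u: "0 < u" "u < t"
      then have inU: "(s + t - u, u) \<in> U" using left[OF st] by auto
      have "((\<lambda>u. f (s + t - u, u)) has_real_derivative
          pd_s E f (s + t - u, u) * (-1) + pd_t E f (s + t - u, u) * 1) (at u)"
        by (intro has_real_derivative_along_path[where E = UNIV] DU C1 inU)
          (auto intro!: derivative_eq_intros)
      moreover have "((\<lambda>u. Q (s + t - 2 * u)) has_real_derivative Q1 (s + t - 2 * u) * (- 2)) (at u)"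
        by (rule DERIV_chain2[OF Q]) (auto intro!: derivative_eq_intros)
      ultimately have "(?g has_real_derivative (pd_s E f (s + t - u, u) * (-1) + pd_t E f (s + t - u, u) * 1)
          - Q1 (s + t - 2 * u) * (- 2)) (at u)"
        by (rule DERIV_diff)
      moreover have "pd_t E f (s + t - u, u) - pd_s E f (s + t - u, u) = - 2 * Q1 (s + t - 2 * u)"
        using minus[of "s + t - u" u] inU UE by (auto simp: algebra_simps)
      ultimately show "(?g has_real_derivative 0) (at u)"
        by (simp add: algebra_simps)
    qed
    then show ?thesis
      using init(1)[of "s + t"] left[OF st, of 0] \<open>0 < t\<close> E by auto
  qed
qed

subsection \<open>D'Alembert solutions and constants\<close>

definition dalembert :: "(real \<Rightarrow> real) \<Rightarrow> (real \<Rightarrow> real) \<Rightarrow> real \<times> real \<Rightarrow> real" where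
  "dalembert P Q p = P (fst p + snd p) + Q (fst p - snd p)"

lemma dalembert_pair [simp]: "dalembert P Q (s, t) = P (s + t) + Q (s - t)"
  by (simp add: dalembert_def)

lemma dalembert_has_derivative:
  assumes P: "\<And>x. (P has_real_derivative P1 x) (at x)" and Q: "\<And>x. (Q has_real_derivative Q1 x) (at x)"
  shows "(dalembert P Q has_derivative
    (\<lambda>(h, k). dalembert P1 Q1 p * h + dalembert P1 (\<lambda>x. - Q1 x) p * k)) (at p within E)"
proof -
  have sum: "((\<lambda>p::real \<times> real. fst p + snd p) has_derivative (\<lambda>v. fst v + snd v)) (at p within E)"
    and diff: "((\<lambda>p::real \<times> real. fst p - snd p) has_derivative (\<lambda>v. fst v - snd v)) (at p within E)"
    by (auto intro!: derivative_eq_intros)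
  have "((\<lambda>p. P (fst p + snd p)) has_derivative (\<lambda>v. P1 (fst p + snd p) * (fst v + snd v))) (at p within E)"
    using has_derivative_compose[OF sum] P unfolding has_field_derivative_def by blast
  moreover have "((\<lambda>p. Q (fst p - snd p)) has_derivative (\<lambda>v. Q1 (fst p - snd p) * (fst v - snd v))) (at p within E)"
    using has_derivative_compose[OF diff] Q unfolding has_field_derivative_def by blast
  ultimately have "((\<lambda>p. P (fst p + snd p) + Q (fst p - snd p)) has_derivative
      (\<lambda>v. P1 (fst p + snd p) * (fst v + snd v) + Q1 (fst p - snd p) * (fst v - snd v))) (at p within E)"
    by (rule has_derivative_add)
  then show ?thesis
    by (simp add: dalembert_def[abs_def] algebra_simps case_prod_unfold)
qed

lemma continuous_on_dalembert:
  assumes "continuous_on UNIV P" "continuous_on UNIV Q"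
  shows "continuous_on E (dalembert P Q)"
  unfolding dalembert_def[abs_def]
  by (intro continuous_on_add continuous_on_compose2[OF assms(1)] continuous_on_compose2[OF assms(2)])
    (auto intro!: continuous_intros)

lemma has_derivative_cong_on:
  assumes "(g has_derivative D) (at p within E)" "p \<in> E" "\<And>q. q \<in> E \<Longrightarrow> f q = g q"
  shows "(f has_derivative D) (at p within E)"
  using assms has_derivative_transform by metis

lemma dalembert_region:
  assumes E: "approachable E"
    and P: "\<And>x. (P has_real_derivative P1 x) (at x)" "\<And>x. (P1 has_real_derivative P2 x) (at x)"
    and Q: "\<And>x. (Q has_real_derivative Q1 x) (at x)" "\<And>x. (Q1 has_real_derivative Q2 x) (at x)"
    and cont: "continuous_on UNIV P2" "continuous_on UNIV Q2"
    and f: "\<And>p. p \<in> E \<Longrightarrow> f p = dalembert P Q p"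
  shows "C2_region E f"
    and "\<And>p. p \<in> E \<Longrightarrow> pd_s E f p = dalembert P1 Q1 p"
    and "\<And>p. p \<in> E \<Longrightarrow> pd_t E f p = dalembert P1 (\<lambda>x. - Q1 x) p"
    and "\<And>p. p \<in> E \<Longrightarrow> pd_s E (pd_s E f) p = dalembert P2 Q2 p"
    and "\<And>p. p \<in> E \<Longrightarrow> pd_t E (pd_s E f) p = dalembert P2 (\<lambda>x. - Q2 x) p"
    and "\<And>p. p \<in> E \<Longrightarrow> pd_t E (pd_t E f) p = dalembert P2 Q2 p"
proof -
  have Q1': "((\<lambda>x. - Q1 x) has_real_derivative - Q2 x) (at x)" for x
    by (intro DERIV_minus Q)
  have "continuous_on UNIV P1" "continuous_on UNIV Q1"
    using P(2) Q(2) DERIV_continuous_on has_field_derivative_at_within by metis+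
  then have c1: "continuous_on E (dalembert P1 Q1)" "continuous_on E (dalembert P1 (\<lambda>x. - Q1 x))"
    by (auto intro!: continuous_on_dalembert continuous_on_minus)
  have c2: "continuous_on E (dalembert P2 Q2)" "continuous_on E (dalembert P2 (\<lambda>x. - Q2 x))"
    using cont by (auto intro!: continuous_on_dalembert continuous_on_minus)
  note d = has_derivative_cong_on[OF dalembert_has_derivative[OF P(1) Q(1)] _ f]
  have 1: "C1_region E f"
    using C1_regionI[OF E d c1] by blast
  show s: "pd_s E f p = dalembert P1 Q1 p" and t: "pd_t E f p = dalembert P1 (\<lambda>x. - Q1 x) p" if "p \<in> E" for p
    using pd_eqI[OF E that d] that by auto
  note ds = has_derivative_cong_on[OF dalembert_has_derivative[OF P(2) Q(2)] _ s]
  note dt = has_derivative_cong_on[OF dalembert_has_derivative[OF P(2) Q1'] _ t]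
  have "C1_region E (pd_s E f)"
    using C1_regionI[OF E ds c2] by blast
  moreover have "C1_region E (pd_t E f)"
    using C1_regionI[OF E dt] c2 by simp
  ultimately show "C2_region E f"
    using 1 by (simp add: C2_region_def)
  show "pd_s E (pd_s E f) p = dalembert P2 Q2 p" "pd_t E (pd_s E f) p = dalembert P2 (\<lambda>x. - Q2 x) p"
    if "p \<in> E" for p
    using pd_eqI[OF E that ds] that by auto
  show "pd_t E (pd_t E f) p = dalembert P2 Q2 p" if "p \<in> E" for p
    using pd_eqI(2)[OF E that dt] that by auto
qed

section \<open>Comparison with a slower stretched motion\<close>

locale shock_constants =
  fixes N1 \<eta> \<tau> \<zeta> \<sigma>0 \<sigma>1 r T :: real
  assumes eta: "0 < \<eta>" "\<eta> < \<tau>" and zeta: "0 < \<zeta>" and T: "0 < T" and N1: "N1 = \<tau> + \<zeta> * T"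
    and sigma0: "0 < \<sigma>0" and sigma1: "1 < \<sigma>1" and r: "0 < r"
begin

definition lam :: real where "lam = (1 + \<sigma>1) / 2"

text \<open>A slower front: the piece-wise constant stretched motion with speed parameter \<open>lam < \<sigma>1\<close>.
  All fronts under consideration stay ahead of it.\<close>

definition barrier :: "real \<Rightarrow> real" where "barrier t = \<sigma>0 + lam * T * t / (T - t)"

text \<open>The product \<open>(barrier t - t) * (T - t)\<close> is at least the affine function
  \<open>\<sigma>0 * (T - t) + (lam - 1) * T * t\<close>, and \<open>gap\<close> is the smaller of
  its values at 0 and \<open>T\<close>.\<close>

definition gap :: real where "gap = T * min \<sigma>0 ((lam - 1) * T)"

definition decay_const :: real where "decay_const = gap powr (-(r + 1))"

text \<open>Times \<open>B * t\<close>, this bounds the remainder on the barrier: the first summand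
  for times up to \<open>T / 2\<close>, the second for later times.\<close>

definition barrier_const :: real where
  "barrier_const = 4 * lam * \<sigma>0 powr (-(r + 1)) + 8 * \<sigma>0 powr (- r) / (r * T)"

lemma lam: "1 < lam" "lam < \<sigma>1"
  using sigma1 by (auto simp: lam_def)

lemma gap: "0 < gap"
  using T sigma0 lam by (auto simp: gap_def)

lemma decay_const_pos: "0 < decay_const"
  using gap by (simp add: decay_const_def)

lemma barrier_0 [simp]: "barrier 0 = \<sigma>0"
  by (simp add: barrier_def)

lemma barrier_gap:
  assumes "0 \<le> t" "t < T"
  shows "gap / (T - t) \<le> barrier t - t" "\<sigma>0 \<le> barrier t - t"
proof -
  have e: "(barrier t - t) * (T - t) = \<sigma>0 * (T - t) + (lam - 1) * T * t + t * t"
    using assms by (simp add: barrier_def field_simps)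
  have "gap \<le> \<sigma>0 * (T - t) + (lam - 1) * T * t"
  proof -
    have "min \<sigma>0 ((lam - 1) * T) * (T - t) \<le> \<sigma>0 * (T - t)" "min \<sigma>0 ((lam - 1) * T) * t \<le> (lam - 1) * T * t"
      using assms by (intro mult_right_mono; simp)+
    then show ?thesis
      by (simp add: gap_def algebra_simps)
  qed
  then have "gap \<le> (barrier t - t) * (T - t)"
    using e by (smt (verit) zero_le_square)
  then show "gap / (T - t) \<le> barrier t - t"
    using assms by (simp add: pos_divide_le_eq)
  have "\<sigma>0 * (T - t) \<le> (barrier t - t) * (T - t)"
    using e assms lam T by simp
  then show "\<sigma>0 \<le> barrier t - t"
    using assms by simp
qed

lemma barrier_ge: "0 \<le> t \<Longrightarrow> t < T \<Longrightarrow> \<sigma>0 \<le> barrier t"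
  using barrier_gap(2)[of t] by linarith

lemma ahead_of_barrier_decay:
  assumes "0 \<le> t" "t < T" "barrier t - t \<le> x"
  shows "x powr (-(r + 1)) \<le> decay_const * (T - t) powr (r + 1)"
proof -
  have "0 < gap / (T - t)"
    using gap assms by simp
  then have "x powr (-(r + 1)) \<le> (gap / (T - t)) powr (-(r + 1))"
    using barrier_gap(1)[OF assms(1,2)] assms(3) r by (intro powr_mono2') auto
  also have "\<dots> = decay_const * (T - t) powr (r + 1)"
  proof -
    have "(gap / (T - t)) powr (-(r + 1)) = gap powr (-(r + 1)) / (T - t) powr (-(r + 1))"
      by (rule powr_divide)
    moreover have "(T - t) powr (-(r + 1)) = inverse ((T - t) powr (r + 1))"
      by (rule powr_minus)
    ultimately show ?thesis
      by (simp add: decay_const_def divide_inverse)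
  qed
  finally show ?thesis .
qed

end

text \<open>\<open>P1 + Q1\<close> and \<open>P1 - Q1\<close> extend \<open>chi0'\<close> and \<open>chi1\<close> to the whole line, which avoids one-sided
  derivatives; \<open>c\<close> is the limit of \<open>chi1(s) - \<zeta> (s - \<sigma>0)\<close> at infinity, that is \<open>\<sigma>1inf (N1 - \<tau>)\<close>.\<close>

locale shock_data = shock_constants +
  fixes P P1 P2 Q Q1 Q2 :: "real \<Rightarrow> real" and B c :: real
  assumes P: "\<And>x. (P has_real_derivative P1 x) (at x)" "\<And>x. (P1 has_real_derivative P2 x) (at x)"
    and Q: "\<And>x. (Q has_real_derivative Q1 x) (at x)" "\<And>x. (Q1 has_real_derivative Q2 x) (at x)"
    and cont2: "continuous_on UNIV P2" "continuous_on UNIV Q2"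
    and start: "P \<sigma>0 + Q \<sigma>0 = N1 * \<sigma>0"
    and B: "0 \<le> B"
    and P1_bound: "\<And>x. \<sigma>0 \<le> x \<Longrightarrow> \<bar>P1 x - (\<tau> + (\<zeta> * (x - \<sigma>0) + c)) / 2\<bar> \<le> B * x powr (-(r + 1))"
    and Q1_bound: "\<And>x. \<sigma>0 \<le> x \<Longrightarrow> \<bar>Q1 x - (\<tau> - (\<zeta> * (x - \<sigma>0) + c)) / 2\<bar> \<le> B * x powr (-(r + 1))"
    and P2_bound: "\<And>x. \<sigma>0 \<le> x \<Longrightarrow> \<bar>P2 x - \<zeta> / 2\<bar> \<le> B * x powr (-(r + 2))"
    and Q2_bound: "\<And>x. \<sigma>0 \<le> x \<Longrightarrow> \<bar>Q2 x + \<zeta> / 2\<bar> \<le> B * x powr (-(r + 2))"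
    and small: "2 * decay_const * B * T powr r \<le> \<zeta> / 2"
      "2 * decay_const * B * T powr (r + 1) < \<tau> - \<eta>"
      "4 * decay_const * B * T powr (r + 1) < \<zeta> * T * (lam - 1)"
      "barrier_const * B < c - lam * \<zeta> * T"
begin

abbreviation w :: "real \<times> real \<Rightarrow> real" where "w \<equiv> dalembert P Q"
abbreviation ws :: "real \<times> real \<Rightarrow> real" where "ws \<equiv> dalembert P1 Q1"
abbreviation wt :: "real \<times> real \<Rightarrow> real" where "wt \<equiv> dalembert P1 (\<lambda>x. - Q1 x)"
abbreviation err :: "real \<Rightarrow> real" where "err t \<equiv> 2 * decay_const * B * (T - t) powr (r + 1)"

lemma w_s: "((\<lambda>s. w (s, t)) has_real_derivative ws (s, t)) (at s)"
  and w_t: "((\<lambda>t. w (s, t)) has_real_derivative wt (s, t)) (at t)"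
  by (auto intro!: derivative_eq_intros DERIV_chain2[OF P(1)] DERIV_chain2[OF Q(1)])

lemma cont1: "continuous_on UNIV P1" "continuous_on UNIV Q1"
  using P(2) Q(2) DERIV_continuous_on has_field_derivative_at_within by metis+

text \<open>The stretched motion is itself a d'Alembert solution, with the profiles subtracted in
  \<open>P1_bound\<close> and \<open>Q1_bound\<close>, so the deviations of the two profiles simply
  add up. Both are measured at \<open>s - t\<close>, the smaller of the two arguments, where the
  decay is weaker.\<close>

lemma near_stretched_initial:
  assumes "\<sigma>0 \<le> s - t" "0 \<le> t"
  shows "\<bar>ws (s, t) - (\<zeta> * t + \<tau>)\<bar> \<le> 2 * B * (s - t) powr (-(r + 1))"
    and "\<bar>wt (s, t) - (\<zeta> * (s - \<sigma>0) + c)\<bar> \<le> 2 * B * (s - t) powr (-(r + 1))"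
    and "\<bar>dalembert P2 Q2 (s, t)\<bar> \<le> 2 * B * (s - t) powr (-(r + 2))"
    and "\<bar>dalembert P2 (\<lambda>x. - Q2 x) (s, t) - \<zeta>\<bar> \<le> 2 * B * (s - t) powr (-(r + 2))"
proof -
  have mono: "B * (s + t) powr (- k) \<le> B * (s - t) powr (- k)" if "k > 0" for k
    using assms sigma0 B that by (intro mult_left_mono powr_mono2') auto
  have p: "\<bar>P1 (s + t) - (\<tau> + (\<zeta> * (s + t - \<sigma>0) + c)) / 2\<bar> \<le> B * (s - t) powr (-(r + 1))"
    using order_trans[OF P1_bound mono] assms r by simp
  have q: "\<bar>Q1 (s - t) - (\<tau> - (\<zeta> * (s - t - \<sigma>0) + c)) / 2\<bar> \<le> B * (s - t) powr (-(r + 1))"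
    by (rule Q1_bound) (use assms in simp)
  have 1: "ws (s, t) - (\<zeta> * t + \<tau>) = (P1 (s + t) - (\<tau> + (\<zeta> * (s + t - \<sigma>0) + c)) / 2)
      + (Q1 (s - t) - (\<tau> - (\<zeta> * (s - t - \<sigma>0) + c)) / 2)"
    by (simp add: field_simps)
  show "\<bar>ws (s, t) - (\<zeta> * t + \<tau>)\<bar> \<le> 2 * B * (s - t) powr (-(r + 1))"
    unfolding 1 using p q by linarith
  have 2: "wt (s, t) - (\<zeta> * (s - \<sigma>0) + c) = (P1 (s + t) - (\<tau> + (\<zeta> * (s + t - \<sigma>0) + c)) / 2)
      - (Q1 (s - t) - (\<tau> - (\<zeta> * (s - t - \<sigma>0) + c)) / 2)"
    by (simp add: field_simps)
  show "\<bar>wt (s, t) - (\<zeta> * (s - \<sigma>0) + c)\<bar> \<le> 2 * B * (s - t) powr (-(r + 1))"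
    unfolding 2 using p q by linarith
  have p: "\<bar>P2 (s + t) - \<zeta> / 2\<bar> \<le> B * (s - t) powr (-(r + 2))"
    using order_trans[OF P2_bound mono] assms r by simp
  have q: "\<bar>Q2 (s - t) + \<zeta> / 2\<bar> \<le> B * (s - t) powr (-(r + 2))"
    by (rule Q2_bound) (use assms in simp)
  show "\<bar>dalembert P2 Q2 (s, t)\<bar> \<le> 2 * B * (s - t) powr (-(r + 2))"
    and "\<bar>dalembert P2 (\<lambda>x. - Q2 x) (s, t) - \<zeta>\<bar> \<le> 2 * B * (s - t) powr (-(r + 2))"
    using p q unfolding dalembert_pair by linarith+
qed

lemma near_stretched:
  assumes "0 \<le> t" "t < T" "barrier t \<le> s"
  shows "\<bar>ws (s, t) - (\<zeta> * t + \<tau>)\<bar> \<le> err t" "\<bar>wt (s, t) - (\<zeta> * (s - \<sigma>0) + c)\<bar> \<le> err t"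
proof -
  have "2 * B * (s - t) powr (-(r + 1)) \<le> err t"
    using mult_left_mono[OF ahead_of_barrier_decay[of t "s - t"], of "2 * B"] assms B by (simp add: mult_ac)
  moreover have "\<sigma>0 \<le> s - t"
    using barrier_gap(2)[of t] assms by linarith
  ultimately show "\<bar>ws (s, t) - (\<zeta> * t + \<tau>)\<bar> \<le> err t" "\<bar>wt (s, t) - (\<zeta> * (s - \<sigma>0) + c)\<bar> \<le> err t"
    using near_stretched_initial(1,2)[of s t] assms by linarith+
qed

text \<open>The error competes with \<open>N1 - (\<zeta> * t + \<tau>) = \<zeta> * (T - t)\<close>,
  which vanishes at \<open>T\<close>. Splitting off one factor \<open>T - t\<close> leaves a power
  \<open>r > 0\<close> of \<open>T - t\<close>, so the error stays below half of this distance
  uniformly up to \<open>T\<close>.\<close>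

lemma err_bounds:
  assumes "0 \<le> t" "t < T"
  shows "err t \<le> 2 * decay_const * B * T powr (r + 1)" "err t \<le> \<zeta> / 2 * (T - t)" "0 \<le> err t"
proof -
  show "err t \<le> 2 * decay_const * B * T powr (r + 1)" "0 \<le> err t"
    using assms B r decay_const_pos by (auto intro!: mult_left_mono powr_mono2)
  have "2 * decay_const * B * (T - t) powr r \<le> 2 * decay_const * B * T powr r"
    using assms B r decay_const_pos by (auto intro!: mult_left_mono powr_mono2)
  then have "2 * decay_const * B * (T - t) powr r * (T - t) \<le> \<zeta> / 2 * (T - t)"
    using small(1) assms by (intro mult_right_mono) auto
  then show "err t \<le> \<zeta> / 2 * (T - t)"
    using assms by (simp add: powr_add mult.assoc)
qed

lemma tension_bounds:
  assumes "0 \<le> t" "t < T" "barrier t \<le> s"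
  shows "\<eta> < ws (s, t)" "ws (s, t) < N1" "\<zeta> / 2 * (T - t) \<le> N1 - ws (s, t)"
proof -
  note b = near_stretched(1)[OF assms] err_bounds[OF assms(1,2)]
  show "\<eta> < ws (s, t)"
    using b small(2) assms zeta mult_nonneg_nonneg[of \<zeta> t] by linarith
  have "N1 - (\<zeta> * t + \<tau>) = \<zeta> * (T - t)"
    by (simp add: N1 algebra_simps)
  then show *: "\<zeta> / 2 * (T - t) \<le> N1 - ws (s, t)"
    using b by (simp add: field_simps)
  have "0 < \<zeta> / 2 * (T - t)" using zeta assms by simp
  then show "ws (s, t) < N1" using * by linarith
qed

text \<open>The velocity is at least \<open>c - err t\<close> and the denominator at most
  \<open>\<zeta> * T + err t\<close>. As \<open>c > lam * \<zeta> * T\<close>, they differ by more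
  than \<open>\<zeta> * T * (lam - 1) - 2 * err t\<close>, which the third smallness condition keeps
  positive.\<close>

lemma supersonic:
  assumes "0 \<le> t" "t < T" "barrier t \<le> s"
  shows "1 < wt (s, t) / (N1 - ws (s, t))"
proof -
  note b = near_stretched[OF assms] err_bounds[OF assms(1,2)]
  have "\<sigma>0 \<le> s" using barrier_ge[of t] assms by linarith
  then have "c - err t \<le> wt (s, t)"
    using b(2) zeta mult_nonneg_nonneg[of \<zeta> "s - \<sigma>0"] by linarith
  moreover have "N1 - (\<zeta> * t + \<tau>) \<le> \<zeta> * T"
    using zeta assms by (simp add: N1)
  then have "N1 - ws (s, t) \<le> \<zeta> * T + err t"
    using b(1) by linarith
  moreover have "0 \<le> barrier_const * B"
    using B lam r T by (simp add: barrier_const_def)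
  then have "lam * \<zeta> * T < c"
    using small(4) by linarith
  then have "\<zeta> * T * (lam - 1) < c - \<zeta> * T"
    by (simp add: algebra_simps)
  ultimately have "N1 - ws (s, t) < wt (s, t)"
    using b(3) small(3) by linarith
  then show ?thesis
    using tension_bounds(2)[OF assms] by simp
qed

end

subsection \<open>The shock front\<close>

context shock_data
begin

text \<open>Two bounds for the same increment: near \<open>\<sigma>0\<close> the largest value of
  the derivative bound times the length, and far away the integrated decay. The second compares both
  endpoints with the limit at infinity, whence its factor 2.\<close>

lemma remainder_bound:
  assumes G: "\<And>x. \<sigma>0 \<le> x \<Longrightarrow> (G has_real_derivative g x) (at x)"
    and g: "\<And>x. \<sigma>0 \<le> x \<Longrightarrow> \<bar>g x\<bar> \<le> B * x powr (-(r + 1))" and x: "\<sigma>0 \<le> x"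
  shows "\<bar>G x - G \<sigma>0\<bar> \<le> B * \<sigma>0 powr (-(r + 1)) * (x - \<sigma>0)"
    and "\<bar>G x - G \<sigma>0\<bar> \<le> 2 * B * \<sigma>0 powr (- r) / r"
proof -
  have g': "\<bar>g y\<bar> \<le> B * \<sigma>0 powr (-(r + 1))" if "\<sigma>0 \<le> y" for y
  proof -
    have "y powr (-(r + 1)) \<le> \<sigma>0 powr (-(r + 1))"
      using that sigma0 r by (intro powr_mono2') auto
    then show ?thesis
      using g[OF that] mult_left_mono[OF _ B] by (meson order_trans)
  qed
  have "norm (G x - G \<sigma>0) \<le> B * \<sigma>0 powr (-(r + 1)) * norm (x - \<sigma>0)"
    by (rule field_differentiable_bound[of "{\<sigma>0..}" G g])
      (use x g' G in \<open>auto intro: has_field_derivative_at_within\<close>)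
  then show "\<bar>G x - G \<sigma>0\<bar> \<le> B * \<sigma>0 powr (-(r + 1)) * (x - \<sigma>0)"
    using x by simp
  obtain l where l: "\<And>y. y \<ge> \<sigma>0 \<Longrightarrow> \<bar>G y - l\<bar> \<le> B / r * y powr (- r)"
    using decay_limit[OF sigma0 r G g] by blast
  have "B / r * x powr (- r) \<le> B / r * \<sigma>0 powr (- r)"
    using x sigma0 r B by (intro mult_left_mono powr_mono2') auto
  then have "\<bar>G x - G \<sigma>0\<bar> \<le> 2 * (B / r * \<sigma>0 powr (- r))"
    using l[OF x] l[of \<sigma>0] by linarith
  then show "\<bar>G x - G \<sigma>0\<bar> \<le> 2 * B * \<sigma>0 powr (- r) / r"
    by simp
qed

text \<open>After subtraction of the stretched profiles, \<open>p\<close> and \<open>q\<close> carry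
  only the perturbation. On the barrier \<open>(s - \<sigma>0) * (T - t) = lam * T * t\<close>, so
  the explicit part collapses to \<open>(c - lam * \<zeta> * T) * t\<close>. This margin vanishes at
  time 0, and the remainder has to vanish there at the same linear rate.\<close>

lemma barrier_excess:
  assumes t: "0 < t" "t < T"
  shows "N1 * barrier t < w (barrier t, t)"
proof -
  define s where "s = barrier t"
  have s: "\<sigma>0 \<le> s - t" "\<sigma>0 \<le> s + t"
    using barrier_gap(2)[of t] t by (auto simp: s_def)
  define p where "p x = P x - (\<tau> * (x - \<sigma>0) + (\<zeta> * (x - \<sigma>0)\<^sup>2 / 2 + c * (x - \<sigma>0))) / 2" for x
  define q where "q x = Q x - (\<tau> * (x - \<sigma>0) - (\<zeta> * (x - \<sigma>0)\<^sup>2 / 2 + c * (x - \<sigma>0))) / 2" for x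
  have dp: "(p has_real_derivative P1 x - (\<tau> + (\<zeta> * (x - \<sigma>0) + c)) / 2) (at x)" for x
    unfolding p_def by (auto intro!: derivative_eq_intros P simp: field_simps)
  have dq: "(q has_real_derivative Q1 x - (\<tau> - (\<zeta> * (x - \<sigma>0) + c)) / 2) (at x)" for x
    unfolding q_def by (auto intro!: derivative_eq_intros Q simp: field_simps)
  note bp = remainder_bound[OF dp P1_bound s(2)] and bq = remainder_bound[OF dq Q1_bound s(1)]
  define R where "R = (p (s + t) - p \<sigma>0) + (q (s - t) - q \<sigma>0)"
  have s_eq: "s - \<sigma>0 = lam * T * t / (T - t)"
    by (simp add: s_def barrier_def)
  have "P \<sigma>0 + Q \<sigma>0 = N1 * \<sigma>0" by (rule start)
  then have "w (s, t) - N1 * s = - (N1 - \<tau> - \<zeta> * t) * (s - \<sigma>0) + c * t + R"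
    unfolding R_def p_def q_def dalembert_pair by (simp add: field_simps power2_eq_square)
  also have "N1 - \<tau> - \<zeta> * t = \<zeta> * (T - t)"
    by (simp add: N1 algebra_simps)
  also have "- (\<zeta> * (T - t)) * (s - \<sigma>0) = - (lam * \<zeta> * T) * t"
    using t by (simp add: s_eq)
  finally have F: "w (s, t) - N1 * s = (c - lam * \<zeta> * T) * t + R"
    by (simp add: algebra_simps)
  \<comment> \<open>Up to \<open>T / 2\<close> the barrier has moved by at most
    \<open>2 * lam * t\<close>, so the first bound for the increments is linear in \<open>t\<close>.
    Afterwards \<open>1 \<le> 2 * t / T\<close> makes the uniform bound linear.\<close>
  have "\<bar>R\<bar> \<le> barrier_const * B * t"
  proof (cases "t \<le> T / 2")
    case True
    have "T * t \<le> 2 * t * (T - t)"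
      using mult_right_mono[OF True, of t] t by (simp add: algebra_simps)
    then have "T * t / (T - t) \<le> 2 * t"
      using t by (simp add: pos_divide_le_eq)
    then have "lam * (T * t / (T - t)) \<le> lam * (2 * t)"
      using lam by (intro mult_left_mono) auto
    then have s2: "s - \<sigma>0 \<le> 2 * lam * t"
      using s_eq by (simp add: algebra_simps)
    have "\<bar>R\<bar> \<le> B * \<sigma>0 powr (-(r + 1)) * (s + t - \<sigma>0) + B * \<sigma>0 powr (-(r + 1)) * (s - t - \<sigma>0)"
      using bp(1) bq(1) unfolding R_def by linarith
    also have "\<dots> = 2 * B * \<sigma>0 powr (-(r + 1)) * (s - \<sigma>0)"
      by (simp add: algebra_simps)
    also have "\<dots> \<le> 2 * B * \<sigma>0 powr (-(r + 1)) * (2 * lam * t)"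
      using B s2 by (intro mult_left_mono) auto
    also have "\<dots> = 4 * lam * \<sigma>0 powr (-(r + 1)) * B * t"
      by simp
    also have "\<dots> \<le> barrier_const * B * t"
      using t B r T by (intro mult_right_mono) (auto simp: barrier_const_def)
    finally show ?thesis .
  next
    case False
    have "\<bar>R\<bar> \<le> 4 * B * \<sigma>0 powr (- r) / r"
      using bp(2) bq(2) unfolding R_def by linarith
    also have "\<dots> \<le> 4 * B * \<sigma>0 powr (- r) / r * (2 * t / T)"
    proof -
      have "1 \<le> 2 * t / T"
        using False T by (simp add: field_simps)
      then show ?thesis
        using mult_left_mono[of 1 "2 * t / T" "4 * B * \<sigma>0 powr (- r) / r"] B r by simp
    qed
    also have "\<dots> = 8 * \<sigma>0 powr (- r) / (r * T) * B * t"
      by simp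
    also have "\<dots> \<le> barrier_const * B * t"
      using t B lam by (intro mult_right_mono) (auto simp: barrier_const_def)
    finally show ?thesis .
  qed
  moreover have "barrier_const * B * t < (c - lam * \<zeta> * T) * t"
    using small(4) t by simp
  ultimately show ?thesis
    using F unfolding s_def[symmetric] by linarith
qed

text \<open>Strict decrease alone would not force a zero on an unbounded half-line; the explicit
  rate, half the unperturbed slope, does.\<close>

lemma w_steep:
  assumes "0 \<le> t" "t < T" "barrier t \<le> s" "s \<le> s'"
  shows "w (s', t) - N1 * s' \<le> w (s, t) - N1 * s - \<zeta> / 2 * (T - t) * (s' - s)"
proof -
  have "(w (s', t) - N1 * s') + \<zeta> / 2 * (T - t) * s' \<le> (w (s, t) - N1 * s) + \<zeta> / 2 * (T - t) * s"
  proof (rule DERIV_nonpos_imp_nonincreasing[OF assms(4)])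
    fix x assume "s \<le> x" "x \<le> s'"
    then have "ws (x, t) - N1 + \<zeta> / 2 * (T - t) \<le> 0"
      using tension_bounds(3)[of t x] assms by simp
    moreover have "((\<lambda>x. (w (x, t) - N1 * x) + \<zeta> / 2 * (T - t) * x) has_real_derivative
        ws (x, t) - N1 + \<zeta> / 2 * (T - t)) (at x)"
      by (rule derivative_eq_intros w_s refl | simp)+
    ultimately show "\<exists>y. ((\<lambda>x. (w (x, t) - N1 * x) + \<zeta> / 2 * (T - t) * x) has_real_derivative y) (at x) \<and> y \<le> 0"
      by blast
  qed
  then show ?thesis
    unfolding right_diff_distrib by linarith
qed

lemma w_strict:
  assumes "0 \<le> t" "t < T" "barrier t \<le> s" "s < s'"
  shows "w (s', t) - N1 * s' < w (s, t) - N1 * s"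
proof -
  have "0 < \<zeta> / 2 * (T - t) * (s' - s)"
    using assms zeta by simp
  then show ?thesis
    using w_steep[of t s s'] assms by linarith
qed

lemma barrier_excess_weak:
  assumes "0 \<le> t" "t < T"
  shows "N1 * barrier t \<le> w (barrier t, t)"
  using barrier_excess[of t] assms start by (cases "t = 0") auto

lemma front_ex1:
  assumes t: "0 \<le> t" "t < T"
  shows "\<exists>!s. barrier t \<le> s \<and> w (s, t) = N1 * s"
proof -
  let ?F = "\<lambda>s. w (s, t) - N1 * s"
  define k where "k = \<zeta> / 2 * (T - t)"
  \<comment> \<open>Falling at rate at least \<open>k\<close>, the excess at the barrier is used up
    no later than here, which brackets the zero.\<close>
  define s' where "s' = barrier t + ?F (barrier t) / k"
  have pos: "0 < k" using zeta t by (simp add: k_def)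
  have le: "barrier t \<le> s'"
    using barrier_excess_weak[OF t] pos by (simp add: s'_def)
  have "?F s' \<le> ?F (barrier t) - k * (s' - barrier t)"
    unfolding k_def using w_steep[OF t order_refl le] .
  also have "\<dots> = 0"
    using pos by (simp add: s'_def)
  finally have "?F s' \<le> 0" .
  moreover have "isCont ?F x" for x
    by (intro continuous_diff DERIV_isCont[OF w_s] continuous_intros)
  ultimately obtain s where "barrier t \<le> s" "?F s = 0"
    using IVT2[of ?F s' 0 "barrier t"] barrier_excess_weak[OF t] le by auto
  moreover have "s1 = s2" if "barrier t \<le> s1" "w (s1, t) = N1 * s1" "barrier t \<le> s2" "w (s2, t) = N1 * s2" for s1 s2
    using w_strict[OF t that(1), of s2] w_strict[OF t that(3), of s1] that by (cases s1 s2 rule: linorder_cases) auto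
  ultimately show ?thesis
    by (metis diff_eq_diff_eq right_minus_eq)
qed

definition front :: "real \<Rightarrow> real" where
  "front t = (THE s. barrier t \<le> s \<and> w (s, t) = N1 * s)"

lemma front:
  assumes "0 \<le> t" "t < T"
  shows "barrier t \<le> front t" "w (front t, t) = N1 * front t"
  using theI'[OF front_ex1[OF assms]] by (auto simp: front_def)

lemma front_eqI:
  assumes "0 \<le> t" "t < T" "barrier t \<le> s" "w (s, t) = N1 * s"
  shows "front t = s"
  using front_ex1[OF assms(1,2)] front[OF assms(1,2)] assms(3,4) by blast

lemma front_0 [simp]: "front 0 = \<sigma>0"
  by (rule front_eqI) (use T start in auto)

lemma front_le: "0 \<le> t \<Longrightarrow> t < T \<Longrightarrow> barrier t \<le> s \<Longrightarrow> w (s, t) < N1 * s \<Longrightarrow> front t < s"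
  using w_strict[of t s "front t"] front[of t] by (cases s "front t" rule: linorder_cases) auto

lemma front_ge: "0 \<le> t \<Longrightarrow> t < T \<Longrightarrow> barrier t \<le> s \<Longrightarrow> N1 * s < w (s, t) \<Longrightarrow> s < front t"
  using w_strict[of t "front t" s] front[of t] by (cases s "front t" rule: linorder_cases) auto

lemma barrier_less_front:
  assumes "0 < t" "t < T"
  shows "barrier t < front t"
  using front_ge[of t "barrier t"] barrier_excess[OF assms] assms by auto

text \<open>Since \<open>w - N1 s\<close> is strictly decreasing beyond the barrier, its sign at a
  test point tells on which side the front lies, and this sign persists for nearby times. The test
  points must themselves stay beyond the moving barrier.\<close>

lemma continuous_front:
  assumes t0: "0 \<le> t0" "t0 < T"
  shows "continuous (at t0 within {0..<T}) front"
  unfolding continuous_within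
proof (rule order_tendstoI)
  have cb: "((\<lambda>t. barrier t) \<longlongrightarrow> barrier t0) (at t0 within {0..<T})"
    unfolding barrier_def by (intro tendsto_intros) (use t0 in auto)
  have cw: "((\<lambda>t. w (s, t)) \<longlongrightarrow> w (s, t0)) (at t0 within {0..<T})" for s
    using continuous_at_imp_continuous_at_within[OF DERIV_isCont[OF w_t]] unfolding continuous_within .
  have ev: "\<forall>\<^sub>F t in at t0 within {0..<T}. t \<in> {0..<T}"
    by (simp add: eventually_at_filter)
  fix a :: real
  {
    assume a: "front t0 < a"
    have "barrier t0 < a" "w (a, t0) < N1 * a"
      using front[OF t0] a w_strict[OF t0 _ a] by auto
    then have "\<forall>\<^sub>F t in at t0 within {0..<T}. barrier t < a" "\<forall>\<^sub>F t in at t0 within {0..<T}. w (a, t) < N1 * a"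
      using order_tendstoD(2)[OF cb] order_tendstoD(2)[OF cw] by auto
    then show "\<forall>\<^sub>F t in at t0 within {0..<T}. front t < a"
      using ev by eventually_elim (use front_le in auto)
  next
    assume a: "a < front t0"
    show "\<forall>\<^sub>F t in at t0 within {0..<T}. a < front t"
    \<comment> \<open>At time 0 front and barrier coincide and no test point fits between them;
      there the bound \<open>\<sigma>0 \<le> front t\<close> takes over.\<close>
    proof (cases "t0 = 0")
      case True
      show ?thesis
        using ev
      proof eventually_elim
        case (elim t)
        then show ?case
          using a front(1)[of t] barrier_ge[of t] True by auto
      qed
    next
      case False
      define b where "b = (max a (barrier t0) + front t0) / 2"
      have b: "a < b" "barrier t0 < b" "b < front t0"
        using a barrier_less_front[of t0] t0 False by (auto simp: b_def)
      then have "N1 * b < w (b, t0)"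
        using front[OF t0] w_strict[OF t0 _ b(3)] by auto
      then have "\<forall>\<^sub>F t in at t0 within {0..<T}. barrier t < b" "\<forall>\<^sub>F t in at t0 within {0..<T}. N1 * b < w (b, t)"
        using order_tendstoD(2)[OF cb b(2)] order_tendstoD(1)[OF cw] by auto
      then show ?thesis
        using ev
      proof eventually_elim
        case (elim t)
        then show ?case
          using b(1) front_ge[of t b] by auto
      qed
    qed
  }
qed

lemma continuous_on_front: "continuous_on {0..<T} front"
  using continuous_front by (auto simp: continuous_on_eq_continuous_within)

section \<open>Speed and smoothness of the front\<close>

definition speed :: "real \<Rightarrow> real" where
  "speed t = wt (front t, t) / (N1 - ws (front t, t))"

text \<open>Implicit differentiation of \<open>w(s, t) = N1 s\<close> returns exactly the speed
  prescribed by the jump condition (4): continuity of the position across the front already encodes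
  it.\<close>

lemma front_deriv:
  assumes t: "t \<in> {0..<T}"
  shows "(front has_real_derivative speed t) (at t within {0..<T})"
proof -
  have "((\<lambda>p. N1 * fst p) has_derivative (\<lambda>v. N1 * fst v)) (at (front t, t))"
    by (auto intro!: derivative_eq_intros)
  from has_derivative_diff[OF dalembert_has_derivative[OF P(1) Q(1)] this]
  have "((\<lambda>p. w p - N1 * fst p) has_derivative (\<lambda>(h, k). (ws (front t, t) - N1) * h + wt (front t, t) * k)) (at (front t, t))"
    by (simp add: case_prod_unfold algebra_simps)
  moreover have "ws (front t, t) - N1 \<noteq> 0"
    using tension_bounds(2)[of t "front t"] front[of t] t by auto
  ultimately have "(front has_real_derivative - wt (front t, t) / (ws (front t, t) - N1)) (at t within {0..<T})"
    by (rule implicit_function_has_derivative) (use continuous_front front t in auto)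
  moreover have "- wt (front t, t) / (ws (front t, t) - N1) = speed t"
  proof -
    have "ws (front t, t) - N1 = - (N1 - ws (front t, t))"
      by simp
    then show ?thesis
      by (simp only: speed_def minus_divide_divide)
  qed
  ultimately show ?thesis
    by simp
qed

lemma speed_gt_1: "t \<in> {0..<T} \<Longrightarrow> 1 < speed t"
  unfolding speed_def using supersonic[of t "front t"] front[of t] by auto

lemma front_fast:
  assumes "0 \<le> t" "t < u" "u < T"
  shows "front t - t < front u - u"
proof -
  have cont: "continuous_on {t..u} front"
    by (rule continuous_on_subset[OF continuous_on_front]) (use assms in auto)
  have "((\<lambda>x. front x - x) has_real_derivative speed x - 1) (at x)" if "t < x" "x < u" for x
  proof -
    have "at x within {0..<T} = at x"
      using that assms by (intro at_within_interior) auto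
    then show ?thesis
      using front_deriv[of x] that assms by (auto intro!: derivative_eq_intros)
  qed
  then show ?thesis
    using DERIV_pos_imp_increasing_open[OF assms(2), of "\<lambda>x. front x - x"] speed_gt_1 assms cont
    by (force intro!: continuous_intros)
qed

lemma front_mono:
  assumes "0 \<le> t" "t \<le> u" "u < T"
  shows "front t \<le> front u"
  using front_fast[of t u] assms by (cases "t = u") auto

lemma front_ge_sigma0: "0 \<le> t \<Longrightarrow> t < T \<Longrightarrow> \<sigma>0 \<le> front t - t"
  using front(1)[of t] barrier_gap(2)[of t] by linarith

text \<open>This gives the second derivative of the front. Once the front is differentiable, the
  formula for its speed contains only first derivatives of \<open>w\<close> along it and can be
  differentiated again.\<close>

lemma speed_deriv:
  obtains speed' where "\<And>t. t \<in> {0..<T} \<Longrightarrow> (speed has_real_derivative speed' t) (at t within {0..<T})"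
    and "continuous_on {0..<T} speed'"
proof -
  let ?wss = "dalembert P2 Q2" and ?wst = "dalembert P2 (\<lambda>x. - Q2 x)"
  define ds where "ds t = ?wss (front t, t) * speed t + ?wst (front t, t)" for t
  define dt where "dt t = ?wst (front t, t) * speed t + ?wss (front t, t)" for t
  define speed' where "speed' t = (dt t * (N1 - ws (front t, t)) - wt (front t, t) * (- ds t))
    / ((N1 - ws (front t, t)) * (N1 - ws (front t, t)))" for t
  have nz: "N1 - ws (front t, t) \<noteq> 0" if "t \<in> {0..<T}" for t
    using tension_bounds(2)[of t "front t"] front[of t] that by auto
  have Q1': "((\<lambda>x. - Q1 x) has_real_derivative - Q2 x) (at x)" for x
    by (intro DERIV_minus Q)
  have s: "((\<lambda>t. ws (front t, t)) has_real_derivative ds t) (at t within {0..<T})"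
    and t: "((\<lambda>t. wt (front t, t)) has_real_derivative dt t) (at t within {0..<T})"
    if "t \<in> {0..<T}" for t
    using has_real_derivative_along_path[where E = UNIV and y = "\<lambda>t. t", OF dalembert_has_derivative[OF P(2) Q(2)] front_deriv[OF that] DERIV_ident]
      has_real_derivative_along_path[where E = UNIV and y = "\<lambda>t. t", OF dalembert_has_derivative[OF P(2) Q1'] front_deriv[OF that] DERIV_ident]
    by (auto simp: ds_def dt_def)
  have d: "(speed has_real_derivative speed' t) (at t within {0..<T})" if "t \<in> {0..<T}" for t
  proof -
    have "((\<lambda>t. N1 - ws (front t, t)) has_real_derivative 0 - ds t) (at t within {0..<T})"
      by (intro DERIV_diff DERIV_const s that)
    then show ?thesis
      unfolding speed_def[abs_def] speed'_def
      using DERIV_divide[of "\<lambda>t. wt (front t, t)" "dt t" t "{0..<T}" "\<lambda>t. N1 - ws (front t, t)" "- ds t"]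
        t[OF that] nz[OF that] by simp
  qed
  have path: "continuous_on {0..<T} (\<lambda>t. (front t, t))"
    by (intro continuous_intros continuous_on_front)
  have c: "continuous_on {0..<T} (\<lambda>t. g (front t, t))" if "continuous_on UNIV g" for g :: "real \<times> real \<Rightarrow> real"
    using continuous_on_compose2[OF that path] by auto
  have cs: "continuous_on {0..<T} speed"
    using d DERIV_continuous_on by blast
  have "continuous_on {0..<T} speed'"
    unfolding speed'_def ds_def dt_def
    by (intro continuous_intros c continuous_on_dalembert cont1 cont2 cs) (use nz in auto)
  then show ?thesis
    using that d by blast
qed

end

subsection \<open>Existence\<close>

lemma closed_in_sets_lebesgue: "closed S \<Longrightarrow> S \<in> sets lebesgue"
  by (simp add: borel_closed sets_completionI_sets)

text \<open>Lebesgue measure is complete, so arbitrary values on the negligible set \<open>Z\<close>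
  do no harm. For the velocity \<open>Z\<close> is the graph of the front, where
  \<open>position\<close> has a kink; for the tension it is empty.\<close>

lemma Linf_on_piecewise:
  fixes f :: "'a::euclidean_space \<Rightarrow> real"
  assumes S: "S \<in> sets lebesgue" and Z: "negligible Z"
    and cont: "continuous_on S h" "continuous_on S f1" "continuous_on S f2"
    and f: "\<And>x. x \<in> S - Z \<Longrightarrow> f x = (if h x \<le> (0::real) then f1 x else f2 x)"
    and bound: "\<And>x. x \<in> S - Z \<Longrightarrow> \<bar>f x\<bar> \<le> K"
  shows "Linf_on S f"
proof -
  define g where "g x = (if h x \<le> 0 then f1 x else f2 x)" for x
  note m = continuous_imp_measurable_on_sets_lebesgue[OF _ S]
  have "{x \<in> space (lebesgue_on S). h x \<le> 0} \<in> sets (lebesgue_on S)"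
    using m[OF cont(1)] by measurable
  then have g: "g \<in> borel_measurable (lebesgue_on S)"
    unfolding g_def[abs_def] by (rule measurable_If[OF m[OF cont(2)] m[OF cont(3)]])
  have sets: "A \<in> sets (lebesgue_on S) \<longleftrightarrow> A \<in> sets lebesgue \<and> A \<subseteq> S" for A
    using S by (auto simp: sets_restrict_space_iff)
  have "f \<in> borel_measurable (lebesgue_on S)"
  proof (rule measurableI)
    fix A :: "real set" assume "A \<in> sets borel"
    then have "g -` A \<inter> S \<in> sets lebesgue"
      using measurable_sets[OF g] sets by fastforce
    moreover have "Z \<in> sets lebesgue" "f -` A \<inter> S \<inter> Z \<in> sets lebesgue"
      using Z by (auto intro!: negligible_imp_sets intro: negligible_subset)
    ultimately have "(g -` A \<inter> S - Z) \<union> (f -` A \<inter> S \<inter> Z) \<in> sets lebesgue"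
      by blast
    moreover have "f -` A \<inter> S = (g -` A \<inter> S - Z) \<union> (f -` A \<inter> S \<inter> Z)"
      using f by (auto simp: g_def)
    ultimately show "f -` A \<inter> space (lebesgue_on S) \<in> sets (lebesgue_on S)"
      using sets by auto
  qed auto
  moreover have "AE x in lebesgue_on S. \<bar>f x\<bar> \<le> K"
  proof (rule AE_I')
    have "negligible (S \<inter> Z)"
      using Z by (auto intro: negligible_subset)
    then show "S \<inter> Z \<in> null_sets (lebesgue_on S)"
      using S by (simp add: null_sets_restrict_space negligible_iff_null_sets)
  qed (use bound in auto)
  ultimately show ?thesis
    unfolding Linf_on_def by blast
qed

lemma negligible_graph:
  fixes g :: "real \<Rightarrow> real"
  assumes "g differentiable_on J"
  shows "negligible ((\<lambda>t. (g t, t)) ` J)"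
proof (rule negligible_differentiable_image_lowdim)
  show "(\<lambda>t. (g t, t)) differentiable_on J"
    unfolding differentiable_on_def
  proof
    fix t assume "t \<in> J"
    then obtain D where "(g has_derivative D) (at t within J)"
      using assms unfolding differentiable_on_def differentiable_def by blast
    then have "((\<lambda>t. (g t, t)) has_derivative (\<lambda>h. (D h, h))) (at t within J)"
      by (intro has_derivative_Pair has_derivative_ident)
    then show "(\<lambda>t. (g t, t)) differentiable at t within J"
      by (rule differentiableI)
  qed
qed simp

context shock_constants
begin

text \<open>Solutions are defined on closed time intervals, while the estimates take derivatives
  within the half-open one. Derivatives within a set refer to that set, so both kinds of interval
  are treated together.\<close>

definition time_window :: "real set \<Rightarrow> bool" where
  "time_window J \<longleftrightarrow> J = {0..<T} \<or> (\<exists>T'. 0 < T' \<and> T' < T \<and> J = {0..T'})"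

lemma time_window:
  assumes "time_window J"
  shows "J \<subseteq> {0..<T}" "0 \<in> J" "t \<in> J \<Longrightarrow> 0 \<le> u \<Longrightarrow> u \<le> t \<Longrightarrow> u \<in> J"
    "\<exists>u>0. u \<in> J" "is_interval J"
  using assms dense[OF T] unfolding time_window_def by (auto simp: is_interval_ci is_interval_cc is_interval_co)

lemma time_window_nontrivial:
  assumes "time_window J" "t \<in> J"
  shows "at t within J \<noteq> bot"
proof -
  obtain u where "u > 0" "u \<in> J" using time_window(4)[OF assms(1)] by blast
  then show ?thesis
    using at_within_interval_nontrivial[OF time_window(5)[OF assms(1)] assms(2)] time_window(2)[OF assms(1)]
    by (metis less_irrefl)
qed

end

section \<open>The explicit solution and its traces on the front\<close>

context shock_data
begin

definition position :: "real \<times> real \<Rightarrow> real" where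
  "position p = (if fst p \<le> front (snd p) then N1 * fst p else w p)"

definition inner_tension :: "real \<Rightarrow> real" where
  "inner_tension t = ws (front t, t) + (speed t)\<^sup>2 * (N1 - ws (front t, t))"

definition tension :: "real \<times> real \<Rightarrow> real" where
  "tension p = (if front (snd p) \<le> fst p then ws p else inner_tension (snd p))"

lemma front_deriv_window:
  assumes "time_window J" "t \<in> J"
  shows "(front has_real_derivative speed t) (at t within J)" "deriv_on J front t = speed t"
proof -
  show "(front has_real_derivative speed t) (at t within J)"
    using has_field_derivative_subset[OF front_deriv time_window(1)[OF assms(1)]]
      time_window(1)[OF assms(1)] assms(2) by blast
  then show "deriv_on J front t = speed t"
    by (rule deriv_on_eqI) (rule time_window_nontrivial[OF assms])
qed

lemma C2_on_front:
  assumes "time_window J"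
  shows "C2_on J front"
proof -
  note J = time_window(1)[OF assms]
  obtain speed' where s: "\<And>t. t \<in> {0..<T} \<Longrightarrow> (speed has_real_derivative speed' t) (at t within {0..<T})"
    "continuous_on {0..<T} speed'"
    using speed_deriv by blast
  show ?thesis
  proof (rule C2_onI)
    show "(front has_real_derivative speed t) (at t within J)" if "t \<in> J" for t
      by (rule front_deriv_window[OF assms that])
    show "(speed has_real_derivative speed' t) (at t within J)" if "t \<in> J" for t
      using has_field_derivative_subset[OF s(1) J] J that by blast
    show "continuous_on J speed'"
      by (rule continuous_on_subset[OF s(2) J])
  qed (rule time_window_nontrivial[OF assms])
qed

lemma approachable_ahead_of_front:
  assumes "time_window J"
  shows "approachable (ext_region front J)"
proof -
  note J = time_window[OF assms]
  have "((\<lambda>d. (front d - front 0) / (d - 0)) \<longlongrightarrow> speed 0) (at 0 within J)"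
    using front_deriv_window(1)[OF assms J(2)] by (simp add: has_field_derivative_iff)
  \<comment> \<open>Any slope above the initial speed keeps ahead of the front for a short time;
    adding 1 to \<open>speed 0\<close> gives the slanted direction at the starting point.\<close>
  then have "\<forall>\<^sub>F d in at 0 within J. (front d - front 0) / (d - 0) < speed 0 + 1"
    by (rule order_tendstoD) simp
  then obtain e where e: "e > 0" "\<And>d. d \<in> J \<Longrightarrow> d \<noteq> 0 \<Longrightarrow> dist d 0 < e \<Longrightarrow> (front d - front 0) / (d - 0) < speed 0 + 1"
    unfolding eventually_at by blast
  obtain u where u: "u > 0" "u \<in> J" using J(4) by blast
  show ?thesis
  proof (rule approachable_ext_region[where ?d0.0 = "min e u" and K = "speed 0 + 1"])
    show "d \<in> J \<and> front d \<le> front 0 + (speed 0 + 1) * d" if "0 < d" "d < min e u" for d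
    proof -
      have d: "d \<in> J" using J(3)[OF u(2), of d] that by simp
      then have "(front d - front 0) / d < speed 0 + 1"
        using e(2)[of d] that by simp
      then show ?thesis
        using d that by (simp add: pos_divide_less_eq)
    qed
    show "front u \<le> front t" if "t \<in> J" "0 \<le> u" "u \<le> t" for t u
      using front_mono[of u t] that J(1) by auto
  qed (use J e u in auto)
qed

lemma ahead_of_front:
  assumes "time_window J" "(s, t) \<in> ext_region front J"
  shows "0 \<le> t" "t < T" "barrier t \<le> s" "front t \<le> s" "\<sigma>0 \<le> s - t"
  using assms time_window(1)[OF assms(1)] front(1)[of t] front_ge_sigma0[of t]
  by (auto simp: ext_region_def subset_iff)

lemma position_ahead:
  assumes "time_window J" "p \<in> ext_region front J"
  shows "position p = w p"
proof -
  obtain s t where p: "p = (s, t)" by (cases p)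
  then show ?thesis
    using ahead_of_front[OF assms(1)] assms(2) front(2)[of t] unfolding position_def by fastforce
qed

lemma position_partials:
  assumes J: "time_window J"
  defines "E \<equiv> ext_region front J"
  shows "C2_region E position"
    and "\<And>p. p \<in> E \<Longrightarrow> pd_s E position p = ws p"
    and "\<And>p. p \<in> E \<Longrightarrow> pd_t E position p = wt p"
    and "\<And>p. p \<in> E \<Longrightarrow> pd_s E (pd_s E position) p = dalembert P2 Q2 p"
    and "\<And>p. p \<in> E \<Longrightarrow> pd_t E (pd_s E position) p = dalembert P2 (\<lambda>x. - Q2 x) p"
    and "\<And>p. p \<in> E \<Longrightarrow> pd_t E (pd_t E position) p = dalembert P2 Q2 p"
  unfolding E_def
  using dalembert_region[OF approachable_ahead_of_front[OF J] P Q cont2 position_ahead[OF J]] by blast+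

lemma ext_trace_tension:
  assumes "time_window J" "p \<in> ext_region front J"
  shows "ext_trace front tension p = ws p"
proof -
  obtain s t where p: "p = (s, t)" by (cases p)
  have s: "front t \<le> s" using ahead_of_front[OF assms(1)] assms(2) p by blast
  have "((\<lambda>x. ws (x, t)) \<longlongrightarrow> ws (front t, t)) (at_right (front t))"
  proof -
    have "isCont (\<lambda>x. ws (x, t)) (front t)"
      unfolding dalembert_pair by (auto intro!: continuous_intros DERIV_isCont derivative_eq_intros DERIV_chain2[OF P(2)] DERIV_chain2[OF Q(2)])
    then show ?thesis
      using continuous_at_imp_continuous_at_within continuous_within by blast
  qed
  moreover have "\<forall>\<^sub>F x in at_right (front t). ws (x, t) = tension (x, t)"
    unfolding eventually_at_filter by (auto simp: tension_def)
  ultimately have "((\<lambda>x. tension (x, t)) \<longlongrightarrow> ws (front t, t)) (at_right (front t))"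
    by (rule Lim_transform_eventually)
  then have "Lim (at_right (front t)) (\<lambda>x. tension (x, t)) = ws (front t, t)"
    by (intro tendsto_Lim) simp_all
  then show ?thesis
    using s by (simp add: p ext_trace_def right_trace_def tension_def del: dalembert_pair)
qed

lemma int_trace_tension:
  assumes "s \<le> front t"
  shows "int_trace front tension (s, t) = inner_tension t"
proof -
  have "\<forall>\<^sub>F x in at_left (front t). inner_tension t = tension (x, t)"
    unfolding eventually_at_filter by (auto simp: tension_def)
  then have "((\<lambda>x. tension (x, t)) \<longlongrightarrow> inner_tension t) (at_left (front t))"
    by (rule Lim_transform_eventually[OF tendsto_const])
  then have "Lim (at_left (front t)) (\<lambda>x. tension (x, t)) = inner_tension t"
    by (intro tendsto_Lim) simp_all
  then show ?thesis
    using assms by (simp add: int_trace_def left_trace_def tension_def)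
qed

lemma ws_at_infinity:
  assumes "0 \<le> t"
  shows "((\<lambda>s. ws (s, t)) \<longlongrightarrow> \<zeta> * t + \<tau>) at_top"
proof -
  have "((\<lambda>s. (s - t) powr (-(r + 1))) \<longlongrightarrow> 0) at_top"
  proof (rule tendsto_neg_powr)
    show "filterlim (\<lambda>s. s - t) at_top at_top"
      unfolding filterlim_at_top
      by (metis (no_types, lifting) eventually_at_top_linorder le_diff_eq)
  qed (use r in simp)
  then have "((\<lambda>s. 2 * B * (s - t) powr (-(r + 1))) \<longlongrightarrow> 2 * B * 0) at_top"
    by (rule tendsto_mult_left)
  then have lim: "((\<lambda>s. 2 * B * (s - t) powr (-(r + 1))) \<longlongrightarrow> 0) at_top"
    by simp
  have "((\<lambda>s. ws (s, t) - (\<zeta> * t + \<tau>)) \<longlongrightarrow> 0) at_top"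
  proof (rule Lim_null_comparison[OF _ lim])
    show "\<forall>\<^sub>F s in at_top. norm (ws (s, t) - (\<zeta> * t + \<tau>)) \<le> 2 * B * (s - t) powr (-(r + 1))"
      unfolding eventually_at_top_linorder
    proof (intro exI allI impI)
      fix s assume "\<sigma>0 + t \<le> s"
      then show "norm (ws (s, t) - (\<zeta> * t + \<tau>)) \<le> 2 * B * (s - t) powr (-(r + 1))"
        unfolding real_norm_def by (intro near_stretched_initial(1)) (use assms in auto)
    qed
  qed
  then show ?thesis
    by (simp add: LIM_zero_iff del: dalembert_pair)
qed

lemma front_conditions_solution:
  assumes T': "0 < T'" "T' < T"
    and front0: "initial_shock_front N1 \<eta> \<tau> \<zeta> chi0 chi1 N0 = \<sigma>0"
    and data: "\<And>s. \<sigma>0 \<le> s \<Longrightarrow> chi0 s = P s + Q s" "\<And>s. \<sigma>0 \<le> s \<Longrightarrow> right_trace \<sigma>0 chi1 s = P1 s - Q1 s"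
  shows "front_conditions N1 \<eta> \<tau> \<zeta> chi0 chi1 N0 T' position tension front"
proof -
  let ?J = "{0..T'}"
  let ?E = "ext_region front ?J"
  have J: "time_window ?J" using T' by (auto simp: time_window_def)
  note pos = position_partials[OF J] and NE = ext_trace_tension[OF J]
  have onfront: "(front t, t) \<in> ?E" if "t \<in> ?J" for t
    using that by (auto simp: ext_region_def)
  have "C1_region ?E (ext_trace front tension)"
  proof -
    have "C1_region ?E (pd_s ?E position)"
      using pos(1) by (simp add: C2_region_def)
    then show ?thesis
      using C1_region_cong[of ?E "pd_s ?E position" "ext_trace front tension"] pos(2) NE by force
  qed
  moreover have "\<forall>p\<in>?E. ext_trace front tension p = pd_s ?E position p \<and> \<eta> < ext_trace front tension p
      \<and> ext_trace front tension p < N1"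
  proof
    fix p assume p: "p \<in> ?E"
    obtain s t where st: "p = (s, t)" by (cases p)
    show "ext_trace front tension p = pd_s ?E position p \<and> \<eta> < ext_trace front tension p
      \<and> ext_trace front tension p < N1"
      using pos(2)[OF p] NE[OF p] tension_bounds(1,2)[of t s] ahead_of_front[OF J] p unfolding st by auto
  qed
  moreover have "\<forall>t\<in>?J. deriv_on ?J front t = pd_t ?E position (front t, t) / (N1 - ext_trace front tension (front t, t))
      \<and> deriv_on ?J front t > 1"
    using front_deriv_window(2)[OF J] pos(3)[OF onfront] NE[OF onfront] speed_gt_1 T'
    by (auto simp: speed_def)
  moreover have "\<forall>(s, t)\<in>int_region front ?J. position (s, t) = N1 * s
      \<and> int_trace front tension (s, t) = ext_trace front tension (front t, t)
        + (deriv_on ?J front t)\<^sup>2 * (N1 - ext_trace front tension (front t, t))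
      \<and> int_trace front tension (s, t) > N1"
  proof clarify
    fix s t assume "(s, t) \<in> int_region front ?J"
    then have t: "t \<in> ?J" and s: "s \<le> front t" by (auto simp: int_region_def)
    have "1 < (speed t)\<^sup>2"
      using speed_gt_1[of t] T' t by (auto intro: one_less_power)
    moreover have pos: "0 < N1 - ws (front t, t)"
      using tension_bounds(2)[of t "front t"] front[of t] T' t by auto
    \<comment> \<open>This is \<open>N1 < inner_tension t\<close>: with speed 1 in place of
      \<open>speed t\<close> the formula for the inner tension would give exactly
      \<open>N1\<close>.\<close>
    ultimately have "1 * (N1 - ws (front t, t)) < (speed t)\<^sup>2 * (N1 - ws (front t, t))"
      by (intro mult_strict_right_mono)
    then show "position (s, t) = N1 * s
      \<and> int_trace front tension (s, t) = ext_trace front tension (front t, t)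
        + (deriv_on ?J front t)\<^sup>2 * (N1 - ext_trace front tension (front t, t))
      \<and> int_trace front tension (s, t) > N1"
      using s int_trace_tension[OF s] NE[OF onfront[OF t]] front_deriv_window(2)[OF J t]
      by (simp add: inner_tension_def position_def del: dalembert_pair)
  qed
  moreover have "\<forall>t\<in>?J. ((\<lambda>s. pd_s ?E position (s, t)) \<longlongrightarrow> \<zeta> * t + \<tau>) at_top"
  proof (rule ballI, rule Lim_transform_eventually)
    fix t assume that: "t \<in> ?J"
    show "((\<lambda>s. ws (s, t)) \<longlongrightarrow> \<zeta> * t + \<tau>) at_top"
      using ws_at_infinity[of t] that by simp
    show "\<forall>\<^sub>F s in at_top. ws (s, t) = pd_s ?E position (s, t)"
      unfolding eventually_at_top_linorder
      by (intro exI[of _ "front t"]) (use pos(2) that in \<open>auto simp: ext_region_def\<close>)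
  qed
  moreover have "\<forall>s\<ge>\<sigma>0. position (s, 0) = chi0 s \<and> pd_t ?E position (s, 0) = right_trace \<sigma>0 chi1 s"
  proof (intro allI impI)
    fix s assume that: "\<sigma>0 \<le> s"
    have "(s, 0) \<in> ?E" using that T' by (auto simp: ext_region_def)
    then show "position (s, 0) = chi0 s \<and> pd_t ?E position (s, 0) = right_trace \<sigma>0 chi1 s"
      using pos(3) position_ahead[OF J] data[OF that] by simp
  qed
  moreover have "front ` ?J \<subseteq> {\<sigma>0..}"
    using front_ge_sigma0 T' by force
  moreover have "\<forall>t\<in>?J. position (front t, t) = N1 * front t"
    by (simp add: position_def)
  moreover have "\<forall>p\<in>?E. pd_t ?E (pd_t ?E position) p = pd_s ?E (pd_s ?E position) p"
    using pos(4,6) by simp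
  ultimately show ?thesis
    unfolding front_conditions_def Let_def front0
    using C2_on_front[OF J] pos(1) front_0 by (intro conjI)
qed

end

subsection \<open>Uniqueness and final time\<close>

context shock_data
begin

context
  fixes chi0 chi1 N0 :: "real \<Rightarrow> real"
  assumes front0: "initial_shock_front N1 \<eta> \<tau> \<zeta> chi0 chi1 N0 = \<sigma>0"
    and data: "\<And>s. \<sigma>0 \<le> s \<Longrightarrow> chi0 s = P s + Q s" "\<And>s. \<sigma>0 \<le> s \<Longrightarrow> right_trace \<sigma>0 chi1 s = P1 s - Q1 s"
begin

text \<open>A speed above 1 is part of being a solution, so \<open>wave_ahead_of_fast_front\<close>
  applies to every solution. Both fronts are therefore zeros of the same function
  \<open>w - N1 s\<close>, and it remains to see that the zeros coincide.\<close>

lemma other_front: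
  assumes fc: "front_conditions N1 \<eta> \<tau> \<zeta> chi0 chi1 N0 T' chi N \<sigma>" and T': "0 < T'" "T' < T"
    and t: "t \<in> {0..T'}"
  shows "\<sigma> t = front t"
    and "\<sigma> t \<le> s \<Longrightarrow> chi (s, t) = w (s, t)"
    and "\<sigma> t \<le> s \<Longrightarrow> ext_trace \<sigma> N (s, t) = ws (s, t)"
proof -
  define E where "E = ext_region \<sigma> {0..T'}"
  have c1: "C1_on {0..T'} \<sigma>" and speed1: "\<And>u. u \<in> {0..T'} \<Longrightarrow> 1 < deriv_on {0..T'} \<sigma> u"
    and s0: "\<sigma> 0 = \<sigma>0" and c2: "C2_region E chi"
    and N: "\<And>p. p \<in> E \<Longrightarrow> ext_trace \<sigma> N p = pd_s E chi p \<and> ext_trace \<sigma> N p < N1"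
    and onf: "\<And>u. u \<in> {0..T'} \<Longrightarrow> chi (\<sigma> u, u) = N1 * \<sigma> u"
    and wave: "\<And>p. p \<in> E \<Longrightarrow> pd_t E (pd_t E chi) p = pd_s E (pd_s E chi) p"
    and init: "\<And>s. s \<ge> \<sigma>0 \<Longrightarrow> chi (s, 0) = chi0 s \<and> pd_t E chi (s, 0) = right_trace \<sigma>0 chi1 s"
    using fc unfolding front_conditions_def Let_def front0 E_def C2_on_def by blast+
  note deriv = C1_on_imp_has_deriv[OF c1]
  have cont: "continuous_on {0..T'} \<sigma>"
    using deriv DERIV_continuous_on by blast
  have fast: "\<sigma> u - u < \<sigma> v - v" if uv: "0 \<le> u" "u < v" "v \<le> T'" for u v
  proof (rule DERIV_pos_imp_increasing_open[OF uv(2)])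
    fix x assume x: "u < x" "x < v"
    have "at x within {0..T'} = at x"
      using x uv by (intro at_within_interior) auto
    then have "((\<lambda>x. \<sigma> x - x) has_real_derivative deriv_on {0..T'} \<sigma> x - 1) (at x)"
      using deriv[of x] x uv by (intro DERIV_diff DERIV_ident) auto
    then show "\<exists>y. ((\<lambda>x. \<sigma> x - x) has_real_derivative y) (at x) \<and> 0 < y"
      using speed1[of x] x uv by (intro exI[of _ "deriv_on {0..T'} \<sigma> x - 1"]) auto
  next
    show "continuous_on {u..v} (\<lambda>x. \<sigma> x - x)"
      by (intro continuous_intros continuous_on_subset[OF cont]) (use uv in auto)
  qed
  have E: "(x, u) \<in> E \<longleftrightarrow> u \<in> {0..T'} \<and> \<sigma> u \<le> x" for x u
    by (auto simp: E_def ext_region_def)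
  have sol: "chi (x, u) = w (x, u)" "pd_s E chi (x, u) = ws (x, u)" if "(x, u) \<in> E" for x u
    using wave_ahead_of_fast_front[OF cont fast, of chi P Q P1 Q1 x u] c2 wave init s0 data P(1) Q(1) that
    unfolding E_def by auto
  show "chi (s, t) = w (s, t)" "ext_trace \<sigma> N (s, t) = ws (s, t)" if "\<sigma> t \<le> s"
    using sol[of s t] N[of "(s, t)"] E t that by auto
  have "w (\<sigma> t, t) = N1 * \<sigma> t"
    using sol(1)[of "\<sigma> t" t] onf t E by simp
  moreover have t': "0 \<le> t" "t < T" using t T' by auto
  note fr = front[OF t']
  have "\<not> front t < \<sigma> t" if "w (\<sigma> t, t) = N1 * \<sigma> t"
    using w_strict[OF t' fr(1), of "\<sigma> t"] fr(2) that by auto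
  moreover have "\<not> \<sigma> t < front t" if "w (\<sigma> t, t) = N1 * \<sigma> t"
  proof
    assume less: "\<sigma> t < front t"
    have "w (front t, t) - N1 * front t < w (\<sigma> t, t) - N1 * \<sigma> t"
    proof (rule DERIV_neg_imp_decreasing[OF less])
      fix x assume x: "\<sigma> t \<le> x"
      then have "ws (x, t) - N1 < 0"
        using sol(2)[of x t] N[of "(x, t)"] E t by auto
      moreover have "((\<lambda>x. w (x, t) - N1 * x) has_real_derivative ws (x, t) - N1) (at x)"
        by (rule derivative_eq_intros w_s refl | simp)+
      ultimately show "\<exists>y. ((\<lambda>x. w (x, t) - N1 * x) has_real_derivative y) (at x) \<and> y < 0"
        by blast
    qed
    then show False
      using fr(2) that by simp
  qed
  ultimately show "\<sigma> t = front t"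
    by (meson linorder_neqE_linordered_idom)
qed

lemma other_solution:
  assumes fc: "front_conditions N1 \<eta> \<tau> \<zeta> chi0 chi1 N0 T' chi N \<sigma>" and T': "0 < T'" "T' < T"
    and t: "t \<in> {0..T'}" and s: "0 \<le> s"
  shows "chi (s, t) = position (s, t)" "s \<noteq> front t \<Longrightarrow> N (s, t) = tension (s, t)"
proof -
  note other = other_front[OF fc T']
  have eq: "\<sigma> u = front u" if "u \<in> {0..T'}" for u
    using other(1)[OF that] .
  have J: "time_window {0..T'}" using T' by (auto simp: time_window_def)
  have inner: "chi (x, t) = N1 * x \<and>
      int_trace \<sigma> N (x, t) = ext_trace \<sigma> N (\<sigma> t, t) + (deriv_on {0..T'} \<sigma> t)\<^sup>2 * (N1 - ext_trace \<sigma> N (\<sigma> t, t))"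
    if "0 \<le> x" "x \<le> \<sigma> t" for x
    using fc t that unfolding front_conditions_def Let_def int_region_def by fast
  have "deriv_on {0..T'} \<sigma> t = speed t"
    using deriv_on_cong[of t "{0..T'}" \<sigma> front] eq t front_deriv_window(2)[OF J t] by simp
  note inner = inner[unfolded this]
  show "chi (s, t) = position (s, t)"
    using inner[of s] other(2)[OF t, of s] s eq[OF t] by (cases "s \<le> front t") (auto simp: position_def)
  show "N (s, t) = tension (s, t)" if ne: "s \<noteq> front t"
  proof (cases "s < front t")
    case True
    then have "N (s, t) = int_trace \<sigma> N (s, t)"
      using eq[OF t] by (simp add: int_trace_def left_trace_def)
    also have "\<dots> = inner_tension t"
      using inner[of s] s True eq[OF t] other(3)[OF t, of "\<sigma> t"] by (simp add: inner_tension_def del: dalembert_pair)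
    finally show ?thesis
      using True by (simp add: tension_def)
  next
    case False
    then have "N (s, t) = ext_trace \<sigma> N (s, t)"
      using eq[OF t] ne by (simp add: ext_trace_def right_trace_def)
    then show ?thesis
      using other(3)[OF t, of s] False eq[OF t] by (simp add: tension_def del: dalembert_pair)
  qed
qed

text \<open>The strict bound by \<open>N1\<close> passes to the limit at spatial infinity only as a
  weak one, which still excludes every \<open>T' > T\<close> because
  \<open>\<zeta> > 0\<close>.\<close>

lemma no_solution_after:
  assumes fc: "front_conditions N1 \<eta> \<tau> \<zeta> chi0 chi1 N0 T' chi N \<sigma>"
  shows "T' \<le> T"
proof (rule ccontr)
  assume "\<not> T' \<le> T"
  then have T': "T < T'" by simp
  define E where "E = ext_region \<sigma> {0..T'}"
  have N: "\<And>p. p \<in> E \<Longrightarrow> pd_s E chi p < N1"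
    and lim: "((\<lambda>s. pd_s E chi (s, T')) \<longlongrightarrow> \<zeta> * T' + \<tau>) at_top"
    using fc T T' unfolding front_conditions_def Let_def E_def by auto
  have "\<forall>\<^sub>F s in at_top. pd_s E chi (s, T') \<le> N1"
    unfolding eventually_at_top_linorder
  proof (intro exI allI impI)
    fix s assume "\<sigma> T' \<le> s"
    then show "pd_s E chi (s, T') \<le> N1"
      using N[of "(s, T')"] T T' by (auto simp: E_def ext_region_def)
  qed
  then have "\<zeta> * T' + \<tau> \<le> N1"
    by (intro tendsto_upperbound[OF lim]) auto
  then show False
    using T' zeta by (simp add: N1)
qed

text \<open>The definition of a solution asks for a unique front, so existence already draws on the
  uniqueness argument: \<open>other_front\<close> is applied to \<open>position\<close> and
  \<open>tension\<close> themselves.\<close>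

lemma classical_solution:
  assumes T': "0 < T'" "T' < T"
  shows "classical_shock_solution N1 \<eta> \<tau> \<zeta> chi0 chi1 N0 T' position tension"
proof -
  let ?S = "{0..} \<times> {0..T'} :: (real \<times> real) set"
  have J: "time_window {0..T'}" using T' by (auto simp: time_window_def)
  have S: "?S \<in> sets lebesgue"
    by (intro closed_in_sets_lebesgue closed_Times) auto
  have cf': "continuous_on {0..T'} front"
    by (rule continuous_on_subset[OF continuous_on_front]) (use T' in auto)
  have cf: "continuous_on ?S (\<lambda>p. front (snd p))"
    by (rule continuous_on_compose2[OF cf']) (auto intro!: continuous_intros)
  have "continuous_on UNIV P" "continuous_on UNIV Q"
    using P(1) Q(1) DERIV_continuous_on has_field_derivative_at_within by metis+
  then have cw: "continuous_on X w" for X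
    by (rule continuous_on_dalembert)
  have cws: "continuous_on X ws" and cwt: "continuous_on X wt" for X
    by (intro continuous_on_dalembert continuous_on_minus cont1)+
  have "continuous_on ?S (\<lambda>p. if fst p - front (snd p) \<le> 0 then N1 * fst p else w p)"
  proof (rule continuous_on_cases_le)
    fix p assume p: "p \<in> ?S" "fst p - front (snd p) = 0"
    then show "N1 * fst p = w p"
      using front(2)[of "snd p"] T' by (cases p) auto
  qed (intro continuous_intros cf cw)+
  then have "continuous_on ?S position"
    by (simp add: position_def[abs_def])
  moreover have "Linf_on ?S tension"
  proof -
    have cfront: "continuous_on {0..T'} (\<lambda>t. ws (front t, t))"
      by (rule continuous_on_compose2[OF cws[of UNIV]]) (auto intro!: continuous_intros cf')
    have "C1_on {0..T'} (deriv_on {0..T'} front)"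
      using C2_on_front[OF J] by (simp add: C2_on_def)
    then have "continuous_on {0..T'} (deriv_on {0..T'} front)"
      by (auto simp: C1_on_def intro: differentiable_imp_continuous_on)
    then have "continuous_on {0..T'} speed"
      using continuous_on_cong[of "{0..T'}" "{0..T'}" "deriv_on {0..T'} front" speed]
        front_deriv_window(2)[OF J] by simp
    then have ci: "continuous_on {0..T'} inner_tension"
      unfolding inner_tension_def[abs_def] by (intro continuous_intros cfront)
    have "bounded (inner_tension ` {0..T'})"
      by (intro compact_imp_bounded compact_continuous_image ci compact_Icc)
    then obtain K where "\<forall>x\<in>inner_tension ` {0..T'}. norm x \<le> K"
      unfolding bounded_iff by blast
    then have K: "\<bar>inner_tension t\<bar> \<le> K" if "t \<in> {0..T'}" for t
      using that by simp
    show ?thesis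
    proof (rule Linf_on_piecewise[OF S negligible_empty, where h = "\<lambda>p. front (snd p) - fst p"
          and ?f1.0 = ws and ?f2.0 = "\<lambda>p. inner_tension (snd p)" and K = "max N1 K"])
      show "continuous_on ?S (\<lambda>p. inner_tension (snd p))"
        by (rule continuous_on_compose2[OF ci]) (auto intro!: continuous_intros)
      fix p assume p: "p \<in> ?S - {}"
      then obtain s t where st: "p = (s, t)" "t \<in> {0..T'}" by auto
      show "tension p = (if front (snd p) - fst p \<le> 0 then ws p else inner_tension (snd p))"
        by (simp add: tension_def)
      show "\<bar>tension p\<bar> \<le> max N1 K"
        using K[OF st(2)] tension_bounds(1,2)[of t s] front(1)[of t] T' st eta
        by (auto simp: tension_def simp del: dalembert_pair)
    qed (intro continuous_intros cf cws)+
  qed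
  moreover have "Linf_loc_on ?S (\<lambda>(s, t). deriv_on {0..T'} (\<lambda>t'. position (s, t')) t)"
    unfolding Linf_loc_on_def
  proof (intro allI impI, elim conjE)
    fix X :: "(real \<times> real) set" assume X: "compact X" "X \<subseteq> ?S"
    define Z where "Z = (\<lambda>t. (front t, t)) ` {0..T'}"
    have Z: "negligible Z"
      unfolding Z_def using C2_on_front[OF J] by (intro negligible_graph) (simp add: C2_on_def C1_on_def)
    have "bounded (wt ` X)"
      by (intro compact_imp_bounded compact_continuous_image cwt X(1))
    then obtain K where "\<forall>x\<in>wt ` X. norm x \<le> K"
      unfolding bounded_iff by blast
    then have K: "\<bar>wt p\<bar> \<le> K" if "p \<in> X" for p
      using that by simp
    have val: "deriv_on {0..T'} (\<lambda>t'. position (s, t')) t = (if s - front t \<le> 0 then 0 else wt (s, t))"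
      if st: "(s, t) \<in> X - Z" for s t
    proof -
      have t: "t \<in> {0..T'}" and ne: "s \<noteq> front t"
        using st X(2) by (auto simp: Z_def)
      \<comment> \<open>By continuity the front stays on one side of \<open>s\<close> for times near
        \<open>t\<close>, so \<open>position\<close> is given there by a single formula.\<close>
      then obtain d where d: "d > 0" "\<And>u. u \<in> {0..T'} \<Longrightarrow> dist u t < d \<Longrightarrow> dist (front u) (front t) < \<bar>s - front t\<bar>"
        using cf' unfolding continuous_on_iff by (metis zero_less_abs_iff right_minus_eq)
      note tr = has_field_derivative_transform_within[OF _ d(1) t]
      show ?thesis
      proof (cases "s < front t")
        case True
        have "((\<lambda>t'. position (s, t')) has_real_derivative 0) (at t within {0..T'})"
        proof (rule tr)
          show "((\<lambda>t'. N1 * s) has_real_derivative 0) (at t within {0..T'})" by simp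
          fix u assume "u \<in> {0..T'}" "dist u t < d"
          then show "N1 * s = position (s, u)"
            using d(2)[of u] True by (auto simp: position_def dist_real_def)
        qed
        then show ?thesis
          using True deriv_on_eqI time_window_nontrivial[OF J t] by auto
      next
        case False
        have "((\<lambda>t'. position (s, t')) has_real_derivative wt (s, t)) (at t within {0..T'})"
        proof (rule tr)
          show "((\<lambda>t'. w (s, t')) has_real_derivative wt (s, t)) (at t within {0..T'})"
            by (rule has_field_derivative_at_within[OF w_t])
          fix u assume "u \<in> {0..T'}" "dist u t < d"
          then show "w (s, u) = position (s, u)"
            using d(2)[of u] False ne by (auto simp: position_def dist_real_def)
        qed
        then show ?thesis
          using False ne deriv_on_eqI time_window_nontrivial[OF J t] by auto
      qed
    qed
    show "Linf_on X (\<lambda>(s, t). deriv_on {0..T'} (\<lambda>t'. position (s, t')) t)"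
    proof (rule Linf_on_piecewise[OF _ Z, where h = "\<lambda>p. fst p - front (snd p)"
          and ?f1.0 = "\<lambda>p. 0" and ?f2.0 = wt and K = "max 0 K"])
      show "X \<in> sets lebesgue"
        by (intro closed_in_sets_lebesgue compact_imp_closed X)
      fix p assume p: "p \<in> X - Z"
      obtain s t where st: "p = (s, t)" by (cases p)
      show "(case p of (s, t) \<Rightarrow> deriv_on {0..T'} (\<lambda>t'. position (s, t')) t)
          = (if fst p - front (snd p) \<le> 0 then 0 else wt p)"
        using val[of s t] p st by simp
      show "\<bar>case p of (s, t) \<Rightarrow> deriv_on {0..T'} (\<lambda>t'. position (s, t')) t\<bar> \<le> max 0 K"
        using val[of s t] p st K[of p] by (auto simp: le_max_iff_disj simp del: dalembert_pair)
    qed (intro continuous_intros continuous_on_subset[OF cf X(2)] cwt)+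
  qed
  ultimately show ?thesis
    unfolding classical_shock_solution_def
    using front_conditions_solution[OF T' front0 data] other_front(1)[OF _ T'] by blast
qed

lemma shock_solution_up_to_T: "shock_solution_before N1 \<eta> \<tau> \<zeta> chi0 chi1 N0 (ereal T) position tension"
  unfolding shock_solution_before_def using classical_solution T by auto

lemma solution_before_le:
  assumes "shock_solution_before N1 \<eta> \<tau> \<zeta> chi0 chi1 N0 T1 chi N"
  shows "T1 \<le> ereal T"
proof (rule ccontr)
  assume "\<not> T1 \<le> ereal T"
  then obtain T' where "T < T'" "ereal T' < T1"
    using ereal_dense2[of "ereal T" T1] by (auto simp: not_le)
  then have "classical_shock_solution N1 \<eta> \<tau> \<zeta> chi0 chi1 N0 T' chi N"
    using assms T unfolding shock_solution_before_def by auto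
  then show False
    using no_solution_after \<open>T < T'\<close> unfolding classical_shock_solution_def by (meson not_le)
qed

lemma final_time_eq: "final_time N1 \<eta> \<tau> \<zeta> chi0 chi1 N0 = ereal T"
  unfolding final_time_def
  by (rule antisym) (use shock_solution_up_to_T solution_before_le in \<open>auto intro!: Sup_least Sup_upper\<close>)

lemma unique_solution:
  "unique_shock_solution N1 \<eta> \<tau> \<zeta> chi0 chi1 N0 position tension front"
  unfolding unique_shock_solution_def final_time_eq
proof (intro conjI allI impI; (elim conjE)?)
  show "shock_solution_before N1 \<eta> \<tau> \<zeta> chi0 chi1 N0 (ereal T) position tension"
    by (rule shock_solution_up_to_T)
  show "shock_front_before N1 \<eta> \<tau> \<zeta> chi0 chi1 N0 (ereal T) position tension front"
    unfolding shock_front_before_def using front_conditions_solution[OF _ _ front0 data] by simp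
  fix T1 chi N and s t :: real
  assume sol: "shock_solution_before N1 \<eta> \<tau> \<zeta> chi0 chi1 N0 T1 chi N"
    and st: "0 \<le> s" "0 \<le> t" "ereal t < T1"
  obtain T' where T': "t < T'" "ereal T' < T1"
    using ereal_dense2[OF st(3)] by auto
  then have "ereal T' < ereal T"
    using solution_before_le[OF sol] order_less_le_trans by blast
  then have T'': "0 < T'" "T' < T" using T' st by auto
  then obtain \<sigma> where fc: "front_conditions N1 \<eta> \<tau> \<zeta> chi0 chi1 N0 T' chi N \<sigma>"
    using sol T' unfolding shock_solution_before_def classical_shock_solution_def by blast
  show "chi (s, t) = position (s, t)" "s \<noteq> front t \<Longrightarrow> N (s, t) = tension (s, t)"
    using other_solution[OF fc T'', of t s] st T' by auto
qed

end

end

subsection \<open>Estimates\<close>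

text \<open>Since \<open>q\<close> is at least 1/2, division by it costs a factor 2. The numerators
  are at most \<open>2 * y\<close> and \<open>(5 / 2 + 1) * y\<close>, where 5/2 bounds
  \<open>\<bar>p + 1\<bar>\<close>.\<close>

lemma quotient_near_1:
  fixes p q y :: real
  assumes "\<bar>p - 1\<bar> \<le> y" "\<bar>q - 1\<bar> \<le> y" "y \<le> 1 / 2"
  shows "\<bar>p / q - 1\<bar> \<le> 4 * y" "\<bar>p\<^sup>2 / q - 1\<bar> \<le> 7 * y"
proof -
  have q: "1 / 2 \<le> q" and y: "0 \<le> y" using assms by auto
  have *: "\<bar>a / q - 1\<bar> \<le> 2 * b" if "\<bar>a - q\<bar> \<le> b" for a b
  proof -
    have "\<bar>a / q - 1\<bar> = \<bar>a - q\<bar> / q"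
      using q by (simp add: diff_divide_distrib[symmetric] abs_divide field_simps)
    also have "\<dots> \<le> b / (1 / 2)"
      using that q by (intro frac_le) auto
    finally show ?thesis by simp
  qed
  show "\<bar>p / q - 1\<bar> \<le> 4 * y"
    using *[of p "2 * y"] assms by simp
  have "\<bar>p\<^sup>2 - 1\<bar> = \<bar>p - 1\<bar> * \<bar>p + 1\<bar>"
    by (simp add: abs_mult[symmetric] power2_eq_square algebra_simps)
  also have "\<dots> \<le> y * (5 / 2)"
    using assms by (intro mult_mono) auto
  finally have "\<bar>p\<^sup>2 - q\<bar> \<le> y * (5 / 2) + y"
    using assms(2) by linarith
  then show "\<bar>p\<^sup>2 / q - 1\<bar> \<le> 7 * y"
    using *[of "p\<^sup>2" "y * (5 / 2) + y"] by simp
qed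

section \<open>Choice of the constants, and d'Alembert profiles of the initial data\<close>

context shock_constants
begin

text \<open>The summands serve, in this order, the second derivatives, the first derivatives, speed
  and inner tension together (22 = 8 + 14), the additive part of the inner tension, and the
  deviation of \<open>\<sigma>1inf\<close> from \<open>\<sigma>1\<close>.\<close>

definition estimate_const :: real where
  "estimate_const = 4 * (1 + T / \<sigma>0) powr (r + 2) + 4 * decay_const + 22 * decay_const / \<zeta>
    + 2 * decay_const * T / \<tau> + 1 / (\<sigma>1 * \<zeta> * T)"

lemma estimate_const:
  "0 < estimate_const" "4 * (1 + T / \<sigma>0) powr (r + 2) \<le> estimate_const"
  "4 * decay_const \<le> estimate_const" "8 * decay_const / \<zeta> \<le> estimate_const"
  "2 * decay_const * T / \<tau> + 14 * decay_const / \<zeta> \<le> estimate_const"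
  "1 / (\<sigma>1 * \<zeta> * T) \<le> estimate_const"
proof -
  have pos: "0 \<le> (1 + T / \<sigma>0) powr (r + 2)" "0 < decay_const" "0 < decay_const / \<zeta>"
    "0 < 2 * decay_const * T / \<tau>" "0 < 1 / (\<sigma>1 * \<zeta> * T)"
    using decay_const_pos zeta T eta sigma1 by auto
  have *: "8 * decay_const / \<zeta> = 8 * (decay_const / \<zeta>)" "14 * decay_const / \<zeta> = 14 * (decay_const / \<zeta>)"
    "22 * decay_const / \<zeta> = 22 * (decay_const / \<zeta>)" by auto
  show "0 < estimate_const" "4 * (1 + T / \<sigma>0) powr (r + 2) \<le> estimate_const"
    "4 * decay_const \<le> estimate_const" "8 * decay_const / \<zeta> \<le> estimate_const"
    "2 * decay_const * T / \<tau> + 14 * decay_const / \<zeta> \<le> estimate_const"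
    "1 / (\<sigma>1 * \<zeta> * T) \<le> estimate_const"
    using pos unfolding estimate_const_def * by linarith+
qed

text \<open>In this order the conditions preserve half of the distance from the tension to
  \<open>N1\<close>, keep the tension above \<open>\<eta>\<close>, make the front faster than the
  waves, and put it ahead of the barrier. The last one involves \<open>c\<close>, which depends on
  the data and is only known to lie within \<open>B\<close> of
  \<open>\<sigma>1 * \<zeta> * T\<close>; hence the quantifier.\<close>

lemma small_deviation:
  obtains e where "0 < e"
    and "\<And>B. 0 \<le> B \<Longrightarrow> B < e \<Longrightarrow> 2 * decay_const * B * T powr r \<le> \<zeta> / 2
      \<and> 2 * decay_const * B * T powr (r + 1) < \<tau> - \<eta>
      \<and> 4 * decay_const * B * T powr (r + 1) < \<zeta> * T * (lam - 1)
      \<and> (\<forall>c. \<bar>c - \<sigma>1 * \<zeta> * T\<bar> \<le> B \<longrightarrow> barrier_const * B < c - lam * \<zeta> * T)"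
proof -
  have small: "k * B < d" if "0 \<le> B" "B < d / (k + 1)" "0 \<le> k" for k d B :: real
  proof -
    have "B * (k + 1) < d" using that by (simp add: pos_less_divide_eq)
    then show ?thesis using that by (simp add: algebra_simps)
  qed
  define e where "e = Min {\<zeta> / 2 / (2 * decay_const * T powr r + 1),
      (\<tau> - \<eta>) / (2 * decay_const * T powr (r + 1) + 1),
      (\<zeta> * T * (lam - 1)) / (4 * decay_const * T powr (r + 1) + 1),
      ((\<sigma>1 - lam) * \<zeta> * T) / (barrier_const + 1 + 1)}"
  have k: "0 \<le> 2 * decay_const * T powr r" "0 \<le> 2 * decay_const * T powr (r + 1)"
    "0 \<le> 4 * decay_const * T powr (r + 1)" "0 \<le> barrier_const + 1"
    using decay_const_pos lam r T by (auto simp: barrier_const_def)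
  show ?thesis
  proof (rule that[of e])
    show "0 < e"
      using k zeta eta T lam unfolding e_def by (simp add: add_nonneg_pos)
    fix B assume B: "0 \<le> B" "B < e"
    then have "B < \<zeta> / 2 / (2 * decay_const * T powr r + 1)"
      "B < (\<tau> - \<eta>) / (2 * decay_const * T powr (r + 1) + 1)"
      "B < (\<zeta> * T * (lam - 1)) / (4 * decay_const * T powr (r + 1) + 1)"
      "B < ((\<sigma>1 - lam) * \<zeta> * T) / (barrier_const + 1 + 1)"
      by (auto simp: e_def)
    note * = this[THEN small[OF B(1)]]
    \<comment> \<open>For \<open>c = \<sigma>1 * \<zeta> * T\<close> the right-hand side is the full
      margin; the additional \<open>B\<close> on the left pays for the deviation of \<open>c\<close>
      from this value.\<close>
    have 4: "(barrier_const + 1) * B < (\<sigma>1 - lam) * \<zeta> * T"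
      by (rule *(4)[OF k(4)])
    have "barrier_const * B < c - lam * \<zeta> * T" if "\<bar>c - \<sigma>1 * \<zeta> * T\<bar> \<le> B" for c
      using 4 that by (simp add: algebra_simps abs_le_iff)
    then show "2 * decay_const * B * T powr r \<le> \<zeta> / 2
      \<and> 2 * decay_const * B * T powr (r + 1) < \<tau> - \<eta>
      \<and> 4 * decay_const * B * T powr (r + 1) < \<zeta> * T * (lam - 1)
      \<and> (\<forall>c. \<bar>c - \<sigma>1 * \<zeta> * T\<bar> \<le> B \<longrightarrow> barrier_const * B < c - lam * \<zeta> * T)"
      using *(1)[OF k(1)] *(2)[OF k(2)] *(3)[OF k(3)] by (simp add: mult_ac)
  qed
qed

text \<open>The bound \<open>B\<close> on the velocity itself does not decay. Integrating the
  weighted bound on its derivative yields a limit \<open>c\<close> of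
  \<open>f x - \<zeta> * (x - \<sigma>0)\<close> and a decaying deviation from it, while the
  unweighted bound survives in the limit and places \<open>c\<close> near
  \<open>\<sigma>1 * \<zeta> * T\<close>. For the strain the limit is \<open>\<tau>\<close> by the
  condition at infinity.\<close>

lemma shock_data_of_initial_data:
  assumes init: "initial_front_conditions N1 \<eta> \<tau> \<zeta> chi0 chi1 N0 \<sigma>0"
    and dev: "data_deviation N1 \<tau> \<zeta> \<sigma>0 \<sigma>1 r chi0 chi1 = ereal B"
    and small: "2 * decay_const * B * T powr r \<le> \<zeta> / 2" "2 * decay_const * B * T powr (r + 1) < \<tau> - \<eta>"
      "4 * decay_const * B * T powr (r + 1) < \<zeta> * T * (lam - 1)"
      "\<forall>c. \<bar>c - \<sigma>1 * \<zeta> * T\<bar> \<le> B \<longrightarrow> barrier_const * B < c - lam * \<zeta> * T"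
  obtains P P1 P2 Q Q1 Q2 c where "shock_data N1 \<eta> \<tau> \<zeta> \<sigma>0 \<sigma>1 r T P P1 P2 Q Q1 Q2 B c"
    "\<And>s. \<sigma>0 \<le> s \<Longrightarrow> chi0 s = P s + Q s" "\<And>s. \<sigma>0 \<le> s \<Longrightarrow> right_trace \<sigma>0 chi1 s = P1 s - Q1 s"
    "\<bar>c - \<sigma>1 * \<zeta> * T\<bar> \<le> B"
proof -
  let ?X = "{\<sigma>0..}" and ?v = "right_trace \<sigma>0 chi1"
  have c2: "C1_on ?X chi0" "C1_on ?X (deriv_on ?X chi0)" "C1_on ?X ?v"
    and lim: "(deriv_on ?X chi0 \<longlongrightarrow> \<tau>) at_top" and start: "chi0 \<sigma>0 = N1 * \<sigma>0"
    using init unfolding initial_front_conditions_def Let_def C2_on_def by auto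
  have bound: "\<bar>deriv_on ?X chi0 s - \<tau>\<bar> + s powr (r + 2) * \<bar>deriv_on ?X (deriv_on ?X chi0) s\<bar>
      + \<bar>?v s - (\<zeta> * (s - \<sigma>0) + \<sigma>1 * (N1 - \<tau>))\<bar> + s powr (r + 2) * \<bar>deriv_on ?X ?v s - \<zeta>\<bar> \<le> B"
    if "\<sigma>0 \<le> s" for s
    using dev that unfolding data_deviation_def Let_def
    by (metis (no_types, lifting) SUP_upper atLeast_iff ereal_less_eq(3))
  have nonneg: "0 \<le> s powr (r + 2) * \<bar>x\<bar>" for s x :: real by simp
  have B: "0 \<le> B"
    by (rule order_trans[OF _ bound[of \<sigma>0]]) auto
  have b2: "s powr (r + 2) * \<bar>deriv_on ?X (deriv_on ?X chi0) s\<bar> \<le> B"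
    and b3: "\<bar>?v s - (\<zeta> * (s - \<sigma>0) + \<sigma>1 * (N1 - \<tau>))\<bar> \<le> B"
    and b4: "s powr (r + 2) * \<bar>deriv_on ?X ?v s - \<zeta>\<bar> \<le> B" if "\<sigma>0 \<le> s" for s
    using bound[OF that] nonneg[of s "deriv_on ?X (deriv_on ?X chi0) s"] nonneg[of s "deriv_on ?X ?v s - \<zeta>"]
    by linarith+
  have decay: "\<bar>x\<bar> \<le> B * s powr (-(r + 2))" if "s powr (r + 2) * \<bar>x\<bar> \<le> B" "\<sigma>0 \<le> s" for s x
  proof -
    have "0 < s powr (r + 2)" using that sigma0 by simp
    then have "\<bar>x\<bar> \<le> B / s powr (r + 2)"
      using that(1) by (simp add: pos_le_divide_eq mult.commute)
    then show ?thesis by (simp only: powr_minus_divide) simp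
  qed
  obtain k k' where k: "\<And>x. (k has_real_derivative k' x) (at x)" "continuous_on UNIV k'"
    "\<And>x. \<sigma>0 \<le> x \<Longrightarrow> k x = deriv_on ?X chi0 x" "\<And>x. \<sigma>0 \<le> x \<Longrightarrow> k' x = deriv_on ?X (deriv_on ?X chi0) x"
    using C1_on_extension[OF c2(2)] by blast
  obtain f f' where f: "\<And>x. (f has_real_derivative f' x) (at x)" "continuous_on UNIV f'"
    "\<And>x. \<sigma>0 \<le> x \<Longrightarrow> f x = ?v x" "\<And>x. \<sigma>0 \<le> x \<Longrightarrow> f' x = deriv_on ?X ?v x"
    using C1_on_extension[OF c2(3)] by blast
  have "continuous_on UNIV k" "continuous_on UNIV f"
    using k(1) f(1) DERIV_continuous_on has_field_derivative_at_within by metis+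
  \<comment> \<open>The additive constant of \<open>G\<close> cancels in \<open>P + Q\<close>, so
    only \<open>F\<close> is normalised.\<close>
  then obtain F G where F: "\<And>x. (F has_real_derivative k x) (at x)" "F \<sigma>0 = chi0 \<sigma>0"
    and G: "\<And>x. (G has_real_derivative f x) (at x)"
    using continuous_antiderivative by metis
  have F_eq: "F x = chi0 x" if "\<sigma>0 \<le> x" for x
  proof (rule same_deriv_on_atLeast[where f = F and g = chi0 and f' = k and a = \<sigma>0 and x = x])
    show "(F has_real_derivative k x) (at x within ?X)" for x
      by (rule has_field_derivative_at_within[OF F(1)])
    show "(chi0 has_real_derivative k x) (at x within ?X)" if "\<sigma>0 \<le> x" for x
      using C1_on_imp_has_deriv[OF c2(1), of x] k(3) that by simp
  qed (use F(2) that in auto)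
  have r2: "-(r + 1 + 1) = -(r + 2)" by simp
  have "\<bar>k' x\<bar> \<le> B * x powr (-(r + 2))" if "\<sigma>0 \<le> x" for x
    using decay[OF b2] k(4) that by simp
  then obtain l where l: "(k \<longlongrightarrow> l) at_top" "\<And>x. \<sigma>0 \<le> x \<Longrightarrow> \<bar>k x - l\<bar> \<le> B / (r + 1) * x powr (-(r + 1))"
    using decay_limit[OF sigma0, of "r + 1" k k' B] k(1) r unfolding r2 by auto
  have "(k \<longlongrightarrow> \<tau>) at_top"
    by (rule Lim_transform_eventually[OF lim])
      (use k(3) in \<open>auto simp: eventually_at_top_linorder intro!: exI[of _ \<sigma>0]\<close>)
  then have "l = \<tau>"
    using l(1) tendsto_unique trivial_limit_at_top_linorder by blast
  have "\<bar>f' x - \<zeta>\<bar> \<le> B * x powr (-(r + 2))" if "\<sigma>0 \<le> x" for x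
    using decay[OF b4] f(4) that by simp
  moreover have "((\<lambda>x. f x - \<zeta> * (x - \<sigma>0)) has_real_derivative f' x - \<zeta>) (at x)" for x
    by (auto intro!: derivative_eq_intros f(1))
  ultimately obtain c where c: "((\<lambda>x. f x - \<zeta> * (x - \<sigma>0)) \<longlongrightarrow> c) at_top"
    "\<And>x. \<sigma>0 \<le> x \<Longrightarrow> \<bar>f x - \<zeta> * (x - \<sigma>0) - c\<bar> \<le> B / (r + 1) * x powr (-(r + 1))"
    using decay_limit[OF sigma0, of "r + 1" "\<lambda>x. f x - \<zeta> * (x - \<sigma>0)" "\<lambda>x. f' x - \<zeta>" B] r unfolding r2 by auto
  have c_near: "\<bar>c - \<sigma>1 * \<zeta> * T\<bar> \<le> B"
  proof (rule tendsto_upperbound)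
    show "((\<lambda>x. \<bar>f x - \<zeta> * (x - \<sigma>0) - \<sigma>1 * \<zeta> * T\<bar>) \<longlongrightarrow> \<bar>c - \<sigma>1 * \<zeta> * T\<bar>) at_top"
      by (intro tendsto_intros c(1))
    show "\<forall>\<^sub>F x in at_top. \<bar>f x - \<zeta> * (x - \<sigma>0) - \<sigma>1 * \<zeta> * T\<bar> \<le> B"
      unfolding eventually_at_top_linorder
      by (intro exI[of _ \<sigma>0]) (use b3 f(3) in \<open>auto simp: N1 algebra_simps\<close>)
  qed simp
  have br: "B / (r + 1) * x \<le> B * x" if "0 \<le> x" for x
    using B r that by (intro mult_right_mono) (auto simp: field_simps)
  have half: "\<bar>(u + v) / 2\<bar> \<le> R" "\<bar>(u - v) / 2\<bar> \<le> R" if "\<bar>u\<bar> \<le> R" "\<bar>v\<bar> \<le> R" for u v R :: real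
    using that by (auto simp: abs_le_iff)
  show ?thesis
  proof (rule that)
    show "shock_data N1 \<eta> \<tau> \<zeta> \<sigma>0 \<sigma>1 r T (\<lambda>x. (F x + G x) / 2) (\<lambda>x. (k x + f x) / 2) (\<lambda>x. (k' x + f' x) / 2)
      (\<lambda>x. (F x - G x) / 2) (\<lambda>x. (k x - f x) / 2) (\<lambda>x. (k' x - f' x) / 2) B c"
    proof unfold_locales
      fix x
      show "((\<lambda>x. (F x + G x) / 2) has_real_derivative (k x + f x) / 2) (at x)"
        "((\<lambda>x. (k x + f x) / 2) has_real_derivative (k' x + f' x) / 2) (at x)"
        "((\<lambda>x. (F x - G x) / 2) has_real_derivative (k x - f x) / 2) (at x)"
        "((\<lambda>x. (k x - f x) / 2) has_real_derivative (k' x - f' x) / 2) (at x)"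
        by (auto intro!: derivative_eq_intros F G k f)
      assume x: "\<sigma>0 \<le> x"
      define m where "m = \<zeta> * (x - \<sigma>0)"
      have a: "\<bar>k x - \<tau>\<bar> \<le> B * x powr (-(r + 1))"
        using l(2)[OF x] br[of "x powr (-(r + 1))"] \<open>l = \<tau>\<close> by simp
      have b: "\<bar>f x - \<zeta> * (x - \<sigma>0) - c\<bar> \<le> B * x powr (-(r + 1))"
        using c(2)[OF x] br[of "x powr (-(r + 1))"] by simp
      show "\<bar>(k x + f x) / 2 - (\<tau> + (\<zeta> * (x - \<sigma>0) + c)) / 2\<bar> \<le> B * x powr (-(r + 1))"
        "\<bar>(k x - f x) / 2 - (\<tau> - (\<zeta> * (x - \<sigma>0) + c)) / 2\<bar> \<le> B * x powr (-(r + 1))"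
        using half[OF a b] by (simp_all add: m_def field_simps)
      have a: "\<bar>k' x\<bar> \<le> B * x powr (-(r + 2))" and b: "\<bar>f' x - \<zeta>\<bar> \<le> B * x powr (-(r + 2))"
        using decay[OF b2] k(4) decay[OF b4] f(4) x by simp_all
      show "\<bar>(k' x + f' x) / 2 - \<zeta> / 2\<bar> \<le> B * x powr (-(r + 2))"
        "\<bar>(k' x - f' x) / 2 + \<zeta> / 2\<bar> \<le> B * x powr (-(r + 2))"
        using half[OF a b] by (simp_all add: field_simps)
    next
      show "continuous_on UNIV (\<lambda>x. (k' x + f' x) / 2)" "continuous_on UNIV (\<lambda>x. (k' x - f' x) / 2)"
        by (intro continuous_intros k(2) f(2); simp)+
      show "(F \<sigma>0 + G \<sigma>0) / 2 + (F \<sigma>0 - G \<sigma>0) / 2 = N1 * \<sigma>0"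
        using F(2) start by (simp add: field_simps)
    qed (use B small c_near in auto)
    show "chi0 s = (F s + G s) / 2 + (F s - G s) / 2" if "\<sigma>0 \<le> s" for s
      using F_eq[OF that] by (simp add: field_simps)
    show "?v s = (k s + f s) / 2 - (k s - f s) / 2" if "\<sigma>0 \<le> s" for s
      using f(3)[OF that] by (simp add: field_simps)
  qed (rule c_near)
qed

end

section \<open>Deviation from the stretched motion ahead of, on and behind the front\<close>

context shock_data
begin

lemma c_bounds: "lam * \<zeta> * T < c" "\<zeta> * T < c"
proof -
  have "0 \<le> barrier_const * B"
    using B lam r T by (simp add: barrier_const_def)
  then show "lam * \<zeta> * T < c"
    using small(4) by linarith
  moreover have "1 * (\<zeta> * T) < lam * (\<zeta> * T)"
    using lam zeta T by (intro mult_strict_right_mono) auto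
  ultimately show "\<zeta> * T < c"
    by (simp add: mult.assoc)
qed

text \<open>The weight is in \<open>s\<close>, the decay in \<open>s - t\<close>. As
  \<open>s - t\<close> is at least \<open>\<sigma>0\<close> and \<open>t < T\<close>, their ratio is
  at most \<open>1 + T / \<sigma>0\<close>, and the two powers cancel up to a constant.\<close>

lemma second_derivative_estimate:
  assumes t: "0 \<le> t" "t < T" and s: "\<sigma>0 \<le> s - t"
  shows "s powr (r + 2) * (\<bar>dalembert P2 Q2 (s, t)\<bar> + \<bar>dalembert P2 (\<lambda>x. - Q2 x) (s, t) - \<zeta>\<bar>) \<le> estimate_const * B"
proof -
  have pos: "0 < s - t" "0 < s" using s sigma0 t by linarith+
  have "s powr (r + 2) * (s - t) powr (-(r + 2)) = (s / (s - t)) powr (r + 2)"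
    by (simp only: powr_divide powr_minus_divide times_divide_eq_right mult_1_right)
  also have "\<dots> \<le> (1 + T / \<sigma>0) powr (r + 2)"
  proof (rule powr_mono2)
    have "t / (s - t) \<le> T / \<sigma>0"
      using t s sigma0 by (intro frac_le) auto
    moreover have "s / (s - t) = 1 + t / (s - t)"
      using pos by (simp add: field_simps)
    ultimately show "s / (s - t) \<le> 1 + T / \<sigma>0" by simp
  qed (use pos r in auto)
  finally have le: "s powr (r + 2) * (s - t) powr (-(r + 2)) \<le> (1 + T / \<sigma>0) powr (r + 2)" .
  have "\<bar>dalembert P2 Q2 (s, t)\<bar> + \<bar>dalembert P2 (\<lambda>x. - Q2 x) (s, t) - \<zeta>\<bar> \<le> 4 * B * (s - t) powr (-(r + 2))"
    using near_stretched_initial(3,4)[OF s t(1)] by linarith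
  then have "s powr (r + 2) * (\<bar>dalembert P2 Q2 (s, t)\<bar> + \<bar>dalembert P2 (\<lambda>x. - Q2 x) (s, t) - \<zeta>\<bar>)
      \<le> s powr (r + 2) * (4 * B * (s - t) powr (-(r + 2)))"
    by (intro mult_left_mono) auto
  also have "\<dots> = 4 * (s powr (r + 2) * (s - t) powr (-(r + 2))) * B"
    by simp
  also have "\<dots> \<le> 4 * (1 + T / \<sigma>0) powr (r + 2) * B"
    using le B by (intro mult_right_mono) auto
  also have "\<dots> \<le> estimate_const * B"
    using estimate_const(2) B by (intro mult_right_mono)
  finally show ?thesis .
qed

lemma first_derivative_estimate:
  assumes "0 \<le> t" "t < T" "barrier t \<le> s"
  shows "\<bar>ws (s, t) - (\<zeta> * t + \<tau>)\<bar> + \<bar>wt (s, t) - (\<zeta> * (s - \<sigma>0) + c)\<bar> \<le> estimate_const * B * (T - t) powr (1 + r)"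
proof -
  have "\<bar>ws (s, t) - (\<zeta> * t + \<tau>)\<bar> + \<bar>wt (s, t) - (\<zeta> * (s - \<sigma>0) + c)\<bar> \<le> 4 * decay_const * (B * (T - t) powr (1 + r))"
    using near_stretched[OF assms] by (simp add: add.commute[of 1 r] del: dalembert_pair)
  also have "\<dots> \<le> estimate_const * (B * (T - t) powr (1 + r))"
    using estimate_const(3) B by (intro mult_right_mono) auto
  finally show ?thesis
    by (simp add: mult.assoc del: dalembert_pair)
qed

text \<open>Velocity and distance to \<open>N1\<close> are divided by their stretched values
  \<open>V\<close> and \<open>\<zeta> * (T - t)\<close>, which gives \<open>p\<close> and
  \<open>q\<close> within \<open>y\<close> of 1. The second division takes one power from the error,
  so \<open>y\<close> has order \<open>r\<close>; speed and tension are then governed by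
  \<open>p / q\<close> and \<open>p\<close> squared over \<open>q\<close>.\<close>

lemma
  assumes t: "0 \<le> t" "t < T"
  defines "n \<equiv> \<zeta> * t + \<tau>" and "V \<equiv> \<zeta> * (front t - \<sigma>0) + c"
  shows speed_estimate: "\<bar>speed t / (V / (N1 - n)) - 1\<bar> \<le> estimate_const * B * (T - t) powr r"
    and inner_tension_estimate:
      "\<bar>inner_tension t / (n + V\<^sup>2 / (N1 - n)) - 1\<bar> \<le> estimate_const * B * (T - t) powr r"
proof -
  define \<theta> where "\<theta> = T - t"
  have \<theta>: "0 < \<theta>" "\<theta> \<le> T" using t by (auto simp: \<theta>_def)
  have n: "N1 - n = \<zeta> * \<theta>" by (simp add: n_def N1 \<theta>_def algebra_simps)
  have "0 \<le> \<zeta> * (front t - \<sigma>0)"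
    using front_ge_sigma0[OF t] zeta t by simp
  then have V: "\<zeta> * T \<le> V"
    using c_bounds(2) by (simp add: V_def)
  have zT: "0 < \<zeta> * T" using zeta T by simp
  then have Vpos: "0 < V" using V by linarith
  define a where "a = ws (front t, t)"
  define b where "b = wt (front t, t)"
  define p where "p = b / V"
  define q where "q = (N1 - a) / (\<zeta> * \<theta>)"
  define y where "y = 2 * decay_const * B * \<theta> powr r / \<zeta>"
  note near = near_stretched[OF t front(1)[OF t], folded a_def b_def n_def V_def]
  have err: "err t = y * \<zeta> * \<theta>"
    using zeta \<theta> by (simp add: y_def \<theta>_def powr_add)
  have y: "0 \<le> y" using decay_const_pos B zeta by (simp add: y_def)
  have "y * \<zeta> * \<theta> \<le> \<zeta> / 2 * (T - t)"
    using err_bounds(2)[OF t] unfolding err .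
  then have "y * (\<zeta> * \<theta>) \<le> 1 / 2 * (\<zeta> * \<theta>)"
    unfolding \<theta>_def[symmetric] by simp
  then have y2: "y \<le> 1 / 2"
    using zeta \<theta> by (simp only: mult_le_cancel_right_pos mult_pos_pos)
  have na: "0 < N1 - a"
    using tension_bounds(2)[OF t front(1)[OF t]] by (simp add: a_def)
  have "\<bar>b - V\<bar> \<le> y * V"
  proof -
    have "\<bar>b - V\<bar> \<le> y * (\<zeta> * \<theta>)"
      using near(2) unfolding err by (simp add: mult.assoc)
    also have "\<dots> \<le> y * V"
      using y order_trans[OF mult_left_mono[OF \<theta>(2), of \<zeta>] V] zeta by (intro mult_left_mono) auto
    finally show ?thesis .
  qed
  then have "\<bar>b - V\<bar> / V \<le> y"
    using Vpos by (simp add: pos_divide_le_eq)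
  moreover have "p - 1 = (b - V) / V"
    using Vpos by (simp add: p_def diff_divide_distrib)
  ultimately have p: "\<bar>p - 1\<bar> \<le> y"
    using Vpos by simp
  have "q - 1 = (n - a) / (\<zeta> * \<theta>)"
    using n zeta \<theta> by (simp add: q_def divide_simps)
  then have q: "\<bar>q - 1\<bar> \<le> y"
    using near(1) zeta \<theta> unfolding err
    by (simp add: abs_divide abs_mult pos_divide_le_eq mult.assoc abs_minus_commute)
  have C: "y = 2 * decay_const / \<zeta> * (B * \<theta> powr r)"
    by (simp add: y_def)
  have Bt: "0 \<le> B * \<theta> powr r" using B by simp
  have "speed t / (V / (N1 - n)) = p / q"
    using Vpos zeta \<theta> na unfolding n by (simp add: speed_def a_def[symmetric] b_def[symmetric] p_def q_def del: dalembert_pair)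
  then have "\<bar>speed t / (V / (N1 - n)) - 1\<bar> \<le> 4 * y"
    using quotient_near_1(1)[OF p q y2] by simp
  also have "4 * y = 8 * decay_const / \<zeta> * (B * \<theta> powr r)"
    by (simp add: C)
  also have "\<dots> \<le> estimate_const * (B * \<theta> powr r)"
    using estimate_const(4) Bt by (rule mult_right_mono)
  finally show "\<bar>speed t / (V / (N1 - n)) - 1\<bar> \<le> estimate_const * B * (T - t) powr r"
    by (simp add: \<theta>_def mult.assoc)
  \<comment> \<open>Condition (5) gives the stretched state \<open>n\<close>, \<open>V\<close>
    exactly this tension. The summand \<open>n\<close> matters: for \<open>B = 0\<close> the inner
    tension equals \<open>D\<close>, and a comparison with the second summand alone would leave a
    nonzero deviation.\<close>
  define D where "D = n + V\<^sup>2 / (\<zeta> * \<theta>)"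
  have n_ge: "\<tau> \<le> n" using t zeta by (simp add: n_def)
  have W: "0 \<le> V\<^sup>2 / (\<zeta> * \<theta>)" using zeta \<theta> by simp
  have D: "\<tau> \<le> D" "V\<^sup>2 / (\<zeta> * \<theta>) \<le> D" "0 < D"
    using n_ge W eta by (auto simp: D_def)
  have "inner_tension t = a + b\<^sup>2 / (N1 - a)"
    using na by (simp add: inner_tension_def speed_def a_def[symmetric] b_def[symmetric] power2_eq_square del: dalembert_pair)
  also have "b\<^sup>2 / (N1 - a) = V\<^sup>2 / (\<zeta> * \<theta>) * (p\<^sup>2 / q)"
    using Vpos zeta \<theta> na by (simp add: p_def q_def power2_eq_square)
  finally have in_eq: "inner_tension t = a + V\<^sup>2 / (\<zeta> * \<theta>) * (p\<^sup>2 / q)" .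
  have "a + W * z - (n + W) = (a - n) + W * (z - 1)" for W z
    by (simp add: algebra_simps)
  then have "inner_tension t - D = (a - n) + V\<^sup>2 / (\<zeta> * \<theta>) * (p\<^sup>2 / q - 1)"
    by (simp only: D_def in_eq)
  also have "\<bar>\<dots>\<bar> \<le> \<bar>a - n\<bar> + V\<^sup>2 / (\<zeta> * \<theta>) * \<bar>p\<^sup>2 / q - 1\<bar>"
    using abs_triangle_ineq[of "a - n" "V\<^sup>2 / (\<zeta> * \<theta>) * (p\<^sup>2 / q - 1)"] W by (simp only: abs_mult abs_of_nonneg)
  also have "\<dots> \<le> y * \<zeta> * \<theta> / \<tau> * D + D * (7 * y)"
  \<comment> \<open>The two lower bounds for \<open>D\<close> make both errors relative to it:
    \<open>\<tau> \<le> D\<close> the additive error of the tension ahead of the front, the other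
    bound the error in the quotient.\<close>
  proof (rule add_mono)
    have "y * \<zeta> * \<theta> * \<tau> \<le> y * \<zeta> * \<theta> * D"
      using D(1) y zeta \<theta> by (intro mult_left_mono) auto
    then have "y * \<zeta> * \<theta> \<le> y * \<zeta> * \<theta> / \<tau> * D"
      using eta by (simp add: pos_le_divide_eq)
    then show "\<bar>a - n\<bar> \<le> y * \<zeta> * \<theta> / \<tau> * D"
      using near(1) unfolding err by linarith
    show "V\<^sup>2 / (\<zeta> * \<theta>) * \<bar>p\<^sup>2 / q - 1\<bar> \<le> D * (7 * y)"
      using quotient_near_1(2)[OF p q y2] D W by (intro mult_mono) auto
  qed
  also have "\<dots> = (y * \<zeta> * \<theta> / \<tau> + 7 * y) * D"
    by (simp add: algebra_simps)
  finally have "\<bar>inner_tension t - D\<bar> / D \<le> y * \<zeta> * \<theta> / \<tau> + 7 * y"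
    using D(3) by (simp add: pos_divide_le_eq)
  moreover have "inner_tension t / D - 1 = (inner_tension t - D) / D"
    using D(3) by (simp add: diff_divide_distrib)
  ultimately have "\<bar>inner_tension t / D - 1\<bar> \<le> y * \<zeta> * \<theta> / \<tau> + 7 * y"
    using D(3) by simp
  also have "\<dots> \<le> y * \<zeta> * T / \<tau> + 7 * y"
    using y zeta \<theta> eta by (intro add_right_mono divide_right_mono mult_left_mono) auto
  also have "\<dots> = (2 * decay_const * T / \<tau> + 14 * decay_const / \<zeta>) * (B * \<theta> powr r)"
    using zeta by (simp add: C algebra_simps)
  also have "\<dots> \<le> estimate_const * (B * \<theta> powr r)"
    using estimate_const(5) Bt by (rule mult_right_mono)
  finally show "\<bar>inner_tension t / (n + V\<^sup>2 / (N1 - n)) - 1\<bar> \<le> estimate_const * B * (T - t) powr r"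
    unfolding D_def n by (simp add: \<theta>_def mult.assoc)
qed

end

lemma data_deviation_nonneg: "0 \<le> data_deviation N1 \<tau> \<zeta> \<sigma>0 \<sigma>1 r chi0 chi1"
  unfolding data_deviation_def Let_def by (rule SUP_upper2[of \<sigma>0]) auto

theorem theorem4p3:
  fixes N1 \<eta> \<tau> \<zeta> \<sigma>0 \<sigma>1 r T :: real
  assumes "N1 > 1" and "0 < \<eta>" and "\<eta> < N1" and "\<eta> < \<tau>" and "\<tau> < N1"
    and "\<zeta> > 0" and "T = (N1 - \<tau>) / \<zeta>"
    and "\<sigma>0 > 0" and "\<sigma>1 > 1" and "r > 0"
  shows "\<exists>\<epsilon>0>0. \<exists>C>0. \<forall>\<epsilon><\<epsilon>0. \<forall>chi0 chi1 N0. \<forall>B::real.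
    classical_shock_data N1 \<eta> \<tau> \<zeta> chi0 chi1 N0 \<and> initial_shock_front N1 \<eta> \<tau> \<zeta> chi0 chi1 N0 = \<sigma>0 \<and>
    ereal B = data_deviation N1 \<tau> \<zeta> \<sigma>0 \<sigma>1 r chi0 chi1 \<and> B < \<epsilon> \<longrightarrow>
    final_time N1 \<eta> \<tau> \<zeta> chi0 chi1 N0 = ereal T \<and>
    (\<exists>chi N \<sigma>. unique_shock_solution N1 \<eta> \<tau> \<zeta> chi0 chi1 N0 chi N \<sigma> \<and>
      (\<exists>\<sigma>1inf>1. \<bar>\<sigma>1inf / \<sigma>1 - 1\<bar> \<le> C * \<epsilon> \<and>
        (\<forall>t\<in>{0..<T}.
          let E = ext_region \<sigma> {0..<T};
              V = (\<lambda>s. \<zeta> * (s - \<sigma>0) + \<sigma>1inf * (N1 - \<tau>));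
              n = \<zeta> * t + \<tau>
          in (SUP s\<in>{\<sigma> t..}. ereal (s powr (r + 2) *
                (\<bar>pd_s E (pd_s E chi) (s, t)\<bar> + \<bar>pd_t E (pd_s E chi) (s, t) - \<zeta>\<bar>)))
                \<le> ereal (C * B) \<and>
             (SUP s\<in>{\<sigma> t..}. ereal
                (\<bar>pd_s E chi (s, t) - n\<bar> + \<bar>pd_t E chi (s, t) - V s\<bar>))
                \<le> ereal (C * B * (T - t) powr (1 + r)) \<and>
             \<bar>deriv_on {0..<T} \<sigma> t / (V (\<sigma> t) / (N1 - n)) - 1\<bar> \<le> C * B * (T - t) powr r \<and>
             (SUP s\<in>{0..\<sigma> t}. ereal
                \<bar>int_trace \<sigma> N (s, t) / (n + (V (\<sigma> t))\<^sup>2 / (N1 - n)) - 1\<bar>)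
                \<le> ereal (C * B * (T - t) powr r))))"
proof -
  have "0 < T" "N1 = \<tau> + \<zeta> * T"
    using assms by auto
  then interpret shock_constants N1 \<eta> \<tau> \<zeta> \<sigma>0 \<sigma>1 r T
    using assms(2,4,6,8,9,10) by unfold_locales
  obtain e where e: "0 < e" and small: "\<And>B. 0 \<le> B \<Longrightarrow> B < e \<Longrightarrow> 2 * decay_const * B * T powr r \<le> \<zeta> / 2
      \<and> 2 * decay_const * B * T powr (r + 1) < \<tau> - \<eta>
      \<and> 4 * decay_const * B * T powr (r + 1) < \<zeta> * T * (lam - 1)
      \<and> (\<forall>c. \<bar>c - \<sigma>1 * \<zeta> * T\<bar> \<le> B \<longrightarrow> barrier_const * B < c - lam * \<zeta> * T)"
    using small_deviation by blast
  show ?thesis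
  proof (rule exI[of _ e], rule conjI[OF e], rule exI[of _ estimate_const], rule conjI[OF estimate_const(1)],
      intro allI impI, elim conjE)
    fix \<epsilon> chi0 chi1 N0 B
    assume \<epsilon>: "\<epsilon> < e" and shock: "classical_shock_data N1 \<eta> \<tau> \<zeta> chi0 chi1 N0"
      and front0: "initial_shock_front N1 \<eta> \<tau> \<zeta> chi0 chi1 N0 = \<sigma>0"
      and dev: "ereal B = data_deviation N1 \<tau> \<zeta> \<sigma>0 \<sigma>1 r chi0 chi1" and B\<epsilon>: "B < \<epsilon>"
    have init: "initial_front_conditions N1 \<eta> \<tau> \<zeta> chi0 chi1 N0 \<sigma>0"
      using shock front0 theI'[of "initial_front_conditions N1 \<eta> \<tau> \<zeta> chi0 chi1 N0"]
      unfolding classical_shock_data_def initial_shock_front_def by auto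
    have "0 \<le> B"
      using data_deviation_nonneg[of N1 \<tau> \<zeta> \<sigma>0 \<sigma>1 r chi0 chi1] dev[symmetric] by simp
    note sm = small[OF this less_trans[OF B\<epsilon> \<epsilon>]]
    have sm: "2 * decay_const * B * T powr r \<le> \<zeta> / 2" "2 * decay_const * B * T powr (r + 1) < \<tau> - \<eta>"
      "4 * decay_const * B * T powr (r + 1) < \<zeta> * T * (lam - 1)"
      "\<forall>c. \<bar>c - \<sigma>1 * \<zeta> * T\<bar> \<le> B \<longrightarrow> barrier_const * B < c - lam * \<zeta> * T"
      using sm by auto
    obtain P P1 P2 Q Q1 Q2 c where sd: "shock_data N1 \<eta> \<tau> \<zeta> \<sigma>0 \<sigma>1 r T P P1 P2 Q Q1 Q2 B c"
      and data: "\<And>s. \<sigma>0 \<le> s \<Longrightarrow> chi0 s = P s + Q s"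
        "\<And>s. \<sigma>0 \<le> s \<Longrightarrow> right_trace \<sigma>0 chi1 s = P1 s - Q1 s"
      and c: "\<bar>c - \<sigma>1 * \<zeta> * T\<bar> \<le> B"
      by (rule shock_data_of_initial_data[OF init dev[symmetric] sm]) (rule that)
    interpret shock_data N1 \<eta> \<tau> \<zeta> \<sigma>0 \<sigma>1 r T P P1 P2 Q Q1 Q2 B c
      by (rule sd)
    have J: "time_window {0..<T}" by (simp add: time_window_def)
    define \<sigma>1inf where "\<sigma>1inf = c / (\<zeta> * T)"
    have zT: "0 < \<zeta> * T" using zeta T by simp
    have N1\<tau>: "\<sigma>1inf * (N1 - \<tau>) = c"
      using zeta T by (simp add: \<sigma>1inf_def N1)
    have "1 < \<sigma>1inf"
      using c_bounds(2) zT by (simp add: \<sigma>1inf_def)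
    moreover have "\<bar>\<sigma>1inf / \<sigma>1 - 1\<bar> \<le> estimate_const * \<epsilon>"
    proof -
      have pos: "0 < \<sigma>1 * \<zeta> * T" using sigma1 zeta T by simp
      have "\<sigma>1inf / \<sigma>1 - 1 = (c - \<sigma>1 * \<zeta> * T) * (1 / (\<sigma>1 * \<zeta> * T))"
        using sigma1 zeta T by (simp add: \<sigma>1inf_def divide_simps)
      then have "\<bar>\<sigma>1inf / \<sigma>1 - 1\<bar> = \<bar>c - \<sigma>1 * \<zeta> * T\<bar> * (1 / (\<sigma>1 * \<zeta> * T))"
        using pos by (simp only: abs_mult) simp
      also have "\<dots> \<le> \<epsilon> * estimate_const"
        using c B\<epsilon> pos estimate_const(6) by (intro mult_mono) auto
      finally show ?thesis by (simp add: mult.commute)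
    qed
    moreover have "let E = ext_region front {0..<T};
              V = (\<lambda>s. \<zeta> * (s - \<sigma>0) + \<sigma>1inf * (N1 - \<tau>));
              n = \<zeta> * t + \<tau>
          in (SUP s\<in>{front t..}. ereal (s powr (r + 2) *
                (\<bar>pd_s E (pd_s E position) (s, t)\<bar> + \<bar>pd_t E (pd_s E position) (s, t) - \<zeta>\<bar>)))
                \<le> ereal (estimate_const * B) \<and>
             (SUP s\<in>{front t..}. ereal
                (\<bar>pd_s E position (s, t) - n\<bar> + \<bar>pd_t E position (s, t) - V s\<bar>))
                \<le> ereal (estimate_const * B * (T - t) powr (1 + r)) \<and>
             \<bar>deriv_on {0..<T} front t / (V (front t) / (N1 - n)) - 1\<bar> \<le> estimate_const * B * (T - t) powr r \<and>
             (SUP s\<in>{0..front t}. ereal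
                \<bar>int_trace front tension (s, t) / (n + (V (front t))\<^sup>2 / (N1 - n)) - 1\<bar>)
                \<le> ereal (estimate_const * B * (T - t) powr r)" if t: "t \<in> {0..<T}" for t
    proof -
      have t': "0 \<le> t" "t < T" using t by auto
      have E: "(s, t) \<in> ext_region front {0..<T}" if "front t \<le> s" for s
        using that t by (simp add: ext_region_def)
      note pos = position_partials(2-5)[OF J E]
      show ?thesis
        unfolding Let_def N1\<tau>
      proof (intro conjI SUP_least)
        fix s assume "s \<in> {front t..}"
        then have s: "front t \<le> s" by simp
        note ahead = ahead_of_front[OF J E[OF s]]
        show "ereal (s powr (r + 2) * (\<bar>pd_s (ext_region front {0..<T}) (pd_s (ext_region front {0..<T}) position) (s, t)\<bar>
            + \<bar>pd_t (ext_region front {0..<T}) (pd_s (ext_region front {0..<T}) position) (s, t) - \<zeta>\<bar>))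
            \<le> ereal (estimate_const * B)"
          using second_derivative_estimate[OF ahead(1,2,5)] pos[OF s] by simp
        show "ereal (\<bar>pd_s (ext_region front {0..<T}) position (s, t) - (\<zeta> * t + \<tau>)\<bar>
            + \<bar>pd_t (ext_region front {0..<T}) position (s, t) - (\<zeta> * (s - \<sigma>0) + c)\<bar>)
            \<le> ereal (estimate_const * B * (T - t) powr (1 + r))"
          using first_derivative_estimate[OF ahead(1,2,3)] pos[OF s] by simp
      next
        show "\<bar>deriv_on {0..<T} front t / ((\<zeta> * (front t - \<sigma>0) + c) / (N1 - (\<zeta> * t + \<tau>))) - 1\<bar>
            \<le> estimate_const * B * (T - t) powr r"
          using speed_estimate[OF t'] front_deriv_window(2)[OF J t] by simp
      next
        fix s assume "s \<in> {0..front t}"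
        then show "ereal \<bar>int_trace front tension (s, t) / (\<zeta> * t + \<tau> + (\<zeta> * (front t - \<sigma>0) + c)\<^sup>2 / (N1 - (\<zeta> * t + \<tau>))) - 1\<bar>
            \<le> ereal (estimate_const * B * (T - t) powr r)"
          using inner_tension_estimate[OF t'] int_trace_tension[of s t] by simp
      qed
    qed
    ultimately show "final_time N1 \<eta> \<tau> \<zeta> chi0 chi1 N0 = ereal T \<and>
      (\<exists>chi N \<sigma>. unique_shock_solution N1 \<eta> \<tau> \<zeta> chi0 chi1 N0 chi N \<sigma> \<and>
      (\<exists>\<sigma>1inf>1. \<bar>\<sigma>1inf / \<sigma>1 - 1\<bar> \<le> estimate_const * \<epsilon> \<and>
        (\<forall>t\<in>{0..<T}.
          let E = ext_region \<sigma> {0..<T};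
              V = (\<lambda>s. \<zeta> * (s - \<sigma>0) + \<sigma>1inf * (N1 - \<tau>));
              n = \<zeta> * t + \<tau>
          in (SUP s\<in>{\<sigma> t..}. ereal (s powr (r + 2) *
                (\<bar>pd_s E (pd_s E chi) (s, t)\<bar> + \<bar>pd_t E (pd_s E chi) (s, t) - \<zeta>\<bar>)))
                \<le> ereal (estimate_const * B) \<and>
             (SUP s\<in>{\<sigma> t..}. ereal
                (\<bar>pd_s E chi (s, t) - n\<bar> + \<bar>pd_t E chi (s, t) - V s\<bar>))
                \<le> ereal (estimate_const * B * (T - t) powr (1 + r)) \<and>
             \<bar>deriv_on {0..<T} \<sigma> t / (V (\<sigma> t) / (N1 - n)) - 1\<bar> \<le> estimate_const * B * (T - t) powr r \<and>
             (SUP s\<in>{0..\<sigma> t}. ereal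
                \<bar>int_trace \<sigma> N (s, t) / (n + (V (\<sigma> t))\<^sup>2 / (N1 - n)) - 1\<bar>)
                \<le> ereal (estimate_const * B * (T - t) powr r))))"
      using final_time_eq[OF front0 data] unique_solution[OF front0 data] by blast
  qed
qed

end
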